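(* Let $G$ be an alternating decomposition graph. (1) If $G$ is a collection of isolated vertices, then $g_T(G)=0$. (2) Suppose that $G$ contains a set of parallel edges $\{e_1,e_2\}$. Let $G'=G-\{e_1,e_2\}$ and $G''=G/\{e_1,e_2\}$. If $k(G)=k(G')$, then $g_T(G')=g_T(G)-1$, and if $k(G')=k(G)+1$, then $g_T(G')=g_T(G'')=g_T(G)$. (3) Suppose that $G$ contains a vertex $v$ of degree two, incident to edges $e_1$ and $e_2$. Let $G'=G/\{e_1,e_2\}$. Then $g_T(G')=g_T(G)$.
   Context: Graphs are finite and may have multiple edges. A link diagram $D$ is viewed as a $4$-valent graph on the sphere $S^2$ with over/under information at the vertices (crossings). An edge of $D$ is non-alternating if both of its ends are over-strands or both are under-strands at the crossings they meet; otherwise it is alternating. A diagram is alternating if all its edges are alternating. Alternating decomposition graph of $D$: for a connected diagram $D$, mark two distinct points on every non-alternating edge, and inside each face join by disjoint arcs those pairs of marked points that are adjacent along the boundary of the face but do not lie on the same edge of $D$; the arcs form disjoint simple closed curves $\gamma_1,\dots,\gamma_m$. If $D$ is connected and alternating, its alternating decomposition graph is a single vertex. If $D$ is connected and not alternating, the graph has vertices $v_1,\dots,v_m$ corresponding to the curves and one edge for each non-alternating edge of $D$, joining $v_i$ and $v_j$ where $\gamma_i,\gamma_j$ are the curves through the two marked points. For disconnected $D$ take the disjoint union over connected components. An alternating decomposition graph is a graph arising in this way; equivalently, it is a planar bipartite graph all of whose vertices have even degree. For a link diagram $D$, $g_T(D)=\frac12\bigl(2k(D)+c(D)-s_A(D)-s_B(D)\bigr)$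 is the genus of its Turaev surface, where $k(D)$ is the number of connected components of $D$ as a graph, $c(D)$ the number of crossings, and $s_A(D),s_B(D)$ the numbers of curves in the all-$A$ and all-$B$ states. For an alternating decomposition graph $G$, $g_T(G):=g_T(D)$ for any diagram $D$ with alternating decomposition graph $G$ (this is independent of $D$). All graphs whose Turaev genus appears in the claim are alternating decomposition graphs, so that $g_T$ is defined. $k(\cdot)$ denotes the number of connected components of a graph. Edges $e_1\ne e_2$ are parallel if they have the same two endpoints. $G-\{e_1,e_2\}$ is edge deletion; $G/\{e_1,e_2\}$ is obtained by identifying the endpoints of $e_1$ and of $e_2$ and deleting $e_1,e_2$. *)

theory Defs
  imports Complex_Main "HOL-Combinatorics.Permutations" "HOL-Combinatorics.Orbits"
begin

text \<open>Classes of the equivalence relation on \<open>S\<close> generated by the restriction of \<open>R\<close> to \<open>S\<close>.\<close>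

definition gen_classes :: "'a set \<Rightarrow> ('a \<times> 'a) set \<Rightarrow> 'a set set" where
  "gen_classes S R = S // (Restr R S \<union> (Restr R S)\<inverse>)\<^sup>*"


section \<open>Multigraphs\<close>

text \<open>The set \<open>ends G e\<close> has two elements, or one if \<open>e\<close> is a loop.\<close>

record ('v, 'e) mgraph =
  verts :: "'v set"
  edges :: "'e set"
  ends  :: "'e \<Rightarrow> 'v set"

definition mgraph_iso :: "('v, 'e) mgraph \<Rightarrow> ('w, 'f) mgraph \<Rightarrow> bool" where
  "mgraph_iso G H \<longleftrightarrow>
    (\<exists>\<phi> \<psi>. bij_betw \<phi> (verts G) (verts H) \<and> bij_betw \<psi> (edges G) (edges H) \<and>
           (\<forall>e\<in>edges G. ends G e \<subseteq> verts G \<and> ends H (\<psi> e) = \<phi> ` ends G e))"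

definition joined_by :: "('v, 'e) mgraph \<Rightarrow> 'e set \<Rightarrow> ('v \<times> 'v) set" where
  "joined_by G F = {(u, v). \<exists>e\<in>F. u \<in> ends G e \<and> v \<in> ends G e}"

definition num_components :: "('v, 'e) mgraph \<Rightarrow> nat" where
  "num_components G = card (gen_classes (verts G) (joined_by G (edges G)))"

definition degree :: "('v, 'e) mgraph \<Rightarrow> 'v \<Rightarrow> nat" where
  "degree G v = card {e \<in> edges G. v \<in> ends G e} + card {e \<in> edges G. ends G e = {v}}"

definition parallel_edges :: "('v, 'e) mgraph \<Rightarrow> 'e \<Rightarrow> 'e \<Rightarrow> bool" where
  "parallel_edges G e1 e2 \<longleftrightarrow>
    e1 \<in> edges G \<and> e2 \<in> edges G \<and> e1 \<noteq> e2 \<and> ends G e1 = ends G e2"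

definition delete_edges :: "('v, 'e) mgraph \<Rightarrow> 'e set \<Rightarrow> ('v, 'e) mgraph" where
  "delete_edges G F = G\<lparr>edges := edges G - F\<rparr>"

text \<open>A vertex of the contraction is the set of vertices of \<open>G\<close> that are identified to it.\<close>

definition contract_edges :: "('v, 'e) mgraph \<Rightarrow> 'e set \<Rightarrow> ('v set, 'e) mgraph" where
  "contract_edges G F =
    \<lparr>verts = gen_classes (verts G) (joined_by G F),
     edges = edges G - F,
     ends = (\<lambda>e. {X \<in> gen_classes (verts G) (joined_by G F). X \<inter> ends G e \<noteq> {}})\<rparr>"


section \<open>Link diagrams\<close>

text \<open>
  The 4-valent graph of a diagram is encoded as a combinatorial map. A dart is an edge
  together with one of its two ends; \<open>rot D\<close> sends a dart to the counterclockwise next dart at the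
  same crossing, and \<open>opp D\<close> sends it to the other dart of its edge. The set \<open>over D\<close> consists of the
  darts belonging to over-strands. Crossingless components, which are circles without vertices,
  are only counted, by \<open>circles D\<close>. The position of the connected components of a diagram relative to
  each other is not recorded, since no notion below depends on it.
\<close>

record 'd diagram =
  darts   :: "'d set"
  rot     :: "'d \<Rightarrow> 'd"
  opp     :: "'d \<Rightarrow> 'd"
  over    :: "'d set"
  circles :: nat

definition crossings :: "'d diagram \<Rightarrow> 'd set set" where
  "crossings D = orbit (rot D) ` darts D"

definition dart_edges :: "'d diagram \<Rightarrow> 'd set set" where
  "dart_edges D = (\<lambda>d. {d, opp D d}) ` darts D"

text \<open>Traverse the edge of \<open>d\<close> away from \<open>d\<close>, then turn into the next edge along the face that
  lies to the right.\<close>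

definition face_next :: "'d diagram \<Rightarrow> 'd \<Rightarrow> 'd" where
  "face_next D d = rot D (opp D d)"

definition faces :: "'d diagram \<Rightarrow> 'd set set" where
  "faces D = orbit (face_next D) ` darts D"

definition edge_rel :: "'d diagram \<Rightarrow> ('d \<times> 'd) set" where
  "edge_rel D = {(d, opp D d) | d. d \<in> darts D}"

definition dart_components :: "'d diagram \<Rightarrow> 'd set set" where
  "dart_components D = gen_classes (darts D) (edge_rel D \<union> {(d, rot D d) | d. d \<in> darts D})"

text \<open>
  Every component of a combinatorial map has Euler characteristic at most 2, with equality exactly
  for the sphere, so the last equation says that every component lies on a sphere.
\<close>

definition link_diagram :: "'d diagram \<Rightarrow> bool" where
  "link_diagram D \<longleftrightarrow>
     finite (darts D) \<and> rot D permutes darts D \<and> opp D permutes darts D \<and> over D \<subseteq> darts D \<and>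
     (\<forall>d\<in>darts D. card (orbit (rot D) d) = 4) \<and>
     (\<forall>d\<in>darts D. opp D d \<noteq> d \<and> opp D (opp D d) = d) \<and>
     (\<forall>d\<in>darts D. rot D d \<in> over D \<longleftrightarrow> d \<notin> over D) \<and>
     int (card (crossings D)) - int (card (dart_edges D)) + int (card (faces D))
       = 2 * int (card (dart_components D))"

text \<open>
  The \<open>A\<close>-regions of a crossing are swept out by turning the over-strand counterclockwise, so they
  are the corners between an over-dart \<open>d\<close> and \<open>rot D d\<close>. The \<open>A\<close>-smoothing merges these two corners
  and hence joins each under-dart to its counterclockwise successor; the \<open>B\<close>-smoothing joins each
  over-dart to its counterclockwise successor.
\<close>

definition states_A :: "'d diagram \<Rightarrow> 'd set set" where
  "states_A D = gen_classes (darts D) (edge_rel D \<union> {(d, rot D d) | d. d \<in> darts D - over D})"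

definition states_B :: "'d diagram \<Rightarrow> 'd set set" where
  "states_B D = gen_classes (darts D) (edge_rel D \<union> {(d, rot D d) | d. d \<in> over D})"

definition diagram_turaev_genus :: "'d diagram \<Rightarrow> rat" where
  "diagram_turaev_genus D =
    (let k  = card (dart_components D) + circles D;
         c  = card (crossings D);
         sA = card (states_A D) + circles D;
         sB = card (states_B D) + circles D
     in (2 * of_nat k + of_nat c - of_nat sA - of_nat sB) / 2)"


section \<open>Alternating decomposition graphs\<close>

text \<open>
  A non-alternating edge carries two marked points, one near each of its ends, so the darts in
  \<open>nonalt D\<close> also serve as the marked points.
\<close>

definition nonalt :: "'d diagram \<Rightarrow> 'd set" where
  "nonalt D = {d \<in> darts D. d \<in> over D \<longleftrightarrow> opp D d \<in> over D}"

text \<open>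
  Following the boundary of a face along the non-alternating edge of \<open>d\<close>, one meets the marked points
  \<open>d\<close> and \<open>opp D d\<close>; the marked point met next is the first non-alternating dart \<open>e\<close> after \<open>d\<close> in the
  orbit of \<open>face_next D\<close>. Inside the face, \<open>opp D d\<close> and \<open>e\<close> are joined by an arc.
\<close>

definition arcs :: "'d diagram \<Rightarrow> ('d \<times> 'd) set" where
  "arcs D = {(opp D d, e) | d e. d \<in> nonalt D \<and> e \<in> nonalt D \<and> e \<notin> {d, opp D d} \<and>
     (\<exists>n>0. e = (face_next D ^^ n) d \<and> (\<forall>m. 0 < m \<and> m < n \<longrightarrow> (face_next D ^^ m) d \<notin> nonalt D))}"

definition curves :: "'d diagram \<Rightarrow> 'd set set" where
  "curves D = gen_classes (nonalt D) (arcs D)"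

text \<open>
  The vertices are the curves in the non-alternating components and one vertex for each alternating
  component, with or without crossings. Arcs do not leave a component, so this is the disjoint union
  over the components.
\<close>

datatype 'd ad_vertex = Curve "'d set" | Alt "'d set" | Circle nat

definition ad_graph :: "'d diagram \<Rightarrow> ('d ad_vertex, 'd set) mgraph" where
  "ad_graph D =
    \<lparr>verts = Curve ` curves D
           \<union> Alt ` {K \<in> dart_components D. K \<inter> nonalt D = {}}
           \<union> Circle ` {..<circles D},
     edges = (\<lambda>d. {d, opp D d}) ` nonalt D,
     ends = (\<lambda>e. Curve ` {\<gamma> \<in> curves D. \<gamma> \<inter> e \<noteq> {}})\<rparr>"

text \<open>Diagrams have finitely many darts, so darts in \<open>nat\<close> are no restriction.\<close>

definition has_ad_graph :: "nat diagram \<Rightarrow> ('v, 'e) mgraph \<Rightarrow> bool" where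
  "has_ad_graph D G \<longleftrightarrow> link_diagram D \<and> mgraph_iso (ad_graph D) G"

definition alternating_decomposition_graph :: "('v, 'e) mgraph \<Rightarrow> bool" where
  "alternating_decomposition_graph G \<longleftrightarrow> (\<exists>D. has_ad_graph D G)"

definition turaev_genus :: "('v, 'e) mgraph \<Rightarrow> rat" where
  "turaev_genus G = (THE g. \<exists>D. has_ad_graph D G \<and> g = diagram_turaev_genus D)"

end

theory Submission
  imports Defs
begin

text \<open>
  For a diagram \<open>D\<close> on the sphere, Euler's formula turns \<open>2 g\<^sub>T(D)\<close> into the number of faces minus the
  number of curves in the all-A and all-B states. Contracting an alternating edge changes neither
  term, so only a plane map remains whose edges are all non-alternating and whose graph is the
  alternating decomposition graph \<open>G\<close>; its state curves are its Petrie walks. Deleting two parallel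
  edges preserves the number of Petrie walks: cutting the sphere along them leaves two paths of
  walks on each side, and both ways of joining them give equally many closed curves. The same
  number survives contraction at a vertex of degree two, and drops by one when two components are
  glued at a vertex.

  A plane map with even faces and without isolated vertices has a face of length two or a
  vertex of degree two, so these reductions determine the number of Petrie walks from the abstract
  graph, which makes \<open>g\<^sub>T(G)\<close> independent of \<open>D\<close>. Conversely, every such map comes from a link diagram:
  expand its vertices, by inserting alternating edges, into vertices of degree four.
\<close>

text \<open>The sphere enters only through permutations of darts. The Jordan curve theorem is
  replaced by the inequality \<open>defect\<close> \<ge> 0: a cut that keeps the number of faces and
  raises the numbers of vertices and edges by two in total must raise the number of components, so
  it separates. The absence of loops and the separation by two parallel edges both rest on this.
  Walks are never traced: a piece of a cut walk has an even number of ends, and the half of the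
  sphere and the state (A or B) of an end leave one candidate for its partner.

  Contraction is awkward for rotations, but it is mere removal of darts from the face permutation,
  that is, deletion in the dual. A vertex that loses its last dart becomes invisible to a map; hence
  isolated vertices are counted apart, and the sum of curves and isolated vertices is what stays
  invariant under deletion.

  The count belongs to the abstract graph, whose embeddings can differ. Two embeddings are compared
  by performing on both the reduction that one of them exhibits, so the effect of a reduction is
  stated in terms of the edges of the graph alone.\<close>

section \<open>Classes of generated equivalence relations\<close>

text \<open>The relation is reflexive on the whole type: points outside \<open>S\<close> form
  singleton classes, so reflexivity, symmetry and transitivity carry no membership premises.\<close>

definition gen_eq :: "'a set \<Rightarrow> ('a \<times> 'a) set \<Rightarrow> ('a \<times> 'a) set" where
  "gen_eq S R = (Restr R S \<union> (Restr R S)\<inverse>)\<^sup>*"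

abbreviation ncl :: "'a set \<Rightarrow> ('a \<times> 'a) set \<Rightarrow> nat" where
  "ncl S R \<equiv> card (gen_classes S R)"

lemma gen_classes_eq: "gen_classes S R = (\<lambda>x. gen_eq S R `` {x}) ` S"
  by (auto simp: gen_classes_def gen_eq_def quotient_def)

lemma gen_eq_refl [simp, intro]: "(x, x) \<in> gen_eq S R"
  by (simp add: gen_eq_def)

lemma gen_eq_sym: "(x, y) \<in> gen_eq S R \<Longrightarrow> (y, x) \<in> gen_eq S R"
proof -
  have "sym (gen_eq S R)"
    unfolding gen_eq_def by (rule sym_rtrancl) (auto simp: sym_def)
  then show "(x, y) \<in> gen_eq S R \<Longrightarrow> (y, x) \<in> gen_eq S R"
    by (simp add: symD)
qed

lemma gen_eq_trans [trans]: "(x, y) \<in> gen_eq S R \<Longrightarrow> (y, z) \<in> gen_eq S R \<Longrightarrow> (x, z) \<in> gen_eq S R"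
  unfolding gen_eq_def by (rule rtrancl_trans)

lemma gen_eq_base: "(a, b) \<in> R \<Longrightarrow> a \<in> S \<Longrightarrow> b \<in> S \<Longrightarrow> (a, b) \<in> gen_eq S R"
  unfolding gen_eq_def by auto

lemma gen_eq_map:
  assumes "(x, y) \<in> gen_eq S R"
    and "\<And>a b. (a, b) \<in> R \<Longrightarrow> a \<in> S \<Longrightarrow> b \<in> S \<Longrightarrow> (f a, f b) \<in> gen_eq T R'"
  shows "(f x, f y) \<in> gen_eq T R'"
  using assms(1) unfolding gen_eq_def[of S R]
proof (induction rule: rtrancl_induct)
  case base
  show ?case by simp
next
  case (step y z)
  then have "(f y, f z) \<in> gen_eq T R'"
    using assms(2) by (auto intro: gen_eq_sym)
  with step.IH show ?case by (rule gen_eq_trans)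
qed

lemma gen_eq_mono:
  assumes "(x, y) \<in> gen_eq S R"
    and "\<And>a b. (a, b) \<in> R \<Longrightarrow> a \<in> S \<Longrightarrow> b \<in> S \<Longrightarrow> (a, b) \<in> gen_eq T R'"
  shows "(x, y) \<in> gen_eq T R'"
  using gen_eq_map[OF assms(1), of id T R'] assms(2) by simp

lemma gen_eq_invariant:
  assumes "(x, y) \<in> gen_eq S R"
    and "\<And>a b. (a, b) \<in> R \<Longrightarrow> a \<in> S \<Longrightarrow> b \<in> S \<Longrightarrow> h a = h b"
  shows "h x = h y"
  using assms(1) unfolding gen_eq_def
  by (induction rule: rtrancl_induct) (use assms(2) in auto)

lemma gen_eq_closed: "(x, y) \<in> gen_eq S R \<Longrightarrow> x \<in> S \<longleftrightarrow> y \<in> S"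
  by (erule gen_eq_invariant) simp

lemma gen_eq_class_eq_iff: "gen_eq S R `` {x} = gen_eq S R `` {y} \<longleftrightarrow> (x, y) \<in> gen_eq S R"
  by (auto intro: gen_eq_trans gen_eq_sym)

lemma finite_gen_classes: "finite S \<Longrightarrow> finite (gen_classes S R)"
  by (simp add: gen_classes_eq)

text \<open>Maps that respect the generating pairs and are mutually inverse up to equivalence induce
  inverse bijections between the classes. Neither map has to be injective, so darts can be collapsed
  onto neighbours; most comparisons of curve counts below have this form.\<close>

lemma ncl_equiv:
  assumes f: "\<And>x. x \<in> S \<Longrightarrow> f x \<in> T" and g: "\<And>y. y \<in> T \<Longrightarrow> g y \<in> S"
    and fR: "\<And>a b. (a, b) \<in> R \<Longrightarrow> a \<in> S \<Longrightarrow> b \<in> S \<Longrightarrow> (f a, f b) \<in> gen_eq T R'"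
    and gR: "\<And>a b. (a, b) \<in> R' \<Longrightarrow> a \<in> T \<Longrightarrow> b \<in> T \<Longrightarrow> (g a, g b) \<in> gen_eq S R"
    and gf: "\<And>x. x \<in> S \<Longrightarrow> (g (f x), x) \<in> gen_eq S R"
    and fg: "\<And>y. y \<in> T \<Longrightarrow> (f (g y), y) \<in> gen_eq T R'"
  shows "ncl S R = ncl T R'"
proof -
  let ?F = "\<lambda>X. gen_eq T R' `` (f ` (X \<inter> S))"
  have F: "?F (gen_eq S R `` {x}) = gen_eq T R' `` {f x}" if "x \<in> S" for x
  proof -
    have "(f x, f z) \<in> gen_eq T R'" if "(x, z) \<in> gen_eq S R" for z
      using gen_eq_map[OF that, of f] fR by blast
    then show ?thesis
      using \<open>x \<in> S\<close> by (auto intro: gen_eq_trans)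
  qed
  have inj: "(x, y) \<in> gen_eq S R" if "(f x, f y) \<in> gen_eq T R'" "x \<in> S" "y \<in> S" for x y
  proof -
    have "(g (f x), g (f y)) \<in> gen_eq S R"
      using gen_eq_map[OF that(1), of g] gR by blast
    then show ?thesis
      using gf[OF that(2)] gf[OF that(3)] by (meson gen_eq_trans gen_eq_sym)
  qed
  have "bij_betw ?F (gen_classes S R) (gen_classes T R')"
  proof (rule bij_betw_imageI)
    show "inj_on ?F (gen_classes S R)"
    proof (rule inj_onI)
      fix X Y assume "X \<in> gen_classes S R" "Y \<in> gen_classes S R" and eq: "?F X = ?F Y"
      then obtain x y where x: "x \<in> S" "X = gen_eq S R `` {x}" and y: "y \<in> S" "Y = gen_eq S R `` {y}"
        by (auto simp: gen_classes_eq)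
      then have "gen_eq T R' `` {f x} = gen_eq T R' `` {f y}" using eq F by metis
      then show "X = Y" using x y inj gen_eq_class_eq_iff by metis
    qed
    have "?F ` gen_classes S R = (\<lambda>x. gen_eq T R' `` {f x}) ` S"
      unfolding gen_classes_eq image_image by (rule image_cong) (auto simp: F)
    also have "\<dots> = gen_classes T R'"
      unfolding gen_classes_eq
    proof (intro set_eqI iffI)
      fix X assume "X \<in> (\<lambda>x. gen_eq T R' `` {x}) ` T"
      then obtain y where y: "y \<in> T" "X = gen_eq T R' `` {y}" by auto
      then have "X = gen_eq T R' `` {f (g y)}"
        using fg[of y] gen_eq_class_eq_iff by metis
      then show "X \<in> (\<lambda>x. gen_eq T R' `` {f x}) ` S" using g y by blast
    qed (use f in auto)
    finally show "?F ` gen_classes S R = gen_classes T R'" .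
  qed
  then show ?thesis by (rule bij_betw_same_card)
qed

lemma gen_eq_cong:
  assumes "\<And>a b. (a, b) \<in> R \<Longrightarrow> a \<in> S \<Longrightarrow> b \<in> S \<Longrightarrow> (a, b) \<in> gen_eq S R'"
    and "\<And>a b. (a, b) \<in> R' \<Longrightarrow> a \<in> S \<Longrightarrow> b \<in> S \<Longrightarrow> (a, b) \<in> gen_eq S R"
  shows "gen_eq S R = gen_eq S R'"
  using gen_eq_mono[of _ _ S R S R'] gen_eq_mono[of _ _ S R' S R] assms by auto

lemma ncl_cong:
  assumes "\<And>a b. (a, b) \<in> R \<Longrightarrow> a \<in> S \<Longrightarrow> b \<in> S \<Longrightarrow> (a, b) \<in> gen_eq S R'"
    and "\<And>a b. (a, b) \<in> R' \<Longrightarrow> a \<in> S \<Longrightarrow> b \<in> S \<Longrightarrow> (a, b) \<in> gen_eq S R"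
  shows "ncl S R = ncl S R'"
  using gen_eq_cong[OF assms] by (simp add: gen_classes_eq)

lemma ncl_mono:
  assumes "finite S"
    and "\<And>a b. (a, b) \<in> R \<Longrightarrow> a \<in> S \<Longrightarrow> b \<in> S \<Longrightarrow> (a, b) \<in> gen_eq S R'"
  shows "ncl S R' \<le> ncl S R"
proof -
  let ?F = "\<lambda>X. gen_eq S R' `` X"
  have F: "?F (gen_eq S R `` {x}) = gen_eq S R' `` {x}" for x
    by (auto intro: gen_eq_trans dest: gen_eq_mono[where R' = R' and T = S] assms(2))
  have "gen_classes S R' = ?F ` gen_classes S R"
    unfolding gen_classes_eq image_image F ..
  then show ?thesis
    using card_image_le[OF finite_gen_classes[OF assms(1)]] by metis
qed

text \<open>A chain that uses the new pair repeatedly can be shortened until it uses the pair at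
  most once, in one of the two directions.\<close>

lemma gen_eq_insert:
  assumes "(x, y) \<in> gen_eq S (insert (a, b) R)"
  shows "(x, y) \<in> gen_eq S R \<or>
    (x, a) \<in> gen_eq S R \<and> (b, y) \<in> gen_eq S R \<or> (x, b) \<in> gen_eq S R \<and> (a, y) \<in> gen_eq S R"
  using assms unfolding gen_eq_def[of S "insert (a, b) R"]
proof (induction rule: rtrancl_induct)
  case base
  show ?case by simp
next
  case (step y z)
  then have "(y, z) \<in> gen_eq S R \<or> y = a \<and> z = b \<or> y = b \<and> z = a"
    by (auto intro: gen_eq_base gen_eq_sym)
  with step.IH show ?case
    by (meson gen_eq_trans gen_eq_refl gen_eq_sym)
qed

lemma ncl_insert_same:
  assumes "(a, b) \<in> gen_eq S R"
  shows "ncl S (insert (a, b) R) = ncl S R"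
  by (rule ncl_cong) (use assms in \<open>auto intro: gen_eq_base\<close>)

lemma ncl_insert_diff:
  assumes "finite S" "a \<in> S" "b \<in> S" and ab: "(a, b) \<notin> gen_eq S R"
  shows "ncl S (insert (a, b) R) + 1 = ncl S R"
proof -
  let ?c = "\<lambda>x. gen_eq S R `` {x}" and ?d = "\<lambda>x. gen_eq S (insert (a, b) R) `` {x}"
  let ?C = "gen_classes S R"
  have sub: "(x, y) \<in> gen_eq S (insert (a, b) R)" if "(x, y) \<in> gen_eq S R" for x y
    using that by (rule gen_eq_mono) (auto intro: gen_eq_base)
  have ab': "(a, b) \<in> gen_eq S (insert (a, b) R)"
    using assms by (auto intro: gen_eq_base)
  have dc: "?d x = ?c x" if "(x, a) \<notin> gen_eq S R" "(x, b) \<notin> gen_eq S R" for x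
    using that gen_eq_insert sub by fast
  have dab: "?d x = ?c a \<union> ?c b" if "(x, a) \<in> gen_eq S R \<or> (x, b) \<in> gen_eq S R" for x
  proof -
    have "?d x = ?d a"
      using that ab' sub gen_eq_class_eq_iff by (metis gen_eq_sym gen_eq_trans)
    moreover have "?d a = ?c a \<union> ?c b"
      using gen_eq_insert[of a _ S a b R] sub ab' by (auto intro: gen_eq_trans)
    ultimately show ?thesis by simp
  qed
  have eq: "gen_classes S (insert (a, b) R) = insert (?c a \<union> ?c b) (?C - {?c a, ?c b})"
  proof (intro set_eqI iffI)
    fix X assume "X \<in> gen_classes S (insert (a, b) R)"
    then obtain x where x: "x \<in> S" "X = ?d x" by (auto simp: gen_classes_eq)
    show "X \<in> insert (?c a \<union> ?c b) (?C - {?c a, ?c b})"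
    proof (cases "(x, a) \<in> gen_eq S R \<or> (x, b) \<in> gen_eq S R")
      case True
      then show ?thesis using dab x by simp
    next
      case False
      then show ?thesis using dc x gen_eq_class_eq_iff[of S R x] by (auto simp: gen_classes_eq)
    qed
  next
    fix X assume "X \<in> insert (?c a \<union> ?c b) (?C - {?c a, ?c b})"
    then consider "X = ?c a \<union> ?c b" | x where "x \<in> S" "X = ?c x" "?c x \<noteq> ?c a" "?c x \<noteq> ?c b"
      by (auto simp: gen_classes_eq)
    then show "X \<in> gen_classes S (insert (a, b) R)"
    proof cases
      case 1
      then show ?thesis using dab[of a] assms(2) by (auto simp: gen_classes_eq)
    next
      case 2
      then show ?thesis using dc gen_eq_class_eq_iff[of S R x] by (auto simp: gen_classes_eq)
    qed
  qed
  have new: "?c a \<union> ?c b \<notin> ?C - {?c a, ?c b}"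
  proof
    assume "?c a \<union> ?c b \<in> ?C - {?c a, ?c b}"
    then obtain x where "?c a \<union> ?c b = ?c x" by (auto simp: gen_classes_eq)
    then have "(x, a) \<in> gen_eq S R" "(x, b) \<in> gen_eq S R" by auto
    then show False using ab by (meson gen_eq_sym gen_eq_trans)
  qed
  have "?c a \<noteq> ?c b" using ab gen_eq_class_eq_iff by metis
  then have "card {?c a, ?c b} = 2" by (rule card_2_iff[THEN iffD2, OF exI, OF exI, OF conjI, OF refl])
  moreover have sub2: "{?c a, ?c b} \<subseteq> ?C" using assms by (auto simp: gen_classes_eq)
  ultimately have "card ?C = card (?C - {?c a, ?c b}) + 2"
    using card_mono[OF finite_gen_classes[OF assms(1)] sub2] card_Diff_subset[OF _ sub2] by simp
  then show ?thesis
    using eq new finite_gen_classes[OF assms(1), of R] by simp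
qed

lemma ncl_insert_cases:
  assumes "finite S" "a \<in> S" "b \<in> S"
  shows "ncl S (insert (a, b) R) + (if (a, b) \<in> gen_eq S R then 0 else 1) = ncl S R"
  using ncl_insert_same ncl_insert_diff assms by auto

lemma ncl_split:
  assumes "finite S" and "\<And>x y. (x, y) \<in> R \<Longrightarrow> x \<in> S \<Longrightarrow> y \<in> S \<Longrightarrow> x \<in> A \<longleftrightarrow> y \<in> A"
  shows "ncl S R = ncl (S \<inter> A) R + ncl (S - A) R"
proof -
  have inv: "x \<in> A \<longleftrightarrow> y \<in> A" if "(x, y) \<in> gen_eq S R" for x y
    using that by (rule gen_eq_invariant) (use assms in auto)
  have res: "gen_eq S R `` {x} = gen_eq T R `` {x}"
    if "x \<in> T" "T \<subseteq> S" and T: "\<And>x y. (x, y) \<in> R \<Longrightarrow> x \<in> S \<Longrightarrow> y \<in> S \<Longrightarrow> x \<in> T \<longleftrightarrow> y \<in> T" for x T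
  proof -
    have "(x, y) \<in> gen_eq T R" if "(x, y) \<in> gen_eq S R" for y
      using that unfolding gen_eq_def[of S]
    proof (induction rule: rtrancl_induct)
      case (step y z)
      have "y \<in> T" using step.IH \<open>x \<in> T\<close> gen_eq_closed by metis
      with step have "(y, z) \<in> gen_eq T R"
        using T by (auto intro: gen_eq_base gen_eq_sym)
      with step.IH show ?case by (rule gen_eq_trans)
    qed simp
    moreover have "(x, y) \<in> gen_eq S R" if "(x, y) \<in> gen_eq T R" for y
      using that by (rule gen_eq_mono) (use \<open>T \<subseteq> S\<close> in \<open>auto intro: gen_eq_base\<close>)
    ultimately show ?thesis by auto
  qed
  have "gen_classes (S \<inter> A) R = (\<lambda>x. gen_eq S R `` {x}) ` (S \<inter> A)"
    unfolding gen_classes_eq by (rule image_cong) (auto simp: res[of _ "S \<inter> A"] assms(2))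
  moreover have "gen_classes (S - A) R = (\<lambda>x. gen_eq S R `` {x}) ` (S - A)"
    unfolding gen_classes_eq by (rule image_cong) (auto simp: res[of _ "S - A"] assms(2))
  ultimately have "gen_classes S R = gen_classes (S \<inter> A) R \<union> gen_classes (S - A) R"
    and "gen_classes (S \<inter> A) R \<inter> gen_classes (S - A) R = {}"
    by (auto simp: gen_classes_eq gen_eq_class_eq_iff inv)
  then show ?thesis
    using assms(1) by (simp add: card_Un_disjoint finite_gen_classes)
qed

lemma ncl_discrete:
  assumes "\<And>x y. (x, y) \<in> R \<Longrightarrow> x \<in> S \<Longrightarrow> y \<in> S \<Longrightarrow> x = y"
  shows "ncl S R = card S"
proof -
  have "gen_eq S R `` {x} = {x}" for x
    using gen_eq_invariant[of x _ S R id] assms by auto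
  then show ?thesis by (simp add: gen_classes_eq card_image)
qed

lemma ncl_singleton_class:
  assumes "finite S" "\<And>x y. x \<in> K \<Longrightarrow> y \<in> K \<Longrightarrow> (x, y) \<in> gen_eq K R" "K \<subseteq> S" "K \<noteq> {}"
    and "\<And>x y. (x, y) \<in> R \<Longrightarrow> x \<in> S \<Longrightarrow> y \<in> S \<Longrightarrow> x \<in> K \<longleftrightarrow> y \<in> K"
  shows "ncl S R = ncl (S - K) R + 1"
proof -
  obtain k where "k \<in> K" using assms(4) by auto
  then have "gen_classes K R = {gen_eq K R `` {k}}"
    unfolding gen_classes_eq using assms(2) gen_eq_class_eq_iff by (auto intro: gen_eq_trans)
  then have "ncl K R = 1" by simp
  moreover have "S \<inter> K = K" using assms(3) by auto
  ultimately show ?thesis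
    using ncl_split[OF assms(1), of R K] assms(5) by simp
qed

section \<open>Cycles of permutations and the genus inequality\<close>

text \<open>The graph of the function on the whole type. The restriction to a set is left to
  \<open>gen_classes\<close>, so one relation serves for all sets of darts.\<close>

definition gr :: "('a \<Rightarrow> 'a) \<Rightarrow> ('a \<times> 'a) set" where
  "gr p = range (\<lambda>x. (x, p x))"

abbreviation cyc :: "'a set \<Rightarrow> ('a \<Rightarrow> 'a) \<Rightarrow> nat" where
  "cyc S p \<equiv> ncl S (gr p)"

lemma gr_iff [simp]: "(x, y) \<in> gr p \<longleftrightarrow> y = p x"
  by (auto simp: gr_def)

lemma gen_eq_gr:
  assumes "p permutes S" "x \<in> S" "gr p \<subseteq> R"
  shows "(x, p x) \<in> gen_eq S R"
  using assms by (intro gen_eq_base) (auto simp: permutes_in_image)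

lemma orbit_step_eq:
  assumes "p permutes S" "finite S"
  shows "orbit p (p x) = orbit p x"
  using assms by (meson permutation_orbit_step permutation_permutes)

lemma self_in_orbit:
  assumes "p permutes S" "finite S"
  shows "x \<in> orbit p x"
  using assms by (meson permutation_self_in_orbit permutation_permutes)

lemma gen_eq_gr_orbit:
  assumes "p permutes S" "finite S" "x \<in> S"
  shows "(x, y) \<in> gen_eq S (gr p) \<longleftrightarrow> y \<in> orbit p x"
proof
  assume "(x, y) \<in> gen_eq S (gr p)"
  then have "orbit p x = orbit p y"
    by (rule gen_eq_invariant) (use orbit_step_eq[OF assms(1,2)] in auto)
  then show "y \<in> orbit p x" using self_in_orbit[OF assms(1,2)] by simp
next
  assume "y \<in> orbit p x"
  then show "(x, y) \<in> gen_eq S (gr p)"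
  proof induction
    case base
    show ?case using assms by (intro gen_eq_gr) auto
  next
    case (step y)
    then have "y \<in> S" using assms(3) gen_eq_closed by metis
    then show ?case using step assms by (meson gen_eq_gr gen_eq_trans order_refl)
  qed
qed

lemma gen_classes_gr:
  assumes "p permutes S" "finite S"
  shows "gen_classes S (gr p) = orbit p ` S"
  unfolding gen_classes_eq
  by (rule image_cong) (use gen_eq_gr_orbit[OF assms] in auto)

text \<open>If \<open>a\<close> and \<open>b\<close> lie on one cycle, then after the transposition
  \<open>b\<close> is followed by \<open>p a\<close>, so the arc from \<open>p a\<close> to
  \<open>b\<close> closes up to a cycle that misses \<open>a\<close>.\<close>

lemma transpose_splits:
  assumes "p permutes S" "finite S" "a \<in> S" "b \<in> S" "a \<noteq> b" "(a, b) \<in> gen_eq S (gr p)"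
  shows "(a, b) \<notin> gen_eq S (gr (p \<circ> transpose a b))"
proof
  let ?q = "p \<circ> transpose a b"
  assume ab: "(a, b) \<in> gen_eq S (gr ?q)"
  have "b \<in> orbit p a" using assms gen_eq_gr_orbit by metis
  then have ex: "\<exists>n. 0 < n \<and> (p ^^ n) a = b" by (auto simp: orbit_altdef)
  define n where "n = (LEAST n. 0 < n \<and> (p ^^ n) a = b)"
  have n: "0 < n" "(p ^^ n) a = b" using LeastI_ex[OF ex] by (auto simp: n_def)
  have least: "(p ^^ m) a \<noteq> b" if "0 < m" "m < n" for m
    using that not_less_Least[of m "\<lambda>n. 0 < n \<and> (p ^^ n) a = b"] by (auto simp: n_def)
  \<comment> \<open>The arc \<open>p a\<close>, ..., \<open>b\<close>; minimality of
    \<open>n\<close> makes \<open>b\<close> its last point only, and this also keeps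
    \<open>a\<close> out of it.\<close>
  define K where "K = (\<lambda>j. (p ^^ j) a) ` {1..n}"
  have "b \<in> K" using n by (auto simp: K_def)
  have "a \<notin> K"
  proof
    assume "a \<in> K"
    then obtain j where j: "1 \<le> j" "j \<le> n" "(p ^^ j) a = a" by (auto simp: K_def)
    then have "j < n" using n assms(5) by (cases "j = n") auto
    have "(p ^^ (n - j)) ((p ^^ j) a) = b"
      using n j by (metis funpow_add le_add_diff_inverse2 o_apply)
    then show False using least[of "n - j"] j \<open>j < n\<close> by simp
  qed
  have "?q ` K \<subseteq> K"
  proof
    fix y assume "y \<in> ?q ` K"
    then obtain j where j: "1 \<le> j" "j \<le> n" "y = ?q ((p ^^ j) a)" by (auto simp: K_def)
    then have "(p ^^ j) a \<in> K" by (auto simp: K_def)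
    then have "(p ^^ j) a \<noteq> a" using \<open>a \<notin> K\<close> by metis
    show "y \<in> K"
    proof (cases "j = n")
      case True
      then have "y = (p ^^ 1) a" using j n by simp
      then show ?thesis using n unfolding K_def by (intro image_eqI[where x = 1]) auto
    next
      case False
      then have "y = (p ^^ Suc j) a" using j least[of j] \<open>(p ^^ j) a \<noteq> a\<close> by simp
      then show ?thesis using False j unfolding K_def by (intro image_eqI[where x = "Suc j"]) auto
    qed
  qed
  moreover have q: "inj ?q"
    using assms by (intro inj_compose) (auto simp: permutes_inj)
  moreover have "finite K" by (simp add: K_def)
  ultimately have "?q ` K = K" by (meson card_image card_subset_eq inj_on_subset subset_UNIV)
  then have "x \<in> K \<longleftrightarrow> ?q x \<in> K" for x
    using q inj_image_mem_iff by metis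
  then have "(a \<in> K) = (b \<in> K)"
    using ab by (intro gen_eq_invariant[of a b S "gr ?q" "\<lambda>x. x \<in> K"]) auto
  then show False using \<open>b \<in> K\<close> \<open>a \<notin> K\<close> by simp
qed

lemma permutes_transpose: "p permutes S \<Longrightarrow> a \<in> S \<Longrightarrow> b \<in> S \<Longrightarrow> p \<circ> transpose a b permutes S"
  by (rule permutes_compose[OF permutes_swap_id])

lemma comp_transpose_cancel: "p \<circ> transpose a b \<circ> transpose a b = p"
  by (simp add: comp_assoc)

text \<open>The new permutation takes \<open>b\<close> to \<open>p a\<close> and then follows the
  whole old cycle of \<open>a\<close>, which does not contain \<open>b\<close>, until it returns to
  \<open>a\<close>.\<close>

lemma transpose_merges:
  assumes "p permutes S" "finite S" "a \<in> S" "b \<in> S" "(a, b) \<notin> gen_eq S (gr p)"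
  shows "(a, b) \<in> gen_eq S (gr (p \<circ> transpose a b))"
proof -
  let ?q = "p \<circ> transpose a b"
  have q: "?q permutes S" using assms by (simp add: permutes_transpose)
  have qstep: "(x, ?q x) \<in> gen_eq S (gr ?q)" if "x \<in> S" for x
    using gen_eq_gr[OF q that order_refl] .
  have "a \<noteq> b" using assms(5) by auto
  have "(b, y) \<in> gen_eq S (gr ?q)" if "y \<in> orbit p a" for y
    using that
  proof induction
    case base
    have "?q b = p a" by simp
    then show ?case using qstep[OF assms(4)] by metis
  next
    case (step y)
    have "y \<in> S" using step gen_eq_gr_orbit[OF assms(1,2,3)] assms(3) gen_eq_closed by metis
    have "y \<noteq> b" using step gen_eq_gr_orbit[OF assms(1,2,3)] assms(5) by auto
    show ?case
    proof (cases "y = a")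
      case True
      then have "p y = ?q b" by simp
      then show ?thesis using qstep[OF assms(4)] by metis
    next
      case False
      then have "?q y = p y" using \<open>y \<noteq> b\<close> by simp
      then show ?thesis
        using qstep[OF \<open>y \<in> S\<close>] step.IH by (metis gen_eq_trans)
    qed
  qed
  then show ?thesis using self_in_orbit[OF assms(1,2)] gen_eq_sym by metis
qed

text \<open>A merging transposition generates the same equivalence as the additional pair
  \<open>(a, b)\<close>. The extra relation \<open>Q\<close> will be the graph of the other
  permutation of a map, so that components are controlled along with cycles.\<close>

lemma gen_eq_transpose:
  assumes "p permutes S" "finite S" "a \<in> S" "b \<in> S" "(a, b) \<notin> gen_eq S (gr p)"
  shows "gen_eq S (gr (p \<circ> transpose a b) \<union> Q) = gen_eq S (insert (a, b) (gr p \<union> Q))"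
proof (rule gen_eq_cong)
  let ?q = "p \<circ> transpose a b" and ?R = "insert (a, b) (gr p \<union> Q)"
  have ab: "(a, b) \<in> gen_eq S ?R" using assms by (auto intro: gen_eq_base)
  have p: "(x, p x) \<in> gen_eq S ?R" if "x \<in> S" for x
    using assms that by (intro gen_eq_gr) auto
  show "(x, y) \<in> gen_eq S ?R" if xy: "(x, y) \<in> gr ?q \<union> Q" "x \<in> S" "y \<in> S" for x y
  proof (cases "(x, y) \<in> Q")
    case True
    then show ?thesis using xy by (auto intro: gen_eq_base)
  next
    case False
    then have y: "y = p (transpose a b x)" using xy by simp
    have "(x, transpose a b x) \<in> gen_eq S ?R"
      using ab gen_eq_sym[OF ab] by (auto simp: transpose_def)
    moreover have "(transpose a b x, y) \<in> gen_eq S ?R"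
      unfolding y using assms xy by (intro p) (auto simp: transpose_def)
    ultimately show ?thesis by (rule gen_eq_trans)
  qed
next
  let ?q = "p \<circ> transpose a b" and ?R = "gr (p \<circ> transpose a b) \<union> Q"
  have ab: "(a, b) \<in> gen_eq S ?R"
    using transpose_merges[OF assms] by (rule gen_eq_mono) (auto intro: gen_eq_base)
  have q: "(x, ?q x) \<in> gen_eq S ?R" if "x \<in> S" for x
    using gen_eq_gr[OF permutes_transpose[OF assms(1,3,4)] that] by blast
  show "(x, y) \<in> gen_eq S ?R" if xy: "(x, y) \<in> insert (a, b) (gr p \<union> Q)" "x \<in> S" "y \<in> S" for x y
  proof -
    consider "(x, y) \<in> Q" | "x = a" "y = b" | "y = p x" using xy by auto
    then show ?thesis
    proof cases
      case 3
      then have y: "y = ?q (transpose a b x)" by simp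
      have "(x, transpose a b x) \<in> gen_eq S ?R"
        using ab gen_eq_sym[OF ab] by (auto simp: transpose_def)
      moreover have "(transpose a b x, y) \<in> gen_eq S ?R"
        unfolding y using assms xy by (intro q) (auto simp: transpose_def)
      ultimately show ?thesis by (rule gen_eq_trans)
    qed (use xy ab in \<open>auto intro: gen_eq_base\<close>)
  qed
qed

lemma ncl_transpose:
  assumes "p permutes S" "finite S" "a \<in> S" "b \<in> S" "(a, b) \<notin> gen_eq S (gr p)"
  shows "ncl S (gr (p \<circ> transpose a b) \<union> Q) = ncl S (insert (a, b) (gr p \<union> Q))"
  using gen_eq_transpose[OF assms] by (simp add: gen_classes_eq)

lemma cyc_transpose_merge:
  assumes "p permutes S" "finite S" "a \<in> S" "b \<in> S" "(a, b) \<notin> gen_eq S (gr p)"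
  shows "cyc S (p \<circ> transpose a b) + 1 = cyc S p"
  using ncl_transpose[OF assms, of "{}"] ncl_insert_diff[OF assms(2,3,4,5)] by simp

lemma cyc_transpose_split:
  assumes "p permutes S" "finite S" "a \<in> S" "b \<in> S" "a \<noteq> b" "(a, b) \<in> gen_eq S (gr p)"
  shows "cyc S (p \<circ> transpose a b) = cyc S p + 1"
  using cyc_transpose_merge[OF permutes_transpose[OF assms(1,3,4)] assms(2-4) transpose_splits[OF assms]]
  by (simp add: comp_transpose_cancel)

section \<open>The genus of a pair of permutations\<close>

abbreviation comps :: "'a set \<Rightarrow> ('a \<Rightarrow> 'a) \<Rightarrow> ('a \<Rightarrow> 'a) \<Rightarrow> nat" where
  "comps S p q \<equiv> ncl S (gr p \<union> gr q)"

text \<open>Twice the total genus of the map with vertices, edges and faces given by the cycles of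
  \<open>p\<close>, \<open>q\<close> and \<open>p \<circ> q\<close>.\<close>

definition defect :: "'a set \<Rightarrow> ('a \<Rightarrow> 'a) \<Rightarrow> ('a \<Rightarrow> 'a) \<Rightarrow> int" where
  "defect S p q = int (card S) + 2 * int (comps S p q) - int (cyc S p) - int (cyc S q) - int (cyc S (p \<circ> q))"

lemma gen_eq_comp:
  assumes "p permutes S" "q permutes S" "x \<in> S"
  shows "(x, p (q x)) \<in> gen_eq S (gr p \<union> gr q)"
proof -
  have "(x, q x) \<in> gen_eq S (gr p \<union> gr q)" using assms by (intro gen_eq_gr) auto
  moreover have "(q x, p (q x)) \<in> gen_eq S (gr p \<union> gr q)"
    using assms by (intro gen_eq_gr) (auto simp: permutes_in_image)
  ultimately show ?thesis by (rule gen_eq_trans)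
qed

lemma gen_eq_face:
  assumes "p permutes S" "q permutes S" "(x, y) \<in> gen_eq S (gr (p \<circ> q))"
  shows "(x, y) \<in> gen_eq S (gr p \<union> gr q)"
  using assms(3) by (rule gen_eq_mono) (use gen_eq_comp[OF assms(1,2)] in auto)

text \<open>The cycles of \<open>q\<close> become one fewer. The cycles of
  \<open>p \<circ> q\<close> become one more or one fewer according to whether \<open>a\<close> and
  \<open>b\<close> share such a cycle, and a component is lost exactly when \<open>a\<close> and
  \<open>b\<close> were in different ones. Only a merge inside a component but across two faces adds
  a handle.\<close>

lemma defect_merge:
  assumes p: "p permutes S" and q: "q permutes S" and "finite S" "a \<in> S" "b \<in> S"
    and ab: "(a, b) \<notin> gen_eq S (gr q)"
  shows "defect S p (q \<circ> transpose a b) = defect S p q +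
    (if (a, b) \<in> gen_eq S (gr p \<union> gr q) \<and> (a, b) \<notin> gen_eq S (gr (p \<circ> q)) then 2 else 0)"
proof -
  let ?t = "transpose a b"
  have c: "cyc S (q \<circ> ?t) + 1 = cyc S q"
    using assms by (intro cyc_transpose_merge)
  have "comps S p (q \<circ> ?t) = ncl S (insert (a, b) (gr p \<union> gr q))"
    using ncl_transpose[OF q assms(3-6), of "gr p"] by (simp add: Un_commute)
  then have k: "comps S p (q \<circ> ?t) + (if (a, b) \<in> gen_eq S (gr p \<union> gr q) then 0 else 1) = comps S p q"
    using ncl_insert_cases[OF assms(3-5)] by simp
  have pq: "p \<circ> q permutes S" using p q by (rule permutes_compose[rotated])
  have "a \<noteq> b" using ab by auto
  have f: "if (a, b) \<in> gen_eq S (gr (p \<circ> q)) then cyc S (p \<circ> (q \<circ> ?t)) = cyc S (p \<circ> q) + 1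
    else cyc S (p \<circ> (q \<circ> ?t)) + 1 = cyc S (p \<circ> q)"
    using cyc_transpose_split[OF pq assms(3-5) \<open>a \<noteq> b\<close>] cyc_transpose_merge[OF pq assms(3-5)]
    by (simp add: comp_assoc)
  have "(a, b) \<in> gen_eq S (gr (p \<circ> q)) \<Longrightarrow> (a, b) \<in> gen_eq S (gr p \<union> gr q)"
    using gen_eq_face[OF p q] .
  then show ?thesis
    using c k f by (auto simp: defect_def split: if_splits)
qed

text \<open>The permutation \<open>q\<close> arises from the identity by merging transpositions,
  each of which changes the defect by 0 or 2; for the identity the defect is 0.\<close>

lemma defect_nonneg:
  assumes "p permutes S" "q permutes S" "finite S"
  shows "0 \<le> defect S p q"
  using assms(2)
proof (induction "card {x \<in> S. q x \<noteq> x}" arbitrary: q rule: less_induct)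
  case less
  show ?case
  proof (cases "\<forall>x\<in>S. q x = x")
    case True
    then have q: "q = id" using less.prems by (auto simp: permutes_def fun_eq_iff)
    have "comps S p id = cyc S p"
      by (rule ncl_cong) (auto intro: gen_eq_base)
    moreover have "cyc S id = card S" by (rule ncl_discrete) simp
    ultimately show ?thesis by (simp add: q defect_def)
  next
    case False
    then obtain a where a: "a \<in> S" "q a \<noteq> a" by auto
    \<comment> \<open>With the predecessor of \<open>a\<close> as the other point, the transposition
      turns \<open>a\<close> into a fixed point, so fewer points are moved.\<close>
    define b where "b = inv q a"
    have b: "q b = a" "b \<in> S"
      using less.prems a unfolding b_def by (auto simp: permutes_inverses permutes_in_image permutes_inv)
    have "a \<noteq> b" using a b by auto
    let ?r = "q \<circ> transpose a b"
    have r: "?r permutes S" using less.prems a b by (simp add: permutes_transpose)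
    have "(a, b) \<in> gen_eq S (gr q)"
      using gen_eq_gr[OF less.prems b(2) order_refl] b gen_eq_sym by simp
    then have n: "(a, b) \<notin> gen_eq S (gr ?r)"
      using transpose_splits less.prems assms(3) a b \<open>a \<noteq> b\<close> by metis
    have "{x \<in> S. ?r x \<noteq> x} \<subset> {x \<in> S. q x \<noteq> x}"
      using a b less.prems by (auto simp: transpose_def split: if_splits)
    then have "card {x \<in> S. ?r x \<noteq> x} < card {x \<in> S. q x \<noteq> x}"
      using assms(3) by (intro psubset_card_mono) auto
    then have "0 \<le> defect S p ?r" using less.hyps r by blast
    then show ?thesis
      using defect_merge[OF assms(1) r assms(3) a(1) b(2) n]
      by (simp add: comp_transpose_cancel split: if_splits)
  qed
qed

text \<open>Undoing a merge never increases the defect, and the genus inequality keeps it from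
  becoming negative.\<close>

lemma planar_split:
  assumes "p permutes S" "q permutes S" "finite S" "a \<in> S" "b \<in> S"
    and "defect S p q = 0" "(a, b) \<in> gen_eq S (gr q)"
  shows "defect S p (q \<circ> transpose a b) = 0"
proof (cases "a = b")
  case False
  let ?r = "q \<circ> transpose a b"
  have r: "?r permutes S" using assms by (simp add: permutes_transpose)
  have "(a, b) \<notin> gen_eq S (gr ?r)" using transpose_splits assms False by metis
  then have "defect S p ?r \<le> 0"
    using defect_merge[OF assms(1) r assms(3-5)] assms(6)
    by (simp add: comp_transpose_cancel split: if_splits)
  then show ?thesis using defect_nonneg[OF assms(1) r assms(3)] by simp
qed (use assms in simp)

text \<open>The two products are conjugate: \<open>q\<close> carries the cycles of
  \<open>p \<circ> q\<close> to those of \<open>q \<circ> p\<close>.\<close>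

lemma cyc_comp_commute:
  assumes "p permutes S" "q permutes S"
  shows "cyc S (p \<circ> q) = cyc S (q \<circ> p)"
proof (rule ncl_equiv[where f = q and g = p])
  have pq: "p \<circ> q permutes S" "q \<circ> p permutes S" using assms by (simp_all add: permutes_compose)
  show "(q a, q b) \<in> gen_eq S (gr (q \<circ> p))" if "(a, b) \<in> gr (p \<circ> q)" "a \<in> S" "b \<in> S" for a b
    using that assms gen_eq_gr[OF pq(2), of "q a" "gr (q \<circ> p)"] by (simp add: permutes_in_image)
  show "(p a, p b) \<in> gen_eq S (gr (p \<circ> q))" if "(a, b) \<in> gr (q \<circ> p)" "a \<in> S" "b \<in> S" for a b
    using that assms gen_eq_gr[OF pq(1), of "p a" "gr (p \<circ> q)"] by (simp add: permutes_in_image)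
  show "(p (q x), x) \<in> gen_eq S (gr (p \<circ> q))" if "x \<in> S" for x
    using gen_eq_gr[OF pq(1) that order_refl] gen_eq_sym by auto
  show "(q (p x), x) \<in> gen_eq S (gr (q \<circ> p))" if "x \<in> S" for x
    using gen_eq_gr[OF pq(2) that order_refl] gen_eq_sym by auto
qed (use assms in \<open>auto simp: permutes_in_image\<close>)

lemma defect_commute:
  assumes "p permutes S" "q permutes S"
  shows "defect S p q = defect S q p"
  using cyc_comp_commute[OF assms] by (simp add: defect_def Un_commute)

lemma comps_dual:
  assumes "p permutes S" "q permutes S" "q \<circ> q = id"
  shows "comps S (p \<circ> q) q = comps S p q"
proof (rule ncl_cong)
  show "(a, b) \<in> gen_eq S (gr p \<union> gr q)" if "(a, b) \<in> gr (p \<circ> q) \<union> gr q" "a \<in> S" "b \<in> S" for a b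
    using that gen_eq_comp[OF assms(1,2)] by (auto intro: gen_eq_base)
  show "(a, b) \<in> gen_eq S (gr (p \<circ> q) \<union> gr q)" if "(a, b) \<in> gr p \<union> gr q" "a \<in> S" "b \<in> S" for a b
  proof -
    have "(p \<circ> q) (q a) = p a" using assms(3) by (metis comp_assoc comp_id o_apply)
    then have "(a, p a) \<in> gen_eq S (gr (p \<circ> q) \<union> gr q)"
      using gen_eq_comp[OF _ assms(2) that(2), of "p \<circ> q"] assms by (metis permutes_compose)
    then show ?thesis using that by (auto intro: gen_eq_base)
  qed
qed

text \<open>This is the passage to the dual map: the faces \<open>p \<circ> q\<close> become the
  vertices and, \<open>q\<close> being an involution, the vertices \<open>p\<close> become the
  faces.\<close>

lemma defect_dual:
  assumes "p permutes S" "q permutes S" "q \<circ> q = id"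
  shows "defect S (p \<circ> q) q = defect S p q"
  using comps_dual[OF assms] assms(3) by (simp add: defect_def comp_assoc)

section \<open>Removal of darts from a permutation\<close>

definition del :: "'a \<Rightarrow> ('a \<Rightarrow> 'a) \<Rightarrow> 'a \<Rightarrow> 'a" where
  "del d p x = (if x = d then d else if p x = d then p d else p x)"

text \<open>Bypassing \<open>d\<close> is composition with the transposition of \<open>d\<close> and
  its predecessor, so the results on splitting a cycle apply.\<close>

lemma del_eq: "p permutes S \<Longrightarrow> del d p = p \<circ> transpose d (inv p d)"
  by (auto simp: fun_eq_iff del_def transpose_def permutes_inverses permutes_inv_eq)

lemma permutes_del:
  assumes "p permutes S" "d \<in> S"
  shows "del d p permutes (S - {d})"
proof -
  have "del d p permutes S"
    unfolding del_eq[OF assms(1)]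
    using assms by (intro permutes_transpose) (auto simp: permutes_in_image permutes_inv)
  then show ?thesis
    by (rule permutes_superset) (auto simp: del_def)
qed

lemma ncl_drop:
  assumes "finite S" "d \<in> S" "\<And>x y. (x, y) \<in> R \<Longrightarrow> x \<in> S \<Longrightarrow> y \<in> S \<Longrightarrow> x = d \<longleftrightarrow> y = d"
  shows "ncl S R = ncl (S - {d}) R + 1"
  by (rule ncl_singleton_class) (use assms in auto)

lemma defect_drop:
  assumes "p permutes S" "q permutes S" "finite S" "d \<in> S" "p d = d" "q d = d"
  shows "defect (S - {d}) p q = defect S p q"
proof -
  have i: "p x = d \<longleftrightarrow> x = d" "q x = d \<longleftrightarrow> x = d" for x
    using assms by (metis permutes_inj injD)+
  note drop = ncl_drop[OF assms(3,4)]
  have "cyc S p = cyc (S - {d}) p + 1" "cyc S q = cyc (S - {d}) q + 1"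
    "cyc S (p \<circ> q) = cyc (S - {d}) (p \<circ> q) + 1"
    by (rule drop; simp add: i)+
  moreover have "comps S p q = comps (S - {d}) p q + 1"
    by (rule drop) (use i in auto)
  moreover have "card S = card (S - {d}) + 1"
    using card_Suc_Diff1[OF assms(3,4)] by simp
  ultimately show ?thesis
    using assms by (simp add: defect_def)
qed

lemma planar_del:
  assumes "p permutes S" "q permutes S" "finite S" "d \<in> S" "q d = d" "defect S p q = 0"
  shows "defect (S - {d}) (del d p) q = 0"
proof -
  let ?e = "inv p d"
  have e: "?e \<in> S" "p ?e = d" using assms by (auto simp: permutes_in_image permutes_inv permutes_inverses)
  have de: "(d, ?e) \<in> gen_eq S (gr p)"
    using gen_eq_gr[OF assms(1) e(1) order_refl] e(2) gen_eq_sym by simp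
  have "defect S q (p \<circ> transpose d ?e) = 0"
    using assms e de by (intro planar_split) (auto simp: defect_commute)
  then have "defect S (del d p) q = 0"
    using assms e by (simp add: del_eq defect_commute permutes_transpose)
  moreover have "del d p permutes S"
    using assms e by (simp add: del_eq permutes_transpose)
  ultimately show ?thesis
    using assms by (simp add: defect_drop del_def)
qed

lemma even_card_involution:
  assumes "finite K" "\<And>x. x \<in> K \<Longrightarrow> f x \<in> K \<and> f (f x) = x \<and> f x \<noteq> x"
  shows "even (card K)"
  using assms
proof (induction "card K" arbitrary: K rule: less_induct)
  case less
  show ?case
  proof (cases "K = {}")
    case False
    then obtain x where x: "x \<in> K" by auto
    let ?L = "K - {x, f x}"
    have sub: "{x, f x} \<subseteq> K" and two: "card {x, f x} = 2"
      using x less.prems(2)[OF x] by auto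
    then have c: "card K = card ?L + 2"
      using card_mono[OF less.prems(1) sub] card_Diff_subset[OF _ sub] by simp
    have "even (card ?L)"
    proof (rule less.hyps)
      show "card ?L < card K" using c by simp
      show "f y \<in> ?L \<and> f (f y) = y \<and> f y \<noteq> y" if "y \<in> ?L" for y
        using less.prems(2)[of y] less.prems(2)[OF x] that by auto
    qed (use less.prems in simp)
    then show ?thesis using c by simp
  qed simp
qed

text \<open>The bijection \<open>f\<close> exchanges the points with sign \<open>s\<close> and those
  without, so both kinds are equally many.\<close>

lemma even_card_alternating:
  assumes "finite K" "inj_on f K" "f ` K = K" "\<And>x. x \<in> K \<Longrightarrow> s (f x) \<longleftrightarrow> \<not> s x"
  shows "even (card K)"
proof -
  have "f ` {x \<in> K. s x} = {x \<in> K. \<not> s x}"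
  proof
    show "{x \<in> K. \<not> s x} \<subseteq> f ` {x \<in> K. s x}"
      using assms(3,4) by (auto 0 3 simp: image_iff)
  qed (use assms(3,4) in auto)
  then have "card {x \<in> K. s x} = card {x \<in> K. \<not> s x}"
    using card_image[of f "{x \<in> K. s x}"] assms(2) inj_on_subset by fastforce
  moreover have "card K = card {x \<in> K. s x} + card {x \<in> K. \<not> s x}"
    using assms(1) by (subst card_Un_disjoint[symmetric]) (auto intro: arg_cong[where f = card])
  ultimately show ?thesis by simp
qed

text \<open>Once \<open>a\<close> and \<open>b\<close> are known to be connected, the transposition
  does not matter for connectivity. This is used to show that cutting a map would leave its
  components unchanged.\<close>

lemma gen_eq_untranspose:
  assumes "p \<circ> transpose a b permutes S" "gr (p \<circ> transpose a b) \<subseteq> R"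
    and "(a, b) \<in> gen_eq S R" "x \<in> S" "a \<in> S" "b \<in> S"
  shows "(x, p x) \<in> gen_eq S R"
proof -
  have "(x, transpose a b x) \<in> gen_eq S R"
    using assms(3) gen_eq_sym by (auto simp: transpose_def)
  also have "(transpose a b x, (p \<circ> transpose a b) (transpose a b x)) \<in> gen_eq S R"
    using assms(4-6) by (intro gen_eq_gr[OF assms(1) _ assms(2)]) (auto simp: transpose_def)
  finally show ?thesis by simp
qed

section \<open>Signed planar maps\<close>

text \<open>Signs alternate around vertices only and may do anything across an edge. This common
  generality covers maps with alternating edges as well, through which a four-valent diagram is
  reached from a map without such edges.\<close>

locale plane_map =
  fixes N :: "'a set" and \<sigma> \<tau> :: "'a \<Rightarrow> 'a" and s :: "'a \<Rightarrow> bool"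
  assumes fin: "finite N" and rot: "\<sigma> permutes N" and opp: "\<tau> permutes N"
    and opp_fpf: "x \<in> N \<Longrightarrow> \<tau> x \<noteq> x" and opp_opp: "x \<in> N \<Longrightarrow> \<tau> (\<tau> x) = x"
    and sign_rot: "x \<in> N \<Longrightarrow> s (\<sigma> x) \<longleftrightarrow> \<not> s x"
    and planar: "defect N \<sigma> \<tau> = 0"
begin

lemma rot_in [simp]: "\<sigma> x \<in> N \<longleftrightarrow> x \<in> N"
  using rot by (rule permutes_in_image)

lemma opp_in [simp]: "\<tau> x \<in> N \<longleftrightarrow> x \<in> N"
  using opp by (rule permutes_in_image)

lemma opp_involution [simp]: "\<tau> (\<tau> x) = x"
  using opp_opp opp by (cases "x \<in> N") (auto simp: permutes_not_in)

lemma opp_comp: "\<tau> \<circ> \<tau> = id"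
  by auto

lemma opp_inj: "\<tau> x = \<tau> y \<longleftrightarrow> x = y"
  by (metis opp_involution)

end

text \<open>
  All edges of the map are non-alternating: \<open>s\<close> tells over-darts from under-darts, and it alternates
  around every vertex.
\<close>

locale signed_map = plane_map +
  assumes sign_opp: "x \<in> N \<Longrightarrow> s (\<tau> x) \<longleftrightarrow> s x"
begin

text \<open>Suppose that \<open>x\<close> and \<open>\<tau> x\<close> are at the same vertex. Split
  the vertex between them and cut the edge into two fixed darts: the faces stay, so by the genus
  inequality \<open>x\<close> and \<open>\<tau> x\<close> fall into different components. The
  component of \<open>x\<close> then has an even number of darts, since signs alternate, and an odd
  number, since all of them but \<open>x\<close> are paired by edges.\<close>

lemma no_loop:
  assumes x: "x \<in> N"
  shows "(x, \<tau> x) \<notin> gen_eq N (gr \<sigma>)"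
proof
  assume loop: "(x, \<tau> x) \<in> gen_eq N (gr \<sigma>)"
  let ?t = "transpose x (\<tau> x)"
  let ?p = "\<sigma> \<circ> ?t" and ?q = "\<tau> \<circ> ?t"
  let ?R = "gr ?p \<union> gr ?q"
  have xy: "\<tau> x \<in> N" "x \<noteq> \<tau> x" using x opp_fpf[OF x] by auto
  have p: "?p permutes N" and q: "?q permutes N"
    using x rot opp by (simp_all add: permutes_transpose)
  \<comment> \<open>The transposition commutes with \<open>\<tau>\<close>, so splitting the vertex
    and cutting the edge leave the face permutation as it was.\<close>
  have "?p \<circ> ?q = \<sigma> \<circ> \<tau>"
  proof
    fix z
    have "\<tau> z = x \<longleftrightarrow> z = \<tau> x" "\<tau> z = \<tau> x \<longleftrightarrow> z = x" by (metis opp_involution)+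
    then have "?t (\<tau> (?t z)) = \<tau> z" by (auto simp: transpose_def)
    then show "(?p \<circ> ?q) z = (\<sigma> \<circ> \<tau>) z" by simp
  qed
  moreover have "cyc N ?p = cyc N \<sigma> + 1"
    using cyc_transpose_split[OF rot fin x xy loop] .
  moreover have "cyc N ?q = cyc N \<tau> + 1"
    using cyc_transpose_split[OF opp fin x xy] gen_eq_gr[OF opp x order_refl] .
  ultimately have k: "comps N ?p ?q > comps N \<sigma> \<tau>"
    using defect_nonneg[OF p q fin] planar by (simp add: defect_def)
  have sep: "(x, \<tau> x) \<notin> gen_eq N ?R"
  proof
    assume a: "(x, \<tau> x) \<in> gen_eq N ?R"
    have "comps N ?p ?q \<le> comps N \<sigma> \<tau>"
      using gen_eq_untranspose[OF p _ a _ x xy(1)] gen_eq_untranspose[OF q _ a _ x xy(1)]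
      by (intro ncl_mono fin) auto
    then show False using k by simp
  qed
  define K where "K = {y. (x, y) \<in> gen_eq N ?R}"
  have KN: "K \<subseteq> N" using x by (auto simp: K_def dest: gen_eq_closed)
  then have "finite K" using fin finite_subset by auto
  have closed: "y \<in> K \<longleftrightarrow> f y \<in> K" if "f \<in> {?p, ?q}" "y \<in> N" for f y
    unfolding K_def using gen_eq_gr[of f N y ?R] that p q
    by (auto intro: gen_eq_trans gen_eq_sym)
  have "\<tau> x \<notin> K" "x \<in> K" using sep by (auto simp: K_def)
  \<comment> \<open>The signs still alternate along \<open>?p\<close>, because \<open>x\<close> and
    \<open>\<tau> x\<close> have the same sign.\<close>
  have "even (card K)"
  proof (rule even_card_alternating)
    show "inj_on ?p K" using p permutes_inj_on by blast
    have "?p ` K \<subseteq> K" using closed[of ?p] KN by auto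
    then show "?p ` K = K" using endo_inj_surj \<open>finite K\<close> \<open>inj_on ?p K\<close> by blast
    show "s (?p y) \<longleftrightarrow> \<not> s y" if "y \<in> K" for y
      using that KN x sign_opp[OF x] by (auto simp: transpose_def sign_rot subset_iff)
  qed fact
  moreover have "even (card (K - {x}))"
  proof (rule even_card_involution[where f = \<tau>])
    fix y assume y: "y \<in> K - {x}"
    then have "y \<noteq> \<tau> x" using \<open>\<tau> x \<notin> K\<close> by auto
    then have "?q y = \<tau> y" "\<tau> y \<noteq> x" using y by auto
    then show "\<tau> y \<in> K - {x} \<and> \<tau> (\<tau> y) = y \<and> \<tau> y \<noteq> y"
      using closed[of ?q y] y KN opp_fpf by auto
  qed (use \<open>finite K\<close> in simp)
  ultimately show False
    using card_Suc_Diff1[OF \<open>finite K\<close> \<open>x \<in> K\<close>] by (metis even_Suc)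
qed

end

section \<open>Petrie walks\<close>

text \<open>
  The two sides of a dart are \<open>(x, True)\<close>, next to the corner between \<open>x\<close> and \<open>\<sigma> x\<close>, and \<open>(x, False)\<close>.
  State curves follow corners; they change the side of a non-alternating edge and, traversed
  from \<open>x\<close> to \<open>\<tau> x\<close>, thereby keep the second component.
\<close>

definition corners :: "('a \<Rightarrow> 'a) \<Rightarrow> (('a \<times> bool) \<times> ('a \<times> bool)) set" where
  "corners p = range (\<lambda>x. ((x, True), (p x, False)))"

definition links :: "'a set \<Rightarrow> ('a \<Rightarrow> 'a) \<Rightarrow> (('a \<times> bool) \<times> ('a \<times> bool)) set" where
  "links A q = {((x, b), (q x, b)) | x b. x \<in> A}"

text \<open>Joining both sides of a dart lets a curve pass from one adjacent corner to the other as
  if the dart were absent.\<close>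

definition through :: "'a set \<Rightarrow> (('a \<times> bool) \<times> ('a \<times> bool)) set" where
  "through A = (\<lambda>x. ((x, True), (x, False))) ` A"

abbreviation sides :: "'a set \<Rightarrow> ('a \<times> bool) set" where
  "sides N \<equiv> N \<times> UNIV"

abbreviation petrie :: "'a set \<Rightarrow> ('a \<Rightarrow> 'a) \<Rightarrow> ('a \<Rightarrow> 'a) \<Rightarrow> nat" where
  "petrie N p q \<equiv> ncl (sides N) (corners p \<union> links UNIV q)"

lemma corners_iff [simp]: "((x, b), (y, c)) \<in> corners p \<longleftrightarrow> b \<and> \<not> c \<and> y = p x"
  by (auto simp: corners_def)

lemma links_iff [simp]: "((x, b), (y, c)) \<in> links A q \<longleftrightarrow> b = c \<and> x \<in> A \<and> y = q x"
  by (auto simp: links_def)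

lemma through_iff [simp]: "((x, b), (y, c)) \<in> through A \<longleftrightarrow> b \<and> \<not> c \<and> x \<in> A \<and> y = x"
  by (auto simp: through_def)

lemma through_insert: "through (insert d A) = insert ((d, True), (d, False)) (through A)"
  by (simp add: through_def)

definition untouched :: "'a \<Rightarrow> (('a \<times> bool) \<times> ('a \<times> bool)) set \<Rightarrow> bool" where
  "untouched d E \<longleftrightarrow> (\<forall>x b y c. ((x, b), (y, c)) \<in> E \<longrightarrow> x \<noteq> d \<and> y \<noteq> d)"

text \<open>A dart whose sides are joined only prolongs the curve between its two neighbouring
  corners. If it is the sole dart of its vertex, its two sides form a closed curve of their own,
  which disappears with it.\<close>

lemma ncl_del:
  assumes p: "p permutes N" and "finite N" "d \<in> N" and E: "untouched d E"
  shows "ncl (sides N) (corners p \<union> insert ((d, True), (d, False)) E) =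
    ncl (sides (N - {d})) (corners (del d p) \<union> E) + (if p d = d then 1 else 0)"
proof -
  let ?R = "corners p \<union> insert ((d, True), (d, False)) E" and ?R' = "corners (del d p) \<union> E"
  have pin: "p x \<in> N \<longleftrightarrow> x \<in> N" for x using p by (rule permutes_in_image)
  show ?thesis
  proof (cases "p d = d")
    case True
    have pd: "p x = d \<longleftrightarrow> x = d" for x using p True by (metis permutes_inj injD)
    have "ncl (sides N) ?R = ncl (sides N - sides {d}) ?R + 1"
    proof (rule ncl_singleton_class)
      have "((d, True), (d, False)) \<in> gen_eq (sides {d}) ?R" by (rule gen_eq_base) auto
      then show "(x, y) \<in> gen_eq (sides {d}) ?R" if "x \<in> sides {d}" "y \<in> sides {d}" for x y
        using that gen_eq_sym by (cases "snd x"; cases "snd y") (auto simp: prod_eq_iff)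
      show "z \<in> sides {d} \<longleftrightarrow> w \<in> sides {d}" if "(z, w) \<in> ?R" for z w
      proof -
        obtain x b y c where z: "z = (x, b)" "w = (y, c)" by fastforce
        have "((x, b), (y, c)) \<in> E \<Longrightarrow> x \<noteq> d \<and> y \<noteq> d" using E by (auto simp: untouched_def)
        then have "x = d \<longleftrightarrow> y = d" using that z pd[of x] by auto
        then show ?thesis using z by simp
      qed
    qed (use assms in auto)
    moreover have "sides N - sides {d} = sides (N - {d})" by auto
    moreover have "ncl (sides (N - {d})) ?R = ncl (sides (N - {d})) ?R'"
      by (rule ncl_cong) (auto simp: del_def pd intro!: gen_eq_base)
    ultimately show ?thesis using True by simp
  next
    case False
    have "ncl (sides N) ?R = ncl (sides (N - {d})) ?R'"
    \<comment> \<open>Both sides of \<open>d\<close> lie on the curve through the corner after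
      \<open>d\<close>, whose far end \<open>(p d, False)\<close> survives.\<close>
    proof (rule ncl_equiv[where g = id and f = "\<lambda>z. if fst z = d then (p d, False) else z"])
      have dT: "((d, True), (p d, False)) \<in> gen_eq (sides N) ?R"
        and dF: "((d, True), (d, False)) \<in> gen_eq (sides N) ?R"
        using assms pin by (auto intro!: gen_eq_base)
      then have dFT: "((d, False), (p d, False)) \<in> gen_eq (sides N) ?R"
        by (meson gen_eq_sym gen_eq_trans)
      show "(id (if fst z = d then (p d, False) else z), z) \<in> gen_eq (sides N) ?R" if "z \<in> sides N" for z
        using gen_eq_sym[OF dT] gen_eq_sym[OF dFT] by (cases z; cases "snd z") auto
      show "((if fst z = d then (p d, False) else z), (if fst w = d then (p d, False) else w))
          \<in> gen_eq (sides (N - {d})) ?R'"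
        if zw: "(z, w) \<in> ?R" "z \<in> sides N" "w \<in> sides N" for z w
      proof -
        obtain x b y c where z: "z = (x, b)" "w = (y, c)" by fastforce
        have Exy: "((x, b), (y, c)) \<in> E \<Longrightarrow> x \<noteq> d \<and> y \<noteq> d" using E by (auto simp: untouched_def)
        show ?thesis
        proof (cases "x = d")
          case True
          then show ?thesis using zw(1) z Exy False by auto
        next
          case x: False
          show ?thesis
          proof (cases "((x, b), (y, c)) \<in> E")
            case True
            then show ?thesis using zw z Exy by (auto intro!: gen_eq_base)
          next
            case nE: False
            then have c: "b" "\<not> c" "y = p x" using zw(1) z x by auto
            define w' where "w' = (del d p x, False)"
            have w': "(if fst w = d then (p d, False) else w) = w'"
              using c z x by (auto simp: del_def w'_def)
            have "del d p x \<in> N - {d}" using x z zw(2) assms(3) False pin by (auto simp: del_def)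
            then have "(z, w') \<in> gen_eq (sides (N - {d})) ?R'"
              using z c x zw(2) by (intro gen_eq_base) (auto simp: w'_def)
            then show ?thesis unfolding w' using x z by simp
          qed
        qed
      qed
      show "(id z, id w) \<in> gen_eq (sides N) ?R"
        if zw: "(z, w) \<in> ?R'" "z \<in> sides (N - {d})" "w \<in> sides (N - {d})" for z w
      proof (cases "(z, w) \<in> ?R")
        case True
        then show ?thesis using zw by (auto intro: gen_eq_base)
      next
        case False
        moreover obtain x b y c where z: "z = (x, b)" "w = (y, c)" by fastforce
        ultimately have "b" "\<not> c" "y = del d p x" "y \<noteq> p x" using zw(1) by auto
        then have x: "z = (x, True)" "w = (p d, False)" "p x = d" "x \<in> N"
          using zw(2) z by (auto simp: del_def split: if_splits)
        then have "(z, (d, False)) \<in> gen_eq (sides N) ?R"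
          using assms by (auto intro!: gen_eq_base)
        then show ?thesis using dFT x by (auto intro: gen_eq_trans)
      qed
    qed (use False assms pin in \<open>auto split: if_splits\<close>)
    then show ?thesis using False by simp
  qed
qed

text \<open>The labels are names of vertices that outlive the removal of darts: the same \<phi> is
  used throughout, and a vertex without darts is a value that is no longer attained.\<close>

definition labels_cycles :: "'a set \<Rightarrow> ('a \<Rightarrow> 'a) \<Rightarrow> ('a \<Rightarrow> 'v) \<Rightarrow> bool" where
  "labels_cycles N p \<phi> \<longleftrightarrow> (\<forall>x\<in>N. \<forall>y\<in>N. \<phi> x = \<phi> y \<longleftrightarrow> (x, y) \<in> gen_eq N (gr p))"

lemma gen_eq_del:
  assumes p: "p permutes N" and "d \<in> N" and xy: "x \<in> N - {d}" "y \<in> N - {d}"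
  shows "(x, y) \<in> gen_eq (N - {d}) (gr (del d p)) \<longleftrightarrow> (x, y) \<in> gen_eq N (gr p)"
proof
  have pin: "p x \<in> N \<longleftrightarrow> x \<in> N" for x using p by (rule permutes_in_image)
  have pd: "p d = d \<Longrightarrow> p x = d \<Longrightarrow> x = d" for x using p by (metis permutes_inj injD)
  show "(x, y) \<in> gen_eq N (gr p)" if "(x, y) \<in> gen_eq (N - {d}) (gr (del d p))"
    using that
  proof (rule gen_eq_mono)
    fix a b assume ab: "(a, b) \<in> gr (del d p)" "a \<in> N - {d}" "b \<in> N - {d}"
    have "(a, p a) \<in> gen_eq N (gr p)" "(p a, p (p a)) \<in> gen_eq N (gr p)"
      using ab p pin by (auto intro!: gen_eq_gr)
    then show "(a, b) \<in> gen_eq N (gr p)"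
      using ab by (auto simp: del_def split: if_splits intro: gen_eq_trans)
  qed
  \<comment> \<open>The removed dart is pushed forward to its successor, which carries steps of
    \<open>p\<close> to steps of \<open>del d p\<close> or to equalities.\<close>
  let ?f = "\<lambda>x. if x = d then p d else x"
  show "(x, y) \<in> gen_eq (N - {d}) (gr (del d p))" if "(x, y) \<in> gen_eq N (gr p)"
  proof -
    have "(?f x, ?f y) \<in> gen_eq (N - {d}) (gr (del d p))"
      using that
    proof (rule gen_eq_map)
      fix a b assume ab: "(a, b) \<in> gr p" "a \<in> N" "b \<in> N"
      show "(?f a, ?f b) \<in> gen_eq (N - {d}) (gr (del d p))"
      proof (cases "a = d")
        case True
        then show ?thesis using ab by simp
      next
        case False
        then have "?f b = del d p a" "?f b \<noteq> d" using ab pd[of a] by (auto simp: del_def)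
        moreover have "?f b \<in> N" using ab assms(2) pin by simp
        ultimately show ?thesis
          using gen_eq_base[of a "?f b" "gr (del d p)" "N - {d}"] False ab(2) by simp
      qed
    qed
    then show ?thesis using xy by simp
  qed
qed

lemma labels_cycles_del:
  assumes "p permutes N" "d \<in> N" "labels_cycles N p \<phi>"
  shows "labels_cycles (N - {d}) (del d p) \<phi>"
  using assms gen_eq_del[OF assms(1,2)] by (simp add: labels_cycles_def)

lemma card_unlabelled_del:
  assumes p: "p permutes N" and "finite N" "d \<in> N" and \<phi>: "labels_cycles N p \<phi>" and "finite V" "\<phi> ` N \<subseteq> V"
  shows "card (V - \<phi> ` (N - {d})) = card (V - \<phi> ` N) + (if p d = d then 1 else 0)"
proof -
  have iff: "\<phi> x = \<phi> d \<longleftrightarrow> x \<in> orbit p d" if "x \<in> N" for x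
    using \<phi> that assms gen_eq_gr_orbit[OF p assms(2,3), of x] by (metis labels_cycles_def)
  show ?thesis
  proof (cases "p d = d")
    case True
    then have "orbit p d = {d}" by (simp add: orbit_eq_singleton_iff)
    then have ne: "\<phi> x \<noteq> \<phi> d" if "x \<in> N - {d}" for x using iff[of x] that by simp
    have "\<phi> d \<notin> \<phi> ` (N - {d})"
    proof
      assume "\<phi> d \<in> \<phi> ` (N - {d})"
      then obtain x where "x \<in> N - {d}" "\<phi> d = \<phi> x" by blast
      then show False using ne by metis
    qed
    moreover have "\<phi> ` N = insert (\<phi> d) (\<phi> ` (N - {d}))" using assms(3) by blast
    moreover have "\<phi> d \<in> V" using assms(3,6) by blast
    moreover have "V - A = insert v (V - insert v A)" if "v \<notin> A" "v \<in> V" for v A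
      using that by blast
    ultimately have "V - \<phi> ` (N - {d}) = insert (\<phi> d) (V - \<phi> ` N)" by simp
    moreover have "\<phi> d \<notin> V - \<phi> ` N" using assms(3) by simp
    ultimately show ?thesis using True assms by simp
  next
    case False
    have "p d \<in> N - {d}" using False assms by (auto simp: permutes_in_image)
    moreover have "\<phi> (p d) = \<phi> d"
      using iff[of "p d"] calculation by (simp add: orbit.base)
    ultimately have "\<phi> d \<in> \<phi> ` (N - {d})" by (metis image_eqI)
    then have "\<phi> ` (N - {d}) = \<phi> ` N" using assms(3) by blast
    then show ?thesis using False by simp
  qed
qed

text \<open>Curves plus vertices without darts. When the last dart of a vertex is removed, a closed
  curve is lost and an isolated vertex is gained, so the sum does not change.\<close>

definition weight :: "'v set \<Rightarrow> ('a \<Rightarrow> 'v) \<Rightarrow> 'a set \<Rightarrow> ('a \<Rightarrow> 'a) \<Rightarrow> (('a \<times> bool) \<times> ('a \<times> bool)) set \<Rightarrow> nat" where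
  "weight V \<phi> N p E = ncl (sides N) (corners p \<union> E) + card (V - \<phi> ` N)"

lemma weight_del:
  assumes "p permutes N" "finite N" "d \<in> N" "labels_cycles N p \<phi>" "finite V" "\<phi> ` N \<subseteq> V" "untouched d E"
  shows "weight V \<phi> N p (insert ((d, True), (d, False)) E) = weight V \<phi> (N - {d}) (del d p) E"
  using ncl_del[OF assms(1-3,7)] card_unlabelled_del[OF assms(1-6)] by (simp add: weight_def)

lemma weight_del_set:
  assumes "distinct ds" "set ds \<subseteq> N" "p permutes N" "finite N" "labels_cycles N p \<phi>" "finite V" "\<phi> ` N \<subseteq> V"
    and "\<And>d. d \<in> set ds \<Longrightarrow> untouched d E"
  shows "weight V \<phi> N p (through (set ds) \<union> E) = weight V \<phi> (N - set ds) (fold del ds p) E \<and>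
    fold del ds p permutes (N - set ds) \<and> labels_cycles (N - set ds) (fold del ds p) \<phi>"
  using assms
proof (induction ds arbitrary: N p)
  case Nil
  then show ?case by (simp add: through_def)
next
  case (Cons d ds)
  have d: "d \<in> N" "d \<notin> set ds" "distinct ds" "set ds \<subseteq> N - {d}" using Cons.prems(1,2) by auto
  have "untouched d (through (set ds) \<union> E)"
    using d(2) Cons.prems(8)[of d] by (auto simp: untouched_def through_def)
  then have "weight V \<phi> N p (through (set (d # ds)) \<union> E) = weight V \<phi> (N - {d}) (del d p) (through (set ds) \<union> E)"
    using weight_del[OF Cons.prems(3,4) d(1) Cons.prems(5-7)] by (simp add: through_insert)
  moreover have "weight V \<phi> (N - {d}) (del d p) (through (set ds) \<union> E)
      = weight V \<phi> (N - {d} - set ds) (fold del ds (del d p)) E \<and>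
    fold del ds (del d p) permutes (N - {d} - set ds) \<and>
    labels_cycles (N - {d} - set ds) (fold del ds (del d p)) \<phi>"
  proof (rule Cons.IH[OF d(3,4)])
    show "del d p permutes (N - {d})" using permutes_del[OF Cons.prems(3) d(1)] .
    show "labels_cycles (N - {d}) (del d p) \<phi>" using labels_cycles_del[OF Cons.prems(3) d(1) Cons.prems(5)] .
    show "\<phi> ` (N - {d}) \<subseteq> V" using Cons.prems(7) by blast
    show "untouched e E" if "e \<in> set ds" for e using Cons.prems(8) that by simp
  qed (use Cons.prems(4,6) in simp_all)
  moreover have "N - {d} - set ds = N - set (d # ds)" by auto
  ultimately show ?case by simp
qed

lemma planar_del_set:
  assumes "distinct ds" "set ds \<subseteq> N" "p permutes N" "q permutes N" "finite N" "defect N p q = 0"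
    and "\<And>d. d \<in> set ds \<Longrightarrow> q d = d"
  shows "fold del ds p permutes (N - set ds) \<and> defect (N - set ds) (fold del ds p) q = 0"
  using assms
proof (induction ds arbitrary: N p)
  case (Cons d ds)
  have d: "d \<in> N" "distinct ds" "set ds \<subseteq> N - {d}" "q d = d" using Cons.prems(1,2,7) by auto
  have "fold del ds (del d p) permutes (N - {d} - set ds) \<and>
      defect (N - {d} - set ds) (fold del ds (del d p)) q = 0"
  proof (rule Cons.IH[OF d(2,3)])
    show "del d p permutes (N - {d})" using permutes_del[OF Cons.prems(3) d(1)] .
    show "q permutes (N - {d})" using permutes_superset[OF Cons.prems(4), of "N - {d}"] d(4) by blast
    show "defect (N - {d}) (del d p) q = 0"
      using planar_del[OF Cons.prems(3-5) d(1,4) Cons.prems(6)] .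
    show "q e = e" if "e \<in> set ds" for e using Cons.prems(7) that by simp
  qed (use Cons.prems(5) in simp)
  moreover have "N - {d} - set ds = N - set (d # ds)" by auto
  ultimately show ?case by simp
qed simp

text \<open>Here \<open>u\<close> is the sign seen on arriving at a dart and \<open>v\<close> the
  sign seen on leaving it. If these are opposite at \<open>d\<close>, then \<open>u (p d)\<close>
  equals \<open>u d\<close>, and bypassing \<open>d\<close> keeps the alternation. Two functions are
  required because the sign of a removed dart may depend on its side.\<close>

lemma alternating_del_set:
  assumes "\<And>x. x \<in> A \<Longrightarrow> u (p x) \<longleftrightarrow> \<not> v x" "\<And>d. d \<in> set ds \<Longrightarrow> d \<in> A" "\<And>d. d \<in> set ds \<Longrightarrow> u d \<longleftrightarrow> \<not> v d"
    and "x \<in> A - set ds"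
  shows "u (fold del ds p x) \<longleftrightarrow> \<not> v x"
  using assms
proof (induction ds arbitrary: A p)
  case (Cons d ds)
  have "u (del d p y) \<longleftrightarrow> \<not> v y" if "y \<in> A" for y
    using that Cons.prems(1)[of y] Cons.prems(1)[of d] Cons.prems(2,3)[of d] by (auto simp: del_def)
  then show ?case
    using Cons.IH[of A "del d p"] Cons.prems by auto
qed simp

text \<open>The first bridge between \<open>A\<close> and its complement always unites two classes.
  The second one does so too, unless its ends are already connected to those of the first on either
  side.\<close>

lemma ncl_insert_bridge:
  assumes "finite S" "a \<in> S" "b \<in> S" "c \<in> S" "d \<in> S"
    and R: "\<And>x y. (x, y) \<in> R \<Longrightarrow> x \<in> A \<longleftrightarrow> y \<in> A" and "a \<in> A" "b \<in> A" "c \<notin> A" "d \<notin> A"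
  shows "ncl S (insert (a, c) (insert (b, d) R)) + 1 +
    (if (a, b) \<in> gen_eq S R \<and> (c, d) \<in> gen_eq S R then 0 else 1) = ncl S R"
proof -
  have sep: "(x, y) \<notin> gen_eq S R" if "x \<in> A" "y \<notin> A" for x y
    using gen_eq_invariant[of x y S R "\<lambda>x. x \<in> A"] R that by auto
  have "ncl S (insert (b, d) R) + 1 = ncl S R"
    using assms sep by (intro ncl_insert_diff) auto
  moreover have "(a, c) \<in> gen_eq S (insert (b, d) R) \<longleftrightarrow> (a, b) \<in> gen_eq S R \<and> (c, d) \<in> gen_eq S R"
  proof
    assume "(a, c) \<in> gen_eq S (insert (b, d) R)"
    then show "(a, b) \<in> gen_eq S R \<and> (c, d) \<in> gen_eq S R"
      using gen_eq_insert[of a c S b d R] sep assms gen_eq_sym by metis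
  next
    assume h: "(a, b) \<in> gen_eq S R \<and> (c, d) \<in> gen_eq S R"
    have mono: "(x, y) \<in> gen_eq S (insert (b, d) R)" if "(x, y) \<in> gen_eq S R" for x y
      using that by (rule gen_eq_mono) (auto intro: gen_eq_base)
    have "(b, d) \<in> gen_eq S (insert (b, d) R)" using assms by (auto intro: gen_eq_base)
    then show "(a, c) \<in> gen_eq S (insert (b, d) R)"
      using h mono by (meson gen_eq_trans gen_eq_sym)
  qed
  ultimately show ?thesis
    using ncl_insert_cases[OF assms(1,2,4), of "insert (b, d) R"] by auto
qed

text \<open>The loss of classes depends only on whether \<open>a\<close>, \<open>b\<close> are
  connected and \<open>c\<close>, \<open>d\<close> are connected, and this is symmetric in
  \<open>c\<close> and \<open>d\<close>. It makes both ways of joining the paths of two halves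
  equally good.\<close>

lemma ncl_insert_bridge_swap:
  assumes "finite S" "a \<in> S" "b \<in> S" "c \<in> S" "d \<in> S"
    and "\<And>x y. (x, y) \<in> R \<Longrightarrow> x \<in> A \<longleftrightarrow> y \<in> A" and "a \<in> A" "b \<in> A" "c \<notin> A" "d \<notin> A"
  shows "ncl S (insert (a, c) (insert (b, d) R)) = ncl S (insert (a, d) (insert (b, c) R))"
proof -
  have "(c, d) \<in> gen_eq S R \<longleftrightarrow> (d, c) \<in> gen_eq S R" using gen_eq_sym by metis
  then show ?thesis
    using ncl_insert_bridge[OF assms(1-5), of R A] ncl_insert_bridge[OF assms(1-3,5,4), of R A] assms(6-)
    by simp
qed

section \<open>Cutting edges, and the ends of the resulting paths\<close>

definition fix_set :: "'a set \<Rightarrow> ('a \<Rightarrow> 'a) \<Rightarrow> 'a \<Rightarrow> 'a" where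
  "fix_set A p x = (if x \<in> A then x else p x)"

lemma permutes_fix_set:
  assumes "q permutes S" "q \<circ> q = id" and D: "\<And>z. q z \<in> D \<longleftrightarrow> z \<in> D" "D \<subseteq> S"
  shows "fix_set D q permutes S" "fix_set D q permutes (S - D)"
proof -
  have qq: "q (q z) = z" for z using assms(2) by (metis comp_apply id_apply)
  have "bij_betw (fix_set D q) (S - D) (S - D)"
  proof (rule bij_betw_byWitness[where f' = q])
    show "fix_set D q ` (S - D) \<subseteq> S - D" "q ` (S - D) \<subseteq> S - D"
      using D(1) permutes_in_image[OF assms(1)] by (auto simp: fix_set_def)
  qed (use qq D(1) in \<open>auto simp: fix_set_def\<close>)
  then show 1: "fix_set D q permutes (S - D)"
    using assms(1) by (intro bij_imp_permutes) (auto simp: fix_set_def permutes_not_in)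
  show "fix_set D q permutes S" using permutes_subset[OF 1] by auto
qed

lemma planar_fix_set:
  assumes p: "p permutes S" and q: "q permutes S" "q \<circ> q = id" and "finite S" and "defect S p q = 0"
    and "\<And>z. q z \<in> D \<longleftrightarrow> z \<in> D" "D \<subseteq> S"
  shows "defect S p (fix_set D q) = 0"
  using assms(6,7)
proof (induction "card D" arbitrary: D rule: less_induct)
  case less
  have qq: "q (q z) = z" for z using q(2) by (metis comp_apply id_apply)
  show ?case
  proof (cases "D = {}")
    case True
    then have "fix_set D q = q" by (simp add: fix_set_def fun_eq_iff)
    then show ?thesis using assms(5) by simp
  next
    case False
    then obtain x where x: "x \<in> D" by auto
    let ?E = "D - {x, q x}"
    have qx: "q x \<in> D" "x \<in> S" "q x \<in> S" using x less.prems by auto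
    have inj: "q a = q b \<longleftrightarrow> a = b" for a b by (metis qq)
    have E: "q z \<in> ?E \<longleftrightarrow> z \<in> ?E" for z using less.prems(1)[of z] inj qq by auto
    have fD: "finite D" using less.prems(2) assms(4) finite_subset by auto
    have "card ?E < card D" using x by (intro psubset_card_mono fD) auto
    then have 0: "defect S p (fix_set ?E q) = 0" using less.hyps[of ?E] E less.prems(2) by auto
    have r: "fix_set ?E q permutes S" using permutes_fix_set(1)[OF q E] less.prems(2) by auto
    \<comment> \<open>Cutting one more edge is splitting a two-cycle of the involution.\<close>
    have "fix_set D q = fix_set ?E q \<circ> transpose x (q x)"
      using x qx qq by (auto simp: fun_eq_iff fix_set_def transpose_def)
    moreover have "fix_set ?E q x = q x" by (simp add: fix_set_def)
    then have "(x, q x) \<in> gen_eq S (gr (fix_set ?E q))"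
      using gen_eq_gr[OF r qx(2) order_refl] by metis
    ultimately show ?thesis using planar_split[OF p r assms(4) qx(2,3) 0] by simp
  qed
qed

text \<open>In the union of a perfect matching \<open>f\<close> and a matching \<open>g\<close> that avoids \<open>X\<close>, paths end in \<open>X\<close>.\<close>

lemma even_class_ends:
  assumes "finite S" "z \<in> S"
    and f: "\<And>w. w \<in> S \<Longrightarrow> f w \<in> S \<and> f (f w) = w \<and> f w \<noteq> w \<and> (w, f w) \<in> gen_eq S R"
    and g: "\<And>w. w \<in> S - X \<Longrightarrow> g w \<in> S - X \<and> g (g w) = w \<and> g w \<noteq> w \<and> (w, g w) \<in> gen_eq S R"
  shows "even (card ({w. (z, w) \<in> gen_eq S R} \<inter> X))"
proof -
  define K where "K = {w. (z, w) \<in> gen_eq S R}"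
  have KS: "K \<subseteq> S" using assms(2) by (auto simp: K_def dest: gen_eq_closed)
  then have fK: "finite K" using assms(1) finite_subset by auto
  have closed: "w' \<in> K" if "w \<in> K" "(w, w') \<in> gen_eq S R" for w w'
    using that by (auto simp: K_def intro: gen_eq_trans)
  have "even (card K)"
    by (rule even_card_involution[OF fK, of f]) (use f KS closed in blast)
  moreover have "even (card (K - X))"
    by (rule even_card_involution[of _ g]) (use fK g KS closed in blast)+
  moreover have "card K = card (K - X) + card (K \<inter> X)"
    using fK by (metis card_Diff_subset_Int card_mono finite_Int inf_le1 le_add_diff_inverse2)
  ultimately show ?thesis by (simp add: K_def)
qed

text \<open>The relation \<open>corners\<close> read as an involution of the sides without fixed
  points, the form of a matching that the parity argument asks for.\<close>

definition corner :: "('a \<Rightarrow> 'a) \<Rightarrow> 'a \<times> bool \<Rightarrow> 'a \<times> bool" where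
  "corner p z = (if snd z then (p (fst z), False) else (inv p (fst z), True))"

lemma corners_corner: "p permutes N \<Longrightarrow> (z, corner p z) \<in> corners p \<or> (corner p z, z) \<in> corners p"
  by (cases z) (auto simp: corner_def permutes_inverses)

lemma corner_in: "p permutes N \<Longrightarrow> z \<in> sides N \<Longrightarrow> corner p z \<in> sides N"
  by (auto simp: corner_def permutes_in_image permutes_inv)

lemma corner_involution: "p permutes N \<Longrightarrow> corner p (corner p z) = z"
  by (auto simp: corner_def permutes_inverses prod_eq_iff)

lemma corner_neq: "corner p z \<noteq> z"
  by (auto simp: corner_def prod_eq_iff)

context signed_map
begin

text \<open>
  Cutting the links at the sides of a set \<open>D\<close> of darts leaves paths that end in such sides and respect
  the type \<open>A\<close> or \<open>B\<close> of their corners.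
\<close>

definition paths :: "'a set \<Rightarrow> (('a \<times> bool) \<times> ('a \<times> bool)) set" where
  "paths D = corners \<sigma> \<union> links (- D) \<tau>"

definition type :: "'a \<times> bool \<Rightarrow> bool" where
  "type z \<longleftrightarrow> (s (fst z) \<longleftrightarrow> snd z)"

text \<open>At a corner the sign and the side both change; along a link neither does.\<close>

lemma type_paths: "(z, w) \<in> gen_eq (sides N) (paths D) \<Longrightarrow> type z = type w"
  by (erule gen_eq_invariant) (auto simp: paths_def type_def sign_rot sign_opp corners_def links_def)

lemma even_path_ends:
  assumes D: "\<And>z. \<tau> z \<in> D \<longleftrightarrow> z \<in> D" "D \<subseteq> N" and z: "z \<in> sides N"
  shows "even (card ({w. (z, w) \<in> gen_eq (sides N) (paths D)} \<inter> sides D))"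
proof (rule even_class_ends[where f = "corner \<sigma>" and g = "map_prod \<tau> id"])
  fix w assume w: "w \<in> sides N"
  then have "corner \<sigma> w \<in> sides N" by (rule corner_in[OF rot])
  then show "corner \<sigma> w \<in> sides N \<and> corner \<sigma> (corner \<sigma> w) = w \<and> corner \<sigma> w \<noteq> w \<and>
      (w, corner \<sigma> w) \<in> gen_eq (sides N) (paths D)"
    using corner_involution[OF rot, of w] corner_neq[of \<sigma> w] corners_corner[OF rot, of w] w
      gen_eq_base[of w "corner \<sigma> w" "paths D" "sides N"]
      gen_eq_sym[OF gen_eq_base[of "corner \<sigma> w" w "paths D" "sides N"]]
    unfolding paths_def by simp blast
next
  fix w assume w: "w \<in> sides N - sides D"
  then obtain x b where "w = (x, b)" "x \<in> N" "x \<notin> D" by auto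
  then show "map_prod \<tau> id w \<in> sides N - sides D \<and> map_prod \<tau> id (map_prod \<tau> id w) = w \<and> map_prod \<tau> id w \<noteq> w \<and>
      (w, map_prod \<tau> id w) \<in> gen_eq (sides N) (paths D)"
    using D(1) opp_fpf by (auto simp: paths_def intro!: gen_eq_base)
qed (use fin z in auto)

text \<open>The class of \<open>z\<close> contains an even number of ends, so \<open>z\<close> is
  not its only one; if \<open>w\<close> is the only other candidate, it must be there.\<close>

lemma path_between:
  assumes "\<And>z. \<tau> z \<in> D \<longleftrightarrow> z \<in> D" "D \<subseteq> N" "z \<in> sides D"
    and "\<And>y. y \<in> sides D \<Longrightarrow> (z, y) \<in> gen_eq (sides N) (paths D) \<Longrightarrow> y = z \<or> y = w"
  shows "(z, w) \<in> gen_eq (sides N) (paths D)"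
proof (rule ccontr)
  assume "(z, w) \<notin> gen_eq (sides N) (paths D)"
  then have "{y. (z, y) \<in> gen_eq (sides N) (paths D)} \<inter> sides D = {z}"
    using assms(3,4) by auto
  then show False using even_path_ends[OF assms(1,2), of z] assms(2,3) by auto
qed

end

section \<open>Deletion of parallel edges\<close>

text \<open>
  Cutting the sphere along the two edges separates the map into two maps, each containing one of the
  edges. Reversing all signs on one side of the split_rot makes the signs alternate
  after the deletion of both edges.
\<close>

locale parallel_darts = signed_map +
  fixes x y :: 'a
  assumes x: "x \<in> N" and y: "y \<in> N" and xy: "x \<noteq> y" "\<tau> x \<noteq> y"
    and same: "(x, y) \<in> gen_eq N (gr \<sigma>)" and same': "(\<tau> x, \<tau> y) \<in> gen_eq N (gr \<sigma>)"
begin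

definition "t = transpose x y"
definition "t' = transpose (\<tau> x) (\<tau> y)"
text \<open>One transposition acts after \<sigma> and the other before it. Since
  \<open>t' \<circ> \<tau> = \<tau> \<circ> t\<close>, this makes
  \<open>split_rot \<circ> \<tau>\<close> a conjugate of \<open>\<sigma> \<circ> \<tau>\<close> :
  both end vertices are split and the number of faces is kept.\<close>

definition "split_rot = t \<circ> \<sigma> \<circ> t'"

lemma distinct_darts: "distinct [x, \<tau> x, y, \<tau> y]"
  using xy opp_fpf[OF x] opp_fpf[OF y] by (auto dest: arg_cong[where f = \<tau>])

lemma darts_in: "{x, \<tau> x, y, \<tau> y} \<subseteq> N"
  using x y by simp

lemma cut_permutes: "split_rot permutes N"
  unfolding split_rot_def t_def t'_def
  using x y by (intro permutes_compose[OF permutes_swap_id] permutes_compose[OF _ permutes_swap_id] rot) auto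

lemma cyc_cut: "cyc N split_rot = cyc N \<sigma> + 2"
proof -
  let ?p = "\<sigma> \<circ> t'"
  have ex: "\<tau> x \<in> N" "\<tau> y \<in> N" "\<tau> x \<noteq> \<tau> y" using x y distinct_darts by auto
  have 1: "cyc N ?p = cyc N \<sigma> + 1"
    unfolding t'_def using cyc_transpose_split[OF rot fin ex same'] .
  have p: "?p permutes N" unfolding t'_def using ex rot by (simp add: permutes_transpose)
  have tp: "t permutes N" unfolding t_def using x y by (simp add: permutes_swap_id)
  \<comment> \<open>Without loops the vertex of \<open>x\<close> contains neither
    \<open>\<tau> x\<close> nor \<open>\<tau> y\<close>, so splitting the other vertex leaves its
    cycle intact.\<close>
  have "(x, z) \<in> gen_eq N (gr ?p)" if "z \<in> orbit \<sigma> x" for z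
    using that
  proof induction
    have step: "(z, \<sigma> z) \<in> gen_eq N (gr ?p)" if "(x, z) \<in> gen_eq N (gr \<sigma>)" for z
    proof -
      have "z \<in> N" using that x gen_eq_closed by metis
      moreover have "z \<noteq> \<tau> x" using that no_loop[OF x] by auto
      moreover have "z \<noteq> \<tau> y"
        using that no_loop[OF y] same by (meson gen_eq_sym gen_eq_trans)
      ultimately show ?thesis
        using gen_eq_gr[OF p _ order_refl, of z] by (simp add: t'_def)
    qed
    show "(x, \<sigma> x) \<in> gen_eq N (gr ?p)" by (rule step) simp
    show "(x, \<sigma> z) \<in> gen_eq N (gr ?p)" if "z \<in> orbit \<sigma> x" "(x, z) \<in> gen_eq N (gr ?p)" for z
      using step[of z] that gen_eq_gr_orbit[OF rot fin x] gen_eq_trans by metis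
  qed
  then have "(x, y) \<in> gen_eq N (gr ?p)" using same gen_eq_gr_orbit[OF rot fin x] by metis
  then have "cyc N (?p \<circ> t) = cyc N ?p + 1"
    unfolding t_def using cyc_transpose_split[OF p fin x y xy(1)] by simp
  moreover have "cyc N split_rot = cyc N (?p \<circ> t)"
    unfolding split_rot_def using cyc_comp_commute[OF tp p] by (simp add: comp_assoc)
  ultimately show ?thesis using 1 by simp
qed

lemma cyc_cut_faces: "cyc N (split_rot \<circ> \<tau>) = cyc N (\<sigma> \<circ> \<tau>)"
proof -
  have tp: "t permutes N" unfolding t_def using x y by (simp add: permutes_swap_id)
  have pt: "\<sigma> \<circ> \<tau> \<circ> t permutes N"
    by (intro permutes_compose tp opp rot)
  have "t' (\<tau> z) = \<tau> (t z)" for z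
    using xy by (auto simp: t_def t'_def transpose_def dest: arg_cong[where f = \<tau>])
  then have "split_rot \<circ> \<tau> = t \<circ> (\<sigma> \<circ> \<tau> \<circ> t)" by (simp add: split_rot_def fun_eq_iff)
  then have "cyc N (split_rot \<circ> \<tau>) = cyc N (\<sigma> \<circ> \<tau> \<circ> t \<circ> t)"
    using cyc_comp_commute[OF tp pt] by simp
  then show ?thesis by (simp add: t_def comp_transpose_cancel)
qed

text \<open>If \<open>x\<close> and \<open>y\<close> remained connected, the cut would not create a
  component; two more vertices and equally many faces would then give a negative defect.\<close>

lemma cut_separates: "(x, y) \<notin> gen_eq N (gr split_rot \<union> gr \<tau>)"
proof
  let ?R = "gr split_rot \<union> gr \<tau>"
  assume a: "(x, y) \<in> gen_eq N ?R"
  have opp_step: "(z, \<tau> z) \<in> gen_eq N ?R" if "z \<in> N" for z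
    using that opp by (intro gen_eq_gr) auto
  have "(\<tau> x, \<tau> y) \<in> gen_eq N ?R"
    using a opp_step[OF x] opp_step[OF y] by (meson gen_eq_sym gen_eq_trans)
  then have t': "(z, t' z) \<in> gen_eq N ?R" for z
    using gen_eq_sym by (auto simp: t'_def transpose_def)
  have t: "(z, t z) \<in> gen_eq N ?R" for z
    using a gen_eq_sym by (auto simp: t_def transpose_def)
  have "(z, \<sigma> z) \<in> gen_eq N ?R" if z: "z \<in> N" for z
  proof -
    have "t' z \<in> N" using z x y by (auto simp: t'_def transpose_def)
    then have "(t' z, split_rot (t' z)) \<in> gen_eq N ?R" using cut_permutes by (intro gen_eq_gr) auto
    moreover have "\<sigma> z = t (split_rot (t' z))" by (simp add: split_rot_def t_def t'_def)
    ultimately show ?thesis using t t' gen_eq_trans by metis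
  qed
  then have "comps N split_rot \<tau> \<le> comps N \<sigma> \<tau>"
    using opp_step by (intro ncl_mono fin) auto
  then show False
    using cyc_cut cyc_cut_faces planar defect_nonneg[OF cut_permutes opp fin] by (simp add: defect_def)
qed

definition "C = {z. (x, z) \<in> gen_eq N (gr split_rot \<union> gr \<tau>)}"

lemma C_cut: "split_rot z \<in> C \<longleftrightarrow> z \<in> C" if "z \<in> N"
  using gen_eq_gr[OF cut_permutes that, of "gr split_rot \<union> gr \<tau>"] unfolding C_def
  by (auto intro: gen_eq_trans gen_eq_sym)

lemma C_opp: "\<tau> z \<in> C \<longleftrightarrow> z \<in> C" if "z \<in> N"
  using gen_eq_gr[OF opp that, of "gr split_rot \<union> gr \<tau>"] unfolding C_def
  by (auto intro: gen_eq_trans gen_eq_sym)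

lemma x_in_C: "x \<in> C" and y_notin_C: "y \<notin> C"
  using cut_separates by (auto simp: C_def)

text \<open>In the cut map the corner from \<open>z\<close> to \<open>\<sigma> z\<close> lies
  between \<open>t' z\<close> and \<open>t (\<sigma> z)\<close>, whence the two transpositions. A
  dart of a cut edge has its two sides in different halves.\<close>

definition side_C :: "('a \<times> bool) set" where
  "side_C = {(z, b). if b then t' z \<in> C else t z \<in> C}"

lemma side_C_rot: "z \<in> N \<Longrightarrow> (z, True) \<in> side_C \<longleftrightarrow> (\<sigma> z, False) \<in> side_C"
proof -
  assume "z \<in> N"
  then have "t' z \<in> N" using x y by (auto simp: t'_def transpose_def)
  then show ?thesis using C_cut[of "t' z"] by (simp add: side_C_def split_rot_def t'_def)
qed

abbreviation "D \<equiv> {x, \<tau> x, y, \<tau> y}"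

lemma D_closed: "\<tau> z \<in> D \<longleftrightarrow> z \<in> D"
  by (auto dest: arg_cong[where f = \<tau>])

lemma side_C_D:
  "(x, True) \<in> side_C" "(x, False) \<notin> side_C" "(y, True) \<notin> side_C" "(y, False) \<in> side_C"
  "(\<tau> x, True) \<notin> side_C" "(\<tau> x, False) \<in> side_C" "(\<tau> y, True) \<in> side_C" "(\<tau> y, False) \<notin> side_C"
  using distinct_darts x_in_C y_notin_C C_opp[OF x] C_opp[OF y]
  by (auto simp: side_C_def t_def t'_def transpose_def)

lemma side_C_other: "z \<notin> D \<Longrightarrow> (z, b) \<in> side_C \<longleftrightarrow> z \<in> C"
  by (simp add: side_C_def t_def t'_def)

lemma side_C_paths:
  assumes "(z, w) \<in> paths D" "z \<in> sides N" "w \<in> sides N"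
  shows "z \<in> side_C \<longleftrightarrow> w \<in> side_C"
proof -
  obtain u b v c where z: "z = (u, b)" "w = (v, c)" by fastforce
  show ?thesis
  proof (cases "((u, b), (v, c)) \<in> corners \<sigma>")
    case True
    then show ?thesis using side_C_rot[of u] z assms(2) by simp
  next
    case False
    then have u: "u \<in> N" "u \<notin> D" "v = \<tau> u" "b = c" using assms z by (auto simp: paths_def)
    moreover have "\<tau> u \<notin> D" using u(2) by (auto dest: arg_cong[where f = \<tau>])
    ultimately show ?thesis using z C_opp[OF u(1)] side_C_other by metis
  qed
qed

text \<open>The eight sides of the cut darts are distributed over two halves and two types, two in
  each of the four combinations, so they are the ends of four paths, two in each half. Links across
  the cut edges pair the paths of one half with those of the other in one way, joining the sides of
  each dart pairs them in the other way.\<close>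

lemma petrie_cut: "petrie N \<sigma> \<tau> = ncl (sides N) (paths D \<union> through D)"
proof -
  let ?S = "sides N" and ?R = "paths D"
  let ?xT = "(x, True)" and ?xF = "(x, False)" and ?yT = "(y, True)" and ?yF = "(y, False)"
  let ?XT = "(\<tau> x, True)" and ?XF = "(\<tau> x, False)" and ?YT = "(\<tau> y, True)" and ?YF = "(\<tau> y, False)"
  have sdN: "sides D \<subseteq> ?S" using darts_in by auto
  then have inS: "?xT \<in> ?S" "?xF \<in> ?S" "?yT \<in> ?S" "?yF \<in> ?S" "?XT \<in> ?S" "?XF \<in> ?S" "?YT \<in> ?S" "?YF \<in> ?S"
    by auto
  have sep: "(z \<in> side_C) = (w \<in> side_C)" if "(z, w) \<in> gen_eq ?S ?R" for z w
    using that by (rule gen_eq_invariant) (use side_C_paths in blast)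
  define A where "A = side_C"
  \<comment> \<open>Restricting the relation to the sides of the map makes membership in
    \<open>A\<close> invariant along every pair, as the bridge lemmas demand.\<close>
  define R where "R = Restr ?R ?S"
  have R_eq: "gen_eq ?S (Q \<union> R) = gen_eq ?S (Q \<union> ?R)" for Q
    unfolding gen_eq_def R_def by (rule arg_cong[where f = rtrancl]) auto
  have ncl_R: "ncl ?S (Q \<union> R) = ncl ?S (Q \<union> ?R)" for Q
    by (simp add: gen_classes_eq R_eq)
  have RA: "z \<in> A \<longleftrightarrow> w \<in> A" if "(z, w) \<in> R" for z w
    using that side_C_paths by (auto simp: R_def A_def)
  note sC = side_C_D[folded A_def]
  have ty: "type ?xT = s x" "type ?xF = (\<not> s x)" "type ?yT = s y" "type ?yF = (\<not> s y)"
    "type ?XT = s x" "type ?XF = (\<not> s x)" "type ?YT = s y" "type ?YF = (\<not> s y)"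
    using x y by (simp_all add: type_def sign_opp)
  \<comment> \<open>Two pairs are interchangeable if they join the same two paths, possibly in the
    opposite direction.\<close>
  define same_ends where "same_ends u v u' v' \<longleftrightarrow> (u, u') \<in> gen_eq ?S R \<and> (v, v') \<in> gen_eq ?S R \<or>
    (u, v') \<in> gen_eq ?S R \<and> (v, u') \<in> gen_eq ?S R" for u v u' v'
  let ?all = "{?xT, ?xF, ?yT, ?yF, ?XT, ?XF, ?YT, ?YF}"
  have all: "sides D = ?all" by (auto simp: UNIV_bool)
  have path: "(z, w) \<in> gen_eq ?S R"
    if z: "z \<in> ?all" and v: "\<forall>v\<in>?all. (z \<in> A) = (v \<in> A) \<longrightarrow> type z = type v \<longrightarrow> v = z \<or> v = w" for z w
  proof -
    have "(z, w) \<in> gen_eq ?S ?R"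
    proof (rule path_between[OF D_closed darts_in z[folded all]])
      show "u = z \<or> u = w" if "u \<in> sides D" "(z, u) \<in> gen_eq ?S ?R" for u
        using v sep[OF that(2)] type_paths[OF that(2)] that(1) unfolding all A_def by blast
    qed
    then show ?thesis using R_eq[of "{}"] by simp
  qed
  have fS: "finite ?S" using fin by simp
  have L: "petrie N \<sigma> \<tau> = ncl ?S ({(?xT, ?XT), (?xF, ?XF), (?yT, ?YT), (?yF, ?YF)} \<union> R)"
    unfolding ncl_R
  proof (rule ncl_cong)
    let ?Q = "{(?xT, ?XT), (?xF, ?XF), (?yT, ?YT), (?yF, ?YF)} \<union> ?R"
    show "(z, w) \<in> gen_eq ?S (corners \<sigma> \<union> links UNIV \<tau>)" if "(z, w) \<in> ?Q" "z \<in> ?S" "w \<in> ?S" for z w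
      using that by (intro gen_eq_base) (auto simp: paths_def links_def)
    show "(z, w) \<in> gen_eq ?S ?Q" if zw: "(z, w) \<in> corners \<sigma> \<union> links UNIV \<tau>" "z \<in> ?S" "w \<in> ?S" for z w
    proof -
      have "(z, w) \<in> ?Q \<or> (w, z) \<in> ?Q"
      proof (cases "(z, w) \<in> ?R")
        case False
        then obtain u b where u: "z = (u, b)" "w = (\<tau> u, b)" "u \<in> D"
          using zw False by (auto simp: paths_def links_def)
        then show ?thesis by (cases b) auto
      qed simp
      then show ?thesis
        using gen_eq_base[of z w ?Q ?S] gen_eq_sym[OF gen_eq_base[of w z ?Q ?S]] that(2,3) by blast
    qed
  qed
  have T: "ncl ?S (?R \<union> through D) = ncl ?S ({(?xT, ?xF), (?yT, ?yF), (?XT, ?XF), (?YT, ?YF)} \<union> R)"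
    unfolding ncl_R by (rule arg_cong[where f = "ncl ?S"]) (auto simp: through_def)
  \<comment> \<open>Only the paths that are joined matter. This reduces the four pairs of either
    kind to two bridges.\<close>
  have red: "ncl ?S (Q \<union> R) = ncl ?S (Q' \<union> R)"
    if "Q \<subseteq> ?S \<times> ?S" "Q' \<subseteq> ?S \<times> ?S" "\<forall>(u, v)\<in>Q. \<exists>(u', v')\<in>Q'. same_ends u v u' v'"
      "\<forall>(u, v)\<in>Q'. \<exists>(u', v')\<in>Q. same_ends u v u' v'" for Q Q'
  proof (rule ncl_cong)
    have "(u, v) \<in> gen_eq ?S (P' \<union> R)"
      if P: "(u, v) \<in> P \<union> R" "u \<in> ?S" "v \<in> ?S" "P' \<subseteq> ?S \<times> ?S" and
        ends: "\<forall>(u, v)\<in>P. \<exists>(u', v')\<in>P'. same_ends u v u' v'" for u v P P'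
    proof (cases "(u, v) \<in> R")
      case True
      then show ?thesis using P by (auto intro: gen_eq_base)
    next
      case False
      then obtain u' v' where uv: "(u', v') \<in> P'" "same_ends u v u' v'" using P(1) ends by blast
      have mono: "(z, w) \<in> gen_eq ?S (P' \<union> R)" if "(z, w) \<in> gen_eq ?S R" for z w
        using that by (rule gen_eq_mono) (auto intro: gen_eq_base)
      have "(u', v') \<in> gen_eq ?S (P' \<union> R)" using uv(1) P(4) by (auto intro: gen_eq_base)
      then show ?thesis using uv(2) mono unfolding same_ends_def by (meson gen_eq_sym gen_eq_trans)
    qed
    then show "\<And>u v. (u, v) \<in> Q \<union> R \<Longrightarrow> u \<in> ?S \<Longrightarrow> v \<in> ?S \<Longrightarrow> (u, v) \<in> gen_eq ?S (Q' \<union> R)"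
      and "\<And>u v. (u, v) \<in> Q' \<union> R \<Longrightarrow> u \<in> ?S \<Longrightarrow> v \<in> ?S \<Longrightarrow> (u, v) \<in> gen_eq ?S (Q \<union> R)"
      using that by blast+
  qed
  show ?thesis
  proof (cases "s x = s y")
    case True
    \<comment> \<open>For equal signs each path runs from a side at one end of the edges to a side
      at the other end; for different signs it stays at the same end vertex.\<close>
    have p: "(?xT, ?YT) \<in> gen_eq ?S R" "(?yF, ?XF) \<in> gen_eq ?S R" "(?yT, ?XT) \<in> gen_eq ?S R" "(?xF, ?YF) \<in> gen_eq ?S R"
      by (rule path; simp add: True sC ty)+
    note p' = p p[THEN gen_eq_sym]
    have "ncl ?S ({(?xT, ?XT), (?xF, ?XF), (?yT, ?YT), (?yF, ?YF)} \<union> R) = ncl ?S ({(?xT, ?XT), (?yF, ?YF)} \<union> R)"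
      by (rule red) (simp_all add: inS[simplified] same_ends_def p')
    moreover have "ncl ?S ({(?xT, ?xF), (?yT, ?yF), (?XT, ?XF), (?YT, ?YF)} \<union> R) = ncl ?S ({(?xT, ?YF), (?yF, ?XT)} \<union> R)"
      by (rule red) (simp_all add: inS[simplified] same_ends_def p')
    moreover have "ncl ?S (insert (?xT, ?XT) (insert (?yF, ?YF) R)) = ncl ?S (insert (?xT, ?YF) (insert (?yF, ?XT) R))"
      by (rule ncl_insert_bridge_swap[where A = A]) (use fS inS sC RA in auto)
    ultimately show ?thesis unfolding L T by simp
  next
    case False
    have p: "(?xT, ?yF) \<in> gen_eq ?S R" "(?YT, ?XF) \<in> gen_eq ?S R" "(?yT, ?xF) \<in> gen_eq ?S R" "(?XT, ?YF) \<in> gen_eq ?S R"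
      by (rule path; use False in \<open>simp add: sC ty\<close>)+
    note p' = p p[THEN gen_eq_sym]
    have "ncl ?S ({(?xT, ?XT), (?xF, ?XF), (?yT, ?YT), (?yF, ?YF)} \<union> R) = ncl ?S ({(?xT, ?XT), (?YT, ?xF)} \<union> R)"
      by (rule red) (simp_all add: inS[simplified] same_ends_def p')
    moreover have "ncl ?S ({(?xT, ?xF), (?yT, ?yF), (?XT, ?XF), (?YT, ?YF)} \<union> R) = ncl ?S ({(?xT, ?xF), (?YT, ?XT)} \<union> R)"
      by (rule red) (simp_all add: inS[simplified] same_ends_def p')
    moreover have "ncl ?S (insert (?xT, ?XT) (insert (?YT, ?xF) R)) = ncl ?S (insert (?xT, ?xF) (insert (?YT, ?XT) R))"
      by (rule ncl_insert_bridge_swap[where A = A]) (use fS inS sC RA in auto)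
    ultimately show ?thesis unfolding L T by simp
  qed
qed

lemma delete_parallel:
  assumes \<phi>: "labels_cycles N \<sigma> \<phi>" and V: "finite V" "\<phi> ` N \<subseteq> V"
  shows "\<exists>\<sigma>' s'. signed_map (N - D) \<sigma>' (fix_set D \<tau>) s' \<and> labels_cycles (N - D) \<sigma>' \<phi> \<and>
    petrie (N - D) \<sigma>' (fix_set D \<tau>) + card (V - \<phi> ` (N - D)) = petrie N \<sigma> \<tau> + card (V - \<phi> ` N)"
proof -
  let ?ds = "[x, \<tau> x, y, \<tau> y]" and ?E = "links (- D) \<tau>" and ?\<tau> = "fix_set D \<tau>"
  let ?\<sigma> = "fold del ?ds \<sigma>"
  \<comment> \<open>Signs are reversed in the half of \<open>x\<close> only.\<close>
  define s' where "s' z \<longleftrightarrow> (s z \<noteq> (z \<in> C))" for z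
  have sub: "set ?ds \<subseteq> N" and setds: "set ?ds = D" using darts_in by auto
  note \<tau>D = D_closed
  have unt: "untouched d ?E" if "d \<in> set ?ds" for d
    using that \<tau>D unfolding setds by (auto simp: untouched_def)
  have W: "weight V \<phi> N \<sigma> (through D \<union> ?E) = weight V \<phi> (N - D) ?\<sigma> ?E"
    and P: "?\<sigma> permutes (N - D)" and L: "labels_cycles (N - D) ?\<sigma> \<phi>"
    using weight_del_set[OF distinct_darts sub rot fin \<phi> V unt] unfolding setds by simp_all
  have "corners \<sigma> \<union> (through D \<union> ?E) = paths D \<union> through D" by (auto simp: paths_def)
  then have "petrie N \<sigma> \<tau> + card (V - \<phi> ` N) = ncl (sides (N - D)) (corners ?\<sigma> \<union> ?E) + card (V - \<phi> ` (N - D))"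
    using W petrie_cut by (simp only: weight_def)
  moreover have "ncl (sides (N - D)) (corners ?\<sigma> \<union> ?E) = petrie (N - D) ?\<sigma> ?\<tau>"
    by (rule ncl_cong) (auto simp: fix_set_def intro!: gen_eq_base simp del: fold_simps)
  moreover have "signed_map (N - D) ?\<sigma> ?\<tau> s'"
  proof
    show "finite (N - D)" using fin by simp
    show "?\<sigma> permutes (N - D)" by fact
    show "?\<tau> permutes (N - D)" using permutes_fix_set[OF opp opp_comp D_closed darts_in] by simp
    show "defect (N - D) ?\<sigma> ?\<tau> = 0"
      using planar_del_set[OF distinct_darts sub rot permutes_fix_set(1)[OF opp opp_comp D_closed darts_in] fin planar_fix_set[OF rot opp opp_comp fin planar D_closed darts_in]]
      unfolding setds by (simp add: fix_set_def)
    fix z assume z: "z \<in> N - D"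
    then have "\<tau> z \<in> N - D" using \<tau>D by auto
    then show "?\<tau> z \<noteq> z" "?\<tau> (?\<tau> z) = z" "s' (?\<tau> z) \<longleftrightarrow> s' z"
      using z opp_fpf[of z] sign_opp[of z] C_opp[of z] by (auto simp: fix_set_def s'_def)
    \<comment> \<open>The reversed sign is evaluated at either side of a dart. On the four removed
      darts the sides lie in different halves, so the two values are opposite there, which is what
      removal needs to keep alternation.\<close>
    define u v where "u w \<longleftrightarrow> (s w \<noteq> ((w, False) \<in> side_C))" and "v w \<longleftrightarrow> (s w \<noteq> ((w, True) \<in> side_C))" for w
    have "u (?\<sigma> z) \<longleftrightarrow> \<not> v z"
    proof (rule alternating_del_set[where A = N])
      show "u (\<sigma> w) \<longleftrightarrow> \<not> v w" if "w \<in> N" for w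
        using that sign_rot side_C_rot by (auto simp: u_def v_def)
      show "d \<in> N" if "d \<in> set ?ds" for d using that sub by blast
      show "u d \<longleftrightarrow> \<not> v d" if "d \<in> set ?ds" for d
        using that side_C_D by (auto simp: u_def v_def)
      show "z \<in> N - set ?ds" using z unfolding setds .
    qed
    moreover have "?\<sigma> z \<in> N - D" using z P permutes_in_image by metis
    ultimately show "s' (?\<sigma> z) \<longleftrightarrow> \<not> s' z"
      using z side_C_other by (simp add: u_def v_def s'_def del: fold_simps)
  qed
  ultimately show ?thesis using L by metis
qed

end

lemma ncl_insert_sym: "ncl S (insert (a, b) R) = ncl S (insert (b, a) R)"
proof -
  have "(x, y) \<in> gen_eq S (insert (v, u) R)"
    if "(x, y) \<in> insert (u, v) R" "x \<in> S" "y \<in> S" for x y u v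
  proof (cases "(x, y) \<in> R")
    case True
    then show ?thesis using that by (intro gen_eq_base) auto
  next
    case False
    then have "(y, x) \<in> gen_eq S (insert (v, u) R)" using that by (intro gen_eq_base) auto
    then show ?thesis by (rule gen_eq_sym)
  qed
  then show ?thesis by (intro ncl_cong)
qed

section \<open>First returns\<close>

text \<open>First returns describe what a permutation becomes after the removal of darts. Applied to
  face permutations, they give the rotation of a contracted map and the arcs of a diagram.\<close>

inductive first_return :: "('a \<Rightarrow> 'a) \<Rightarrow> 'a set \<Rightarrow> 'a \<Rightarrow> 'a \<Rightarrow> bool" for p A where
  hit: "p x \<in> A \<Longrightarrow> first_return p A x (p x)"
| skip: "p x \<notin> A \<Longrightarrow> first_return p A (p x) y \<Longrightarrow> first_return p A x y"

lemma first_return_unique: "first_return p A x y \<Longrightarrow> first_return p A x z \<Longrightarrow> y = z"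
proof (induction arbitrary: z rule: first_return.induct)
  case (hit x)
  from hit.prems show ?case by cases (use hit.hyps in simp_all)
next
  case (skip x y)
  from skip.prems show ?case
  proof cases
    case hit
    then show ?thesis using skip.hyps by simp
  next
    case skip': skip
    show ?thesis by (rule skip.IH[OF skip'(2)])
  qed
qed

lemma first_return_subset:
  assumes "first_return p A x y" "B \<subseteq> A"
  shows "y \<in> B \<Longrightarrow> first_return p B x y" "y \<notin> B \<Longrightarrow> first_return p B y z \<Longrightarrow> first_return p B x z"
  using assms by (induction rule: first_return.induct) (auto intro: first_return.intros)

text \<open>If \<open>q\<close> is the first return map of \<open>p\<close> to \<open>A\<close>,
  then first returns of \<open>q\<close> to a smaller set are first returns of \<open>p\<close>:
  intermediate visits to \<open>A\<close> are merely skipped.\<close>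

lemma first_return_trans:
  assumes "first_return q B x y" "B \<subseteq> A" "x \<in> A"
    and q: "\<And>x. x \<in> A \<Longrightarrow> q x \<in> A \<and> first_return p A x (q x)"
  shows "first_return p B x y"
  using assms(1,3)
proof (induction rule: first_return.induct)
  case (hit x)
  then show ?case using first_return_subset(1)[OF _ assms(2)] q by blast
next
  case (skip x y)
  then show ?case using first_return_subset(2)[OF _ assms(2)] q by blast
qed

lemma first_return_del:
  assumes "p permutes S" "d \<in> S" "x \<in> S - {d}"
  shows "first_return p (S - {d}) x (del d p x)"
proof (cases "p x = d")
  case True
  have "p d \<noteq> d" using assms True by (metis DiffD2 injD insertI1 permutes_inj)
  then show ?thesis
    using True assms first_return.hit[of p d "S - {d}"] permutes_in_image[OF assms(1)]
    by (auto simp: del_def intro!: first_return.skip)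
next
  case False
  then show ?thesis
    using assms first_return.hit[of p x "S - {d}"] permutes_in_image[OF assms(1)] by (auto simp: del_def)
qed

lemma first_return_del_set:
  assumes "distinct ds" "set ds \<subseteq> S" "p permutes S" "x \<in> S - set ds"
  shows "first_return p (S - set ds) x (fold del ds p x)"
  using assms
proof (induction ds arbitrary: S p)
  case Nil
  then show ?case using first_return.hit[of p x S] permutes_in_image[of p S x] by simp
next
  case (Cons d ds)
  have d: "d \<in> S" "distinct ds" "set ds \<subseteq> S - {d}" and eq: "S - {d} - set ds = S - set (d # ds)"
    using Cons.prems by auto
  have p: "del d p permutes (S - {d})" using permutes_del[OF Cons.prems(3) d(1)] .
  have "first_return (del d p) (S - {d} - set ds) x (fold del ds (del d p) x)"
    using Cons.prems(4) by (intro Cons.IH d p) auto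
  then have "first_return p (S - {d} - set ds) x (fold del ds (del d p) x)"
  proof (rule first_return_trans[of _ _ _ _ "S - {d}"])
    fix z assume "z \<in> S - {d}"
    then show "del d p z \<in> S - {d} \<and> first_return p (S - {d}) z (del d p z)"
      using permutes_in_image[OF p] first_return_del[OF Cons.prems(3) d(1)] by blast
  qed (use Cons.prems(4) in auto)
  then show ?case unfolding eq by simp
qed

context signed_map
begin

section \<open>Gluing two components at a vertex\<close>

text \<open>The corners after \<open>a\<close> and after \<open>b\<close> are replaced by two
  corners across the components. With these corners cut out, parity shows that the two ends of each
  are still joined by the remainder of their walk, so the reconnection fuses two walks into one.
  Equal signs of \<open>a\<close> and \<open>b\<close> keep the alternation at the new
  vertex.\<close>

lemma merge:
  assumes a: "a \<in> N" and b: "b \<in> N" and sep: "(a, b) \<notin> gen_eq N (gr \<sigma> \<union> gr \<tau>)" and sab: "s a = s b"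
  shows "signed_map N (\<sigma> \<circ> transpose a b) \<tau> s"
    and "petrie N (\<sigma> \<circ> transpose a b) \<tau> + 1 = petrie N \<sigma> \<tau>"
    and "gen_eq N (gr (\<sigma> \<circ> transpose a b)) = gen_eq N (insert (a, b) (gr \<sigma>))"
proof -
  let ?p = "\<sigma> \<circ> transpose a b"
  have sep': "(a, b) \<notin> gen_eq N (gr \<sigma>)"
    using sep by (auto dest: gen_eq_mono[where R' = "gr \<sigma> \<union> gr \<tau>"] intro: gen_eq_base)
  show "gen_eq N (gr ?p) = gen_eq N (insert (a, b) (gr \<sigma>))"
    using gen_eq_transpose[OF rot fin a b sep', of "{}"] by simp
  have p: "?p permutes N" using rot a b by (simp add: permutes_transpose)
  show "signed_map N ?p \<tau> s"
  proof
    show "defect N ?p \<tau> = 0"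
      using defect_merge[OF opp rot fin a b sep'] planar sep p
      by (simp add: defect_commute[OF rot opp] defect_commute[OF p opp] Un_commute)
    show "s (?p x) \<longleftrightarrow> \<not> s x" if "x \<in> N" for x
      using that a b sab by (auto simp: transpose_def sign_rot)
  qed (use fin p opp opp_fpf sign_opp in auto)
  define A :: "('a \<times> bool) set" where "A = {z. (a, fst z) \<in> gen_eq N (gr \<sigma> \<union> gr \<tau>)}"
  \<comment> \<open>All walks with the corners after \<open>a\<close> and after \<open>b\<close> cut
    out; both rotations agree on the rest.\<close>
  define R where "R = Restr ({((x, True), (\<sigma> x, False)) | x. x \<noteq> a \<and> x \<noteq> b} \<union> links UNIV \<tau>) (sides N)"
  let ?aT = "(a, True)" and ?aF = "(\<sigma> a, False)" and ?bT = "(b, True)" and ?bF = "(\<sigma> b, False)"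
  let ?S = "sides N"
  have RA: "z \<in> A \<longleftrightarrow> w \<in> A" if "(z, w) \<in> R" for z w
  proof -
    have "(fst z, fst w) \<in> gen_eq N (gr \<sigma> \<union> gr \<tau>)"
      using that by (auto simp: R_def links_def intro!: gen_eq_base)
    then show ?thesis unfolding A_def by (auto intro: gen_eq_trans gen_eq_sym)
  qed
  have cl: "(x, \<sigma> x) \<in> gen_eq N (gr \<sigma> \<union> gr \<tau>)" if "x \<in> N" for x
    using that rot by (intro gen_eq_gr) auto
  have inA: "?aT \<in> A" "?aF \<in> A" "?bT \<notin> A" "?bF \<notin> A"
    using cl[OF a] cl[OF b] sep unfolding A_def by (auto dest: gen_eq_trans[OF _ gen_eq_sym])
  have "a \<noteq> b" using sep by auto
  \<comment> \<open>Of the four loose ends only two lie in the component concerned, so a walk that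
    starts at one of them can only finish at the other.\<close>
  have path: "(z, w) \<in> gen_eq ?S R" if zw: "z = ?aT \<and> w = ?aF \<or> z = ?bT \<and> w = ?bF" for z w
  proof (rule ccontr)
    assume n: "(z, w) \<notin> gen_eq ?S R"
    let ?X = "{?aT, ?aF, ?bT, ?bF}"
    have zS: "z \<in> ?S" using zw a b by auto
    have "even (card ({v. (z, v) \<in> gen_eq ?S R} \<inter> ?X))"
    proof (rule even_class_ends[where f = "map_prod \<tau> id" and g = "corner \<sigma>"])
      fix v assume "v \<in> ?S"
      then show "map_prod \<tau> id v \<in> ?S \<and> map_prod \<tau> id (map_prod \<tau> id v) = v \<and> map_prod \<tau> id v \<noteq> v \<and>
          (v, map_prod \<tau> id v) \<in> gen_eq ?S R"
        using opp_fpf by (auto simp: R_def intro!: gen_eq_base)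
    next
      fix v assume v: "v \<in> ?S - ?X"
      have inj: "\<sigma> x = \<sigma> y \<longleftrightarrow> x = y" for x y using rot by (metis permutes_inj injD)
      obtain x where x: "v = (x, True) \<and> corner \<sigma> v = (\<sigma> x, False) \<or> v = (\<sigma> x, False) \<and> corner \<sigma> v = (x, True)"
      proof (cases "snd v")
        case True
        then show ?thesis using that[of "fst v"] by (auto simp: corner_def prod_eq_iff)
      next
        case False
        then show ?thesis using that[of "inv \<sigma> (fst v)"] permutes_inverses[OF rot]
          by (auto simp: corner_def prod_eq_iff)
      qed
      then have xN: "x \<in> N" "x \<noteq> a" "x \<noteq> b" using v by auto
      then have "((x, True), (\<sigma> x, False)) \<in> gen_eq ?S R" by (intro gen_eq_base) (auto simp: R_def)
      then have "(v, corner \<sigma> v) \<in> gen_eq ?S R" using x gen_eq_sym by metis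
      moreover have "corner \<sigma> v \<in> ?S - ?X" using x xN inj by auto
      ultimately show "corner \<sigma> v \<in> ?S - ?X \<and> corner \<sigma> (corner \<sigma> v) = v \<and> corner \<sigma> v \<noteq> v \<and>
          (v, corner \<sigma> v) \<in> gen_eq ?S R"
        using corner_involution[OF rot] corner_neq by metis
    qed (use fin zS in auto)
    moreover have "{v. (z, v) \<in> gen_eq ?S R} \<inter> ?X = {z}"
    proof -
      have "v \<in> A \<longleftrightarrow> z \<in> A" if "(z, v) \<in> gen_eq ?S R" for v
        using gen_eq_invariant[OF that, of "\<lambda>v. v \<in> A"] RA by blast
      then show ?thesis using zw n inA by auto
    qed
    ultimately show False by simp
  qed
  have eq: "ncl ?S (corners q \<union> links UNIV \<tau>) = ncl ?S (insert (?aT, (q a, False)) (insert (?bT, (q b, False)) R))"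
    if "q permutes N" "\<And>x. x \<noteq> a \<Longrightarrow> x \<noteq> b \<Longrightarrow> q x = \<sigma> x" for q
  proof -
    have iff: "z \<in> ?S \<Longrightarrow> w \<in> ?S \<Longrightarrow> (z, w) \<in> corners q \<union> links UNIV \<tau> \<longleftrightarrow>
        (z, w) \<in> insert (?aT, (q a, False)) (insert (?bT, (q b, False)) R)" for z w
    proof (cases "(z, w) \<in> corners q")
      case True
      assume "z \<in> ?S" "w \<in> ?S"
      moreover obtain x where x: "z = (x, True)" "w = (q x, False)" using True by (auto simp: corners_def)
      ultimately show ?thesis
        using that(2)[of x] by (cases "x = a \<or> x = b") (auto simp: R_def)
    next
      case False
      assume zw: "z \<in> ?S" "w \<in> ?S"
      have "(z, w) \<in> R \<longleftrightarrow> (z, w) \<in> links UNIV \<tau>"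
      proof
        assume "(z, w) \<in> R"
        moreover have "w = (\<sigma> x, False) \<Longrightarrow> z = (x, True) \<Longrightarrow> x = a \<or> x = b" for x
          using False that(2)[of x] by auto
        ultimately show "(z, w) \<in> links UNIV \<tau>" by (auto simp: R_def)
      qed (use zw in \<open>auto simp: R_def\<close>)
      then show ?thesis using False by auto
    qed
    show ?thesis
      by (rule ncl_cong; rule gen_eq_base) (simp_all only: iff)
  qed
  have mono: "(z, w) \<in> gen_eq ?S (insert e R)" if "(z, w) \<in> gen_eq ?S R" for z w e
    using that by (rule gen_eq_mono) (auto intro: gen_eq_base)
  have "petrie N \<sigma> \<tau> = ncl ?S R"
    using eq[OF rot] path mono by (simp add: ncl_insert_same)
  moreover have "petrie N ?p \<tau> = ncl ?S (insert (?aT, ?bF) (insert (?aF, ?bT) R))"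
  proof -
    have "petrie N ?p \<tau> = ncl ?S (insert (?aT, ?bF) (insert (?bT, ?aF) R))"
      using eq[OF p] \<open>a \<noteq> b\<close> by simp
    also have "\<dots> = ncl ?S (insert (?aT, ?bF) (insert (?aF, ?bT) R))"
      using ncl_insert_sym[of ?S ?bT ?aF "insert (?aT, ?bF) R"] by (simp add: insert_commute)
    finally show ?thesis .
  qed
  moreover have "ncl ?S (insert (?aT, ?bF) (insert (?aF, ?bT) R)) + 1 +
    (if (?aT, ?aF) \<in> gen_eq ?S R \<and> (?bF, ?bT) \<in> gen_eq ?S R then 0 else 1) = ncl ?S R"
    by (rule ncl_insert_bridge[where A = A]) (use fin a b inA RA in auto)
  ultimately show "petrie N ?p \<tau> + 1 = petrie N \<sigma> \<tau>"
    using path[of ?aT ?aF] gen_eq_sym[OF path[of ?bT ?bF]] by simp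
qed

section \<open>Contraction of the edges at a vertex of degree two\<close>

text \<open>The two far ends \<open>\<tau> c\<close> and \<open>\<tau> (\<sigma> c)\<close> belong
  to different vertices, whose cyclic orders are spliced into one. Walks pass through the contracted
  part along two disjoint chains of sides and are merely shortened. The darts after the far ends
  survive, so the spliced vertex keeps at least one dart.\<close>

lemma contract_degree_two:
  assumes c: "c \<in> N" and two: "\<sigma> (\<sigma> c) = c" and sep: "(\<tau> c, \<tau> (\<sigma> c)) \<notin> gen_eq N (gr \<sigma>)"
  defines "D \<equiv> {c, \<tau> c, \<sigma> c, \<tau> (\<sigma> c)}"
  shows "\<exists>\<sigma>'. signed_map (N - D) \<sigma>' (fix_set D \<tau>) s \<and> petrie (N - D) \<sigma>' (fix_set D \<tau>) = petrie N \<sigma> \<tau> \<and>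
    \<sigma> (\<tau> c) \<in> N - D \<and> \<sigma> (\<tau> (\<sigma> c)) \<in> N - D \<and>
    (\<forall>x\<in>N - D. \<forall>y\<in>N - D. (x, y) \<in> gen_eq (N - D) (gr \<sigma>') \<longleftrightarrow>
      (x, y) \<in> gen_eq N (insert (\<tau> c, \<tau> (\<sigma> c)) (gr \<sigma>)))"
proof -
  let ?c = "\<sigma> c"
  define d e where "d = \<tau> c" and "e = \<tau> ?c"
  have inj: "\<sigma> x = \<sigma> y \<longleftrightarrow> x = y" for x y using rot by (metis permutes_inj injD)
  have eqc: "\<sigma> x = c \<longleftrightarrow> x = ?c" "\<sigma> x = ?c \<longleftrightarrow> x = c" for x using inj two by metis+
  have cN: "c \<in> N" "?c \<in> N" "d \<in> N" "e \<in> N" using c by (auto simp: d_def e_def)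
  have \<tau>d: "\<tau> c = d" "\<tau> d = c" "\<tau> ?c = e" "\<tau> e = ?c" by (auto simp: d_def e_def)
  have rot_step: "(x, \<sigma> x) \<in> gen_eq N (gr \<sigma>)" if "x \<in> N" for x using gen_eq_gr[OF rot that] by simp
  have sd: "s ?c = (\<not> s c)" "s d = s c" "s e = s ?c" using c by (simp_all add: d_def e_def sign_opp sign_rot)
  have loops: "(c, d) \<notin> gen_eq N (gr \<sigma>)" "(?c, e) \<notin> gen_eq N (gr \<sigma>)" "(d, e) \<notin> gen_eq N (gr \<sigma>)"
    using no_loop[OF cN(1)] no_loop[OF cN(2)] sep by (simp_all add: d_def e_def)
  have loops': "(?c, d) \<notin> gen_eq N (gr \<sigma>)" "(c, e) \<notin> gen_eq N (gr \<sigma>)"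
    using loops rot_step[OF c] by (meson gen_eq_trans gen_eq_sym)+
  have dist: "distinct [c, d, ?c, e]"
    using loops loops' sd by auto
  have D: "D = {c, d, ?c, e}" and setD: "set [c, d, ?c, e] = D" by (auto simp: D_def d_def e_def)
  have DN: "D \<subseteq> N" "set [c, d, ?c, e] \<subseteq> N" using cN by (auto simp: D)
  have \<tau>D: "\<tau> z \<in> D \<longleftrightarrow> z \<in> D" for z unfolding D using \<tau>d opp_inj by (metis insert_iff singletonD)
  have \<sigma>d: "\<sigma> d \<in> N - D"
  proof -
    have "\<sigma> d \<noteq> d" using sign_rot[OF cN(3)] by metis
    moreover have "\<sigma> d \<noteq> e" using loops rot_step[OF cN(3)] by metis
    moreover have "\<sigma> d \<noteq> ?c" "\<sigma> d \<noteq> c" using dist by (auto simp: eqc)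
    ultimately show ?thesis using cN by (simp add: D)
  qed
  have \<sigma>e: "\<sigma> e \<in> N - D"
  proof -
    have "\<sigma> e \<noteq> e" using sign_rot[OF cN(4)] by metis
    moreover have "\<sigma> e \<noteq> d" using loops rot_step[OF cN(4)] gen_eq_sym by metis
    moreover have "\<sigma> e \<noteq> ?c" "\<sigma> e \<noteq> c" using dist by (auto simp: eqc)
    ultimately show ?thesis using cN by (simp add: D)
  qed
  define \<phi> where "\<phi> = \<sigma> \<circ> \<tau>"
  have \<phi>: "\<phi> permutes N" unfolding \<phi>_def by (rule permutes_compose[OF opp rot])
  define q where "q = fix_set D \<tau>"
  have q: "q permutes (N - D)" "q permutes N" unfolding q_def using permutes_fix_set[OF opp opp_comp \<tau>D DN(1)] by simp_all
  have qq: "q (q x) = x" for x using \<tau>D by (simp add: q_def fix_set_def)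
  have q_out: "q x = \<tau> x" if "x \<notin> D" for x using that by (simp add: q_def fix_set_def)
  \<comment> \<open>Contraction is removal of the four darts from the face permutation. As
    \<open>q\<close> is an involution, \<open>\<psi> \<circ> q\<close> is the rotation with faces
    \<psi>.\<close>
  define \<psi> where "\<psi> = fold del [c, d, ?c, e] \<phi>"
  define p where "p = \<psi> \<circ> q"
  have "defect N \<phi> \<tau> = 0" unfolding \<phi>_def using defect_dual[OF rot opp opp_comp] planar by simp
  then have "defect N \<phi> q = 0" unfolding q_def
    using planar_fix_set[OF \<phi> opp opp_comp fin _ \<tau>D DN(1)] by simp
  then have \<psi>: "\<psi> permutes (N - D)" "defect (N - D) \<psi> q = 0"
    using planar_del_set[OF dist DN(2) \<phi> q(2) fin] unfolding setD \<psi>_def q_def by (auto simp: fix_set_def)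
  have p: "p permutes (N - D)" unfolding p_def by (rule permutes_compose[OF q(1) \<psi>(1)])
  have pl: "defect (N - D) p q = 0"
    unfolding p_def using defect_dual[OF \<psi>(1) q(1)] qq \<psi>(2) by (simp add: fun_eq_iff)
  have pin: "p x \<in> N - D \<longleftrightarrow> x \<in> N - D" for x using p by (rule permutes_in_image)
  \<comment> \<open>A face that would enter \<open>d\<close> continues through
    \<open>\<sigma> c\<close> to \<open>\<sigma> e\<close>, and one that would enter
    \<open>e\<close> continues through \<open>c\<close> to \<open>\<sigma> d\<close>.\<close>
  have p_eq: "p x = (if \<sigma> x = d then \<sigma> e else if \<sigma> x = e then \<sigma> d else \<sigma> x)" if x: "x \<in> N - D" for x
  proof -
    have \<tau>x: "\<tau> x \<in> N - D" using x \<tau>D by simp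
    have ret: "first_return \<phi> (N - D) (\<tau> x) (p x)"
      using first_return_del_set[OF dist DN(2) \<phi>] \<tau>x x unfolding setD by (simp add: p_def \<psi>_def q_out)
    have nc: "\<sigma> x \<noteq> c" "\<sigma> x \<noteq> ?c" using x by (auto simp: D eqc)
    have \<phi>x: "\<phi> (\<tau> x) = \<sigma> x" by (simp add: \<phi>_def)
    consider "\<sigma> x = d" | "\<sigma> x = e" | "\<sigma> x \<in> N - D" using x nc by (auto simp: D)
    then show ?thesis
    proof cases
      case 1
      have "first_return \<phi> (N - D) ?c (\<sigma> e)"
        using first_return.hit[of \<phi> ?c "N - D"] \<sigma>e by (simp add: \<phi>_def \<tau>d)
      then have "first_return \<phi> (N - D) d (\<sigma> e)"
        using first_return.skip[of \<phi> d "N - D" "\<sigma> e"] by (simp add: \<phi>_def \<tau>d D)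
      then have "first_return \<phi> (N - D) (\<tau> x) (\<sigma> e)"
        using first_return.skip[of \<phi> "\<tau> x" "N - D" "\<sigma> e"] 1 by (simp add: \<phi>x D)
      then show ?thesis using ret first_return_unique 1 by metis
    next
      case 2
      have "first_return \<phi> (N - D) c (\<sigma> d)"
        using first_return.hit[of \<phi> c "N - D"] \<sigma>d by (simp add: \<phi>_def \<tau>d)
      then have "first_return \<phi> (N - D) e (\<sigma> d)"
        using first_return.skip[of \<phi> e "N - D" "\<sigma> d"] by (simp add: \<phi>_def \<tau>d two D)
      then have "first_return \<phi> (N - D) (\<tau> x) (\<sigma> d)"
        using first_return.skip[of \<phi> "\<tau> x" "N - D" "\<sigma> d"] 2 by (simp add: \<phi>x D)
      then show ?thesis using ret first_return_unique 2 dist by (metis distinct_length_2_or_more)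
    next
      case 3
      then have "first_return \<phi> (N - D) (\<tau> x) (\<sigma> x)"
        using first_return.hit[of \<phi> "\<tau> x" "N - D"] by (simp add: \<phi>x)
      then show ?thesis using ret first_return_unique 3 D by (metis DiffD2 insertCI)
    qed
  qed
  have M: "signed_map (N - D) p q s"
  proof
    fix x assume x: "x \<in> N - D"
    then show "q x \<noteq> x" "s (q x) = s x"
      using opp_fpf sign_opp by (auto simp: q_out)
    show "q (q x) = x" by (rule qq)
    have "s (\<sigma> d) = (\<not> s d)" "s (\<sigma> e) = (\<not> s e)" using cN by (simp_all add: sign_rot)
    then show "s (p x) = (\<not> s x)"
      using p_eq[OF x] sign_rot[of x] x sd by (auto split: if_splits)
  qed (use fin p q pl in auto)
  have petrie: "petrie N \<sigma> \<tau> = petrie (N - D) p q"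
  proof -
    let ?R = "corners \<sigma> \<union> links UNIV \<tau>" and ?R' = "corners p \<union> links UNIV q"
    \<comment> \<open>The eight sides of the removed darts form two chains,
      \<open>(d, False)\<close>, \<open>(c, False)\<close>, \<open>(\<sigma> c, True)\<close>,
      \<open>(e, True)\<close> and the same with the two edges exchanged. Each chain is collapsed
      onto the surviving side that follows it.\<close>
    define f where "f z = (if z \<in> {(d, False), (c, False), (?c, True), (e, True)} then (\<sigma> e, False)
      else if fst z \<in> D then (\<sigma> d, False) else z)" for z
    have fD: "f (c, True) = (\<sigma> d, False)" "f (c, False) = (\<sigma> e, False)" "f (?c, True) = (\<sigma> e, False)"
      "f (?c, False) = (\<sigma> d, False)" "f (d, True) = (\<sigma> d, False)" "f (d, False) = (\<sigma> e, False)"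
      "f (e, True) = (\<sigma> e, False)" "f (e, False) = (\<sigma> d, False)"
      using dist by (auto simp: f_def D)
    have f_out: "f z = z" if "fst z \<notin> D" for z using that by (auto simp: f_def D)
    have base: "(z, w) \<in> gen_eq (sides N) ?R" if "(z, w) \<in> ?R" "fst z \<in> N" for z w
      using that by (intro gen_eq_base) (auto simp: corners_def links_def mem_Times_iff)
    have ch1: "(z, (\<sigma> e, False)) \<in> gen_eq (sides N) ?R" if "z \<in> {(d, False), (c, False), (?c, True), (e, True)}" for z
    proof -
      have 1: "((e, True), (\<sigma> e, False)) \<in> gen_eq (sides N) ?R" by (rule base) (use cN in auto)
      have 2: "((?c, True), (e, True)) \<in> gen_eq (sides N) ?R" by (rule base) (use cN \<tau>d in auto)
      have 3: "((?c, True), (c, False)) \<in> gen_eq (sides N) ?R" by (rule base) (use cN two in auto)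
      have 4: "((c, False), (d, False)) \<in> gen_eq (sides N) ?R" by (rule base) (use cN \<tau>d in auto)
      show ?thesis using that 1 gen_eq_trans[OF 2 1] gen_eq_trans[OF gen_eq_sym[OF 3] gen_eq_trans[OF 2 1]]
          gen_eq_trans[OF gen_eq_sym[OF 4] gen_eq_trans[OF gen_eq_sym[OF 3] gen_eq_trans[OF 2 1]]] by auto
    qed
    have ch2: "(z, (\<sigma> d, False)) \<in> gen_eq (sides N) ?R" if "z \<in> {(e, False), (?c, False), (c, True), (d, True)}" for z
    proof -
      have 1: "((d, True), (\<sigma> d, False)) \<in> gen_eq (sides N) ?R" by (rule base) (use cN in auto)
      have 2: "((c, True), (d, True)) \<in> gen_eq (sides N) ?R" by (rule base) (use cN \<tau>d in auto)
      have 3: "((c, True), (?c, False)) \<in> gen_eq (sides N) ?R" by (rule base) (use cN in auto)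
      have 4: "((?c, False), (e, False)) \<in> gen_eq (sides N) ?R" by (rule base) (use cN \<tau>d in auto)
      show ?thesis using that 1 gen_eq_trans[OF 2 1] gen_eq_trans[OF gen_eq_sym[OF 3] gen_eq_trans[OF 2 1]]
          gen_eq_trans[OF gen_eq_sym[OF 4] gen_eq_trans[OF gen_eq_sym[OF 3] gen_eq_trans[OF 2 1]]] by auto
    qed
    have sidesD: "z \<in> {(d, False), (c, False), (?c, True), (e, True)} \<or> z \<in> {(e, False), (?c, False), (c, True), (d, True)}"
      if "fst z \<in> D" for z using that by (cases z; cases "snd z") (auto simp: D)
    have f_rel: "(z, f z) \<in> gen_eq (sides N) ?R" for z
    proof (cases "fst z \<in> D")
      case True
      then show ?thesis using sidesD[OF True] ch1[of z] ch2[of z] fD by auto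
    qed (simp add: f_out)
    have fN: "f z \<in> sides (N - D)" if "z \<in> sides N" for z
      using that \<sigma>d \<sigma>e by (auto simp: f_def)
    show ?thesis
    proof (rule ncl_equiv[where f = f and g = id])
      fix z w assume zw: "(z, w) \<in> ?R" "z \<in> sides N" "w \<in> sides N"
      show "(f z, f w) \<in> gen_eq (sides (N - D)) ?R'"
      proof (cases "(z, w) \<in> corners \<sigma>")
        case True
        then obtain x where x: "z = (x, True)" "w = (\<sigma> x, False)" "x \<in> N" using zw by (auto simp: corners_def)
        show ?thesis
        proof (cases "x \<in> D")
          case True
          then have "f z = f w" using x fD f_out[of "(\<sigma> d, False)"] f_out[of "(\<sigma> e, False)"] \<sigma>d \<sigma>e two by (auto simp: D)
          then show ?thesis by simp
        next
          case False
          have "f w = (p x, False)"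
          proof (cases "\<sigma> x \<in> D")
            case True
            have "\<sigma> x \<noteq> c" "\<sigma> x \<noteq> ?c" using False by (auto simp: D eqc)
            then have "\<sigma> x = d \<or> \<sigma> x = e" using True by (auto simp: D)
            then show ?thesis using p_eq[of x] False x fD dist by auto
          next
            case nD: False
            then show ?thesis using p_eq[of x] False x f_out by (auto simp: D)
          qed
          then show ?thesis using False x f_out[of z] pin[of x] by (auto intro!: gen_eq_base)
        qed
      next
        case False
        then obtain x b where x: "z = (x, b)" "w = (\<tau> x, b)" using zw by (auto simp: links_def)
        show ?thesis
        proof (cases "x \<in> D")
          case True
          then have "f z = f w" using x fD \<tau>d by (cases b) (auto simp: D)
          then show ?thesis by simp
        next
          case False
          then have "\<tau> x \<notin> D" using \<tau>D by simp
          then show ?thesis using False x f_out[of z] f_out[of w] zw by (auto simp: q_out intro!: gen_eq_base)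
        qed
      qed
    next
      fix z w assume zw: "(z, w) \<in> ?R'" "z \<in> sides (N - D)" "w \<in> sides (N - D)"
      show "(id z, id w) \<in> gen_eq (sides N) ?R"
      proof (cases "(z, w) \<in> corners p")
        case True
        then obtain x where x: "z = (x, True)" "w = (p x, False)" "x \<in> N - D" using zw by (auto simp: corners_def)
        have 1: "((x, True), (\<sigma> x, False)) \<in> gen_eq (sides N) ?R" by (rule base) (use x in auto)
        have 2: "((\<sigma> x, False), w) \<in> gen_eq (sides N) ?R"
          using p_eq[OF x(3)] x(2) ch1[of "(d, False)"] ch2[of "(e, False)"] by auto
        show ?thesis using gen_eq_trans[OF 1 2] x by simp
      next
        case False
        then show ?thesis using zw by (auto simp: links_def q_out intro!: gen_eq_base)
      qed
    next
      show "(id (f z), z) \<in> gen_eq (sides N) ?R" for z using gen_eq_sym[OF f_rel] by simp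
      show "(f (id z), z) \<in> gen_eq (sides (N - D)) ?R'" if "z \<in> sides (N - D)" for z
        using that f_out[of z] by auto
    qed (use fN in auto)
  qed
  let ?G = "gen_eq (N - D) (gr p)" and ?H = "gen_eq N (insert (d, e) (gr \<sigma>))"
  have p_step: "(x, p x) \<in> ?G" if "x \<in> N - D" for x using gen_eq_gr[OF p that] by simp
  \<comment> \<open>Apart from \<open>u\<close> itself, the old vertex of \<open>u\<close> is still
    traversed in its order, beginning with \<open>\<sigma> u\<close>.\<close>
  have around: "(\<sigma> u, y) \<in> ?G" if y: "y \<in> orbit \<sigma> u" "y \<noteq> u" and u: "u = d \<or> u = e" for u y
    using y
  proof induction
    case base
    show ?case by simp
  next
    case (step y)
    show ?case
    proof (cases "y = u")
      case False
      have uN: "u \<in> N" using u cN by auto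
      have uy: "(u, y) \<in> gen_eq N (gr \<sigma>)" using step.hyps gen_eq_gr_orbit[OF rot fin uN] by simp
      then have yN: "y \<in> N" using uN gen_eq_closed by metis
      have u\<sigma>y: "(u, \<sigma> y) \<in> gen_eq N (gr \<sigma>)" using uy rot_step[OF yN] by (rule gen_eq_trans)
      have n: "(u, z) \<notin> gen_eq N (gr \<sigma>)" if "z \<in> D" "z \<noteq> u" for z
        using that u loops loops' gen_eq_sym unfolding D by (metis insert_iff singletonD)
      have "y \<in> N - D" using n uy False yN by blast
      moreover have "\<sigma> y \<noteq> d" "\<sigma> y \<noteq> e" using n[of d] n[of e] u u\<sigma>y step.prems by (auto simp: D)
      ultimately have "(y, \<sigma> y) \<in> ?G" using p_step[of y] p_eq[of y] by simp
      then show ?thesis using step.IH False gen_eq_trans by metis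
    qed simp
  qed
  have de: "(\<sigma> d, \<sigma> e) \<in> ?G"
  proof -
    \<comment> \<open>The predecessor of \<open>d\<close> is sent by \<open>p\<close> to
      \<open>\<sigma> e\<close>; this is where the two cycles are spliced.\<close>
    define z where "z = inv \<sigma> d"
    have z: "\<sigma> z = d" "z \<in> N" using rot cN by (auto simp: z_def permutes_inverses permutes_in_image permutes_inv)
    have "(d, z) \<in> gen_eq N (gr \<sigma>)" using rot_step[OF z(2)] z gen_eq_sym by metis
    then have zo: "z \<in> orbit \<sigma> d" using gen_eq_gr_orbit[OF rot fin cN(3)] by simp
    have "z \<noteq> d" using z sign_rot[OF cN(3)] by metis
    then have 1: "(\<sigma> d, z) \<in> ?G" using around[of z d] zo by simp
    then have "z \<in> N - D" using \<sigma>d gen_eq_closed by metis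
    then have "(z, \<sigma> e) \<in> ?G" using p_step[of z] p_eq[of z] z by simp
    with 1 show ?thesis by (rule gen_eq_trans)
  qed
  have "(x, y) \<in> ?G \<longleftrightarrow> (x, y) \<in> ?H" if xy: "x \<in> N - D" "y \<in> N - D" for x y
  proof
    have deH: "(d, e) \<in> ?H" using cN by (auto intro: gen_eq_base)
    have sH: "(x, \<sigma> x) \<in> ?H" if "x \<in> N" for x using that by (auto intro: gen_eq_base)
    show "(x, y) \<in> ?H" if "(x, y) \<in> ?G"
      using that
    proof (rule gen_eq_mono)
      fix a b assume ab: "(a, b) \<in> gr p" "a \<in> N - D" "b \<in> N - D"
      have "(d, \<sigma> e) \<in> ?H" "(e, \<sigma> d) \<in> ?H"
        using deH sH cN gen_eq_trans gen_eq_sym by metis+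
      then show "(a, b) \<in> ?H"
        using p_eq[OF ab(2)] sH[of a] ab by (auto split: if_splits dest: gen_eq_trans)
    qed
    \<comment> \<open>Every removed dart is pushed to a surviving dart of the spliced vertex. Which
      one is chosen for \<open>c\<close> and \<open>\<sigma> c\<close> is immaterial, as these form
      a cycle of their own.\<close>
    let ?g = "\<lambda>x. if x = e then \<sigma> e else if x \<in> D then \<sigma> d else x"
    have ed: "(\<sigma> e, \<sigma> d) \<in> ?G" using de by (rule gen_eq_sym)
    show "(x, y) \<in> ?G" if "(x, y) \<in> ?H"
    proof -
      have "(?g x, ?g y) \<in> ?G"
        using that
      proof (rule gen_eq_map)
        fix a b assume ab: "(a, b) \<in> insert (d, e) (gr \<sigma>)" "a \<in> N" "b \<in> N"
        show "(?g a, ?g b) \<in> ?G"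
        proof (cases "(a, b) = (d, e)")
          case True
          then show ?thesis using de dist by (auto simp: D)
        next
          case False
          then have b: "b = \<sigma> a" using ab by auto
          show ?thesis
          proof (cases "a \<in> D")
            case True
            then consider "a = c" | "a = ?c" | "a = d" | "a = e" by (auto simp: D)
            then show ?thesis using dist \<sigma>d \<sigma>e two b by cases (auto simp: D)
          next
            case aD: False
            then have a: "a \<in> N - D" using ab by simp
            have "\<sigma> a \<noteq> c" "\<sigma> a \<noteq> ?c" using aD by (auto simp: D eqc)
            then have "?g b = \<sigma> d \<and> p a = \<sigma> e \<or> ?g b = \<sigma> e \<and> p a = \<sigma> d \<or> ?g b = p a"
              using p_eq[OF a] b dist by (auto simp: D)
            then have "(p a, ?g b) \<in> ?G" using de ed by auto
            moreover have "?g a = a" using aD by (auto simp: D)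
            ultimately show ?thesis using gen_eq_trans[OF p_step[OF a]] by simp
          qed
        qed
      qed
      then show ?thesis using xy by (auto simp: D)
    qed
  qed
  then show ?thesis using M petrie \<sigma>d \<sigma>e unfolding q_def d_def e_def by auto
qed

end

section \<open>Curve counts of multigraphs\<close>

text \<open>The label \<phi> names the vertex of a dart and \<psi> its edge. Vertices outside the
  image of \<phi> are the isolated ones, which have no dart to stand for them.\<close>

definition represents ::
  "'a set \<Rightarrow> ('a \<Rightarrow> 'a) \<Rightarrow> ('a \<Rightarrow> 'a) \<Rightarrow> ('a \<Rightarrow> 'v) \<Rightarrow> ('a \<Rightarrow> 'e) \<Rightarrow> ('v, 'e) mgraph \<Rightarrow> bool" where
  "represents N p q \<phi> \<psi> G \<longleftrightarrow>
    finite (verts G) \<and> \<phi> ` N \<subseteq> verts G \<and> labels_cycles N p \<phi> \<and> edges G = \<psi> ` N \<and>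
    (\<forall>x\<in>N. \<forall>y\<in>N. \<psi> x = \<psi> y \<longleftrightarrow> y = x \<or> y = q x) \<and> (\<forall>x\<in>N. ends G (\<psi> x) = {\<phi> x, \<phi> (q x)})"

text \<open>The number of state curves that meet non-alternating edges, an isolated vertex counting for one curve.\<close>

definition curve_count :: "('v, 'e) mgraph \<Rightarrow> nat \<Rightarrow> bool" where
  "curve_count G n \<longleftrightarrow> (\<exists>(N :: nat set) p q s \<phi> \<psi>. signed_map N p q s \<and> represents N p q \<phi> \<psi> G \<and>
     n = petrie N p q + card (verts G - \<phi> ` N))"

lemma curve_countI:
  "signed_map N p q s \<Longrightarrow> represents N p q \<phi> \<psi> G \<Longrightarrow> n = petrie N p q + card (verts G - \<phi> ` N) \<Longrightarrow> curve_count G n"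
  for N :: "nat set"
  unfolding curve_count_def by blast

text \<open>Identification by an arbitrary map rather than by passing to classes: the quotient may
  then keep the vertex type of \<open>G\<close>, so that an induction over graphs can run through
  contractions.\<close>

definition quotient_by :: "('v \<Rightarrow> 'w) \<Rightarrow> 'e set \<Rightarrow> ('v, 'e) mgraph \<Rightarrow> ('w, 'e) mgraph \<Rightarrow> bool" where
  "quotient_by f F G H \<longleftrightarrow>
    verts H = f ` verts G \<and> edges H = edges G - F \<and> (\<forall>e\<in>edges H. ends H e = f ` ends G e)"

lemma gen_eq_insert_iff:
  assumes "a \<in> S" "b \<in> S"
  shows "(x, y) \<in> gen_eq S (insert (a, b) R) \<longleftrightarrow> (x, y) \<in> gen_eq S R \<or>
    ((x, a) \<in> gen_eq S R \<or> (x, b) \<in> gen_eq S R) \<and> ((y, a) \<in> gen_eq S R \<or> (y, b) \<in> gen_eq S R)"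
proof
  have mono: "(z, w) \<in> gen_eq S (insert (a, b) R)" if "(z, w) \<in> gen_eq S R" for z w
    using that by (rule gen_eq_mono) (auto intro: gen_eq_base)
  have ab: "(a, b) \<in> gen_eq S (insert (a, b) R)" using assms by (auto intro: gen_eq_base)
  assume "(x, y) \<in> gen_eq S R \<or>
    ((x, a) \<in> gen_eq S R \<or> (x, b) \<in> gen_eq S R) \<and> ((y, a) \<in> gen_eq S R \<or> (y, b) \<in> gen_eq S R)"
  then show "(x, y) \<in> gen_eq S (insert (a, b) R)"
    using mono ab by (meson gen_eq_sym gen_eq_trans)
next
  assume "(x, y) \<in> gen_eq S (insert (a, b) R)"
  then show "(x, y) \<in> gen_eq S R \<or>
    ((x, a) \<in> gen_eq S R \<or> (x, b) \<in> gen_eq S R) \<and> ((y, a) \<in> gen_eq S R \<or> (y, b) \<in> gen_eq S R)"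
    using gen_eq_insert[of x y S a b R] gen_eq_sym by metis
qed

locale represented_map = signed_map N \<sigma> \<tau> s
  for N :: "nat set" and \<sigma> \<tau> s +
  fixes \<phi> :: "nat \<Rightarrow> 'v" and \<psi> :: "nat \<Rightarrow> 'e" and G :: "('v, 'e) mgraph"
  assumes rep: "represents N \<sigma> \<tau> \<phi> \<psi> G"
begin

lemma finite_verts: "finite (verts G)"
  and label_verts: "\<phi> ` N \<subseteq> verts G"
  and labels: "labels_cycles N \<sigma> \<phi>"
  and edges_eq: "edges G = \<psi> ` N"
  and edge_eq: "x \<in> N \<Longrightarrow> y \<in> N \<Longrightarrow> \<psi> x = \<psi> y \<longleftrightarrow> y = x \<or> y = \<tau> x"
  and ends_eq: "x \<in> N \<Longrightarrow> ends G (\<psi> x) = {\<phi> x, \<phi> (\<tau> x)}"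
  using rep by (auto simp: represents_def)

lemma label_eq: "x \<in> N \<Longrightarrow> y \<in> N \<Longrightarrow> \<phi> x = \<phi> y \<longleftrightarrow> (x, y) \<in> gen_eq N (gr \<sigma>)"
  using labels by (simp add: labels_cycles_def)

lemma label_rot: "x \<in> N \<Longrightarrow> \<phi> (\<sigma> x) = \<phi> x"
  using label_eq[of x "\<sigma> x"] gen_eq_gr[OF rot _ order_refl] by simp

lemma label_loop: "x \<in> N \<Longrightarrow> \<phi> x \<noteq> \<phi> (\<tau> x)"
  using no_loop label_eq by simp

lemma edge_opp: "x \<in> N \<Longrightarrow> \<psi> (\<tau> x) = \<psi> x"
  using edge_eq[of x "\<tau> x"] by simp

lemma dart_of_edge:
  assumes "e \<in> edges G" "v \<in> ends G e"
  obtains x where "x \<in> N" "\<psi> x = e" "\<phi> x = v"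
proof -
  obtain x where x: "x \<in> N" "\<psi> x = e" using assms(1) edges_eq by auto
  then consider "\<phi> x = v" | "\<phi> (\<tau> x) = v" using assms(2) ends_eq by auto
  then show thesis using that[of x] that[of "\<tau> x"] x edge_opp[OF x(1)] by cases simp_all
qed

lemma vertex_component:
  assumes "(x, y) \<in> gen_eq N (gr \<sigma> \<union> gr \<tau>)"
  shows "(\<phi> x, \<phi> y) \<in> gen_eq (verts G) (joined_by G (edges G))"
  using assms
proof (rule gen_eq_map)
  fix a b assume ab: "(a, b) \<in> gr \<sigma> \<union> gr \<tau>" "a \<in> N" "b \<in> N"
  show "(\<phi> a, \<phi> b) \<in> gen_eq (verts G) (joined_by G (edges G))"
  proof (cases "b = \<sigma> a")
    case True
    then show ?thesis using label_rot ab by simp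
  next
    case False
    then have "(\<phi> a, \<phi> b) \<in> joined_by G (edges G)"
      using ab ends_eq[of a] edges_eq by (auto simp: joined_by_def)
    then show ?thesis using label_verts ab by (intro gen_eq_base) auto
  qed
qed

lemma petrie_count: "curve_count G (petrie N \<sigma> \<tau> + card (verts G - \<phi> ` N))"
  unfolding curve_count_def using rep signed_map_axioms by blast

lemma curve_count_delete:
  assumes "parallel_edges G e1 e2"
  shows "curve_count (delete_edges G {e1, e2}) (petrie N \<sigma> \<tau> + card (verts G - \<phi> ` N))"
proof -
  have e: "e1 \<in> edges G" "e2 \<in> edges G" "e1 \<noteq> e2" "ends G e1 = ends G e2"
    using assms by (auto simp: parallel_edges_def)
  obtain x where x: "x \<in> N" "\<psi> x = e1" using e edges_eq by auto
  have "\<phi> x \<in> ends G e2" using e x ends_eq by auto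
  then obtain y where y: "y \<in> N" "\<psi> y = e2" "\<phi> y = \<phi> x" using e dart_of_edge by metis
  have "{\<phi> x, \<phi> (\<tau> x)} = {\<phi> x, \<phi> (\<tau> y)}"
    using e(4) ends_eq[OF x(1)] ends_eq[OF y(1)] unfolding x(2) y(2,3) by simp
  then have same': "\<phi> (\<tau> x) = \<phi> (\<tau> y)"
    by (metis doubleton_eq_iff)
  have ne: "x \<noteq> y" "\<tau> x \<noteq> y" using e(3) x y edge_eq[OF x(1) y(1)] by auto
  have x'y': "\<tau> x \<in> N" "\<tau> y \<in> N" using x y by simp_all
  have same: "(x, y) \<in> gen_eq N (gr \<sigma>)" "(\<tau> x, \<tau> y) \<in> gen_eq N (gr \<sigma>)"
    using label_eq[OF x(1) y(1)] y(3) label_eq[OF x'y'] same' by metis+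
  interpret P: parallel_darts N \<sigma> \<tau> s x y
    by unfold_locales (fact x(1) y(1) ne same)+
  obtain \<sigma>' s' where M: "signed_map (N - P.D) \<sigma>' (fix_set P.D \<tau>) s'" and L: "labels_cycles (N - P.D) \<sigma>' \<phi>" and
    W: "petrie (N - P.D) \<sigma>' (fix_set P.D \<tau>) + card (verts G - \<phi> ` (N - P.D)) = petrie N \<sigma> \<tau> + card (verts G - \<phi> ` N)"
    using P.delete_parallel[OF labels finite_verts label_verts] by blast
  have D: "z \<in> P.D \<longleftrightarrow> \<psi> z = e1 \<or> \<psi> z = e2" if "z \<in> N" for z
    using edge_eq[OF x(1) that] edge_eq[OF y(1) that] unfolding x(2) y(2) by blast
  have "represents (N - P.D) \<sigma>' (fix_set P.D \<tau>) \<phi> \<psi> (delete_edges G {e1, e2})"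
    unfolding represents_def
  proof (intro conjI ballI)
    show "edges (delete_edges G {e1, e2}) = \<psi> ` (N - P.D)"
      using D by (auto simp: delete_edges_def edges_eq)
    show "\<phi> ` (N - P.D) \<subseteq> verts (delete_edges G {e1, e2})"
      using label_verts by (auto simp: delete_edges_def)
    fix z assume z: "z \<in> N - P.D"
    then show "ends (delete_edges G {e1, e2}) (\<psi> z) = {\<phi> z, \<phi> (fix_set P.D \<tau> z)}"
      using ends_eq by (simp add: delete_edges_def fix_set_def)
    fix w assume "w \<in> N - P.D"
    then show "(\<psi> z = \<psi> w) = (w = z \<or> w = fix_set P.D \<tau> z)"
      using edge_eq z by (simp add: fix_set_def)
  qed (use L finite_verts in \<open>auto simp: delete_edges_def\<close>)
  then show ?thesis
    by (rule curve_countI[OF M]) (use W in \<open>simp add: delete_edges_def\<close>)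
qed

text \<open>If only vertices with darts are identified, the isolated vertices stay distinct and are
  not touched.\<close>

lemma unlabelled_quotient:
  assumes f: "\<And>x y. x \<in> verts G \<Longrightarrow> y \<in> verts G \<Longrightarrow> f x = f y \<longleftrightarrow> x = y \<or> x \<in> W \<and> y \<in> W"
    and W: "W \<subseteq> \<phi> ` N"
  shows "card (f ` verts G - f ` \<phi> ` N) = card (verts G - \<phi> ` N)"
proof -
  have "f ` verts G - f ` \<phi> ` N = f ` (verts G - \<phi> ` N)"
    using f W label_verts by blast
  moreover have "inj_on f (verts G - \<phi> ` N)"
    using f W by (auto simp: inj_on_def)
  ultimately show ?thesis by (simp add: card_image)
qed

text \<open>If both vertices carry darts, two walks fuse. If one of them is isolated, the walks stay
  as they are and one isolated vertex is absorbed. The count drops by one in either case.\<close>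

lemma curve_count_merge:
  assumes uv: "u \<in> verts G" "v \<in> verts G" "(u, v) \<notin> gen_eq (verts G) (joined_by G (edges G))"
    and H: "quotient_by f {} G H"
    and f: "\<And>x y. x \<in> verts G \<Longrightarrow> y \<in> verts G \<Longrightarrow> f x = f y \<longleftrightarrow> x = y \<or> x \<in> {u, v} \<and> y \<in> {u, v}"
  shows "\<exists>n. curve_count H n \<and> n + 1 = petrie N \<sigma> \<tau> + card (verts G - \<phi> ` N)"
proof -
  have "u \<noteq> v" using uv by auto
  have repH: "represents N p \<tau> (f \<circ> \<phi>) \<psi> H" if "labels_cycles N p (f \<circ> \<phi>)" for p
    unfolding represents_def
  proof (intro conjI ballI)
    show "ends H (\<psi> x) = {(f \<circ> \<phi>) x, (f \<circ> \<phi>) (\<tau> x)}" if "x \<in> N" for x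
      using that H ends_eq edges_eq by (auto simp: quotient_by_def)
  qed (use H that finite_verts label_verts edges_eq edge_eq in \<open>auto simp: quotient_by_def\<close>)
  have vH: "verts H = f ` verts G" using H by (simp add: quotient_by_def)
  have im: "(f \<circ> \<phi>) ` N = f ` \<phi> ` N" by (rule image_comp[symmetric])
  show ?thesis
  proof (cases "u \<in> \<phi> ` N \<and> v \<in> \<phi> ` N")
    case True
    then obtain a b' where ab': "a \<in> N" "b' \<in> N" "\<phi> a = u" "\<phi> b' = v" by auto
    \<comment> \<open>The next dart at the same vertex has the other sign, so a dart with the sign
      of \<open>a\<close> can be chosen.\<close>
    define b where "b = (if s b' = s a then b' else \<sigma> b')"
    have ab: "a \<in> N" "b \<in> N" "\<phi> a = u" "\<phi> b = v" "s a = s b"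
      using ab' label_rot sign_rot by (auto simp: b_def)
    have sep: "(a, b) \<notin> gen_eq N (gr \<sigma> \<union> gr \<tau>)"
      using vertex_component uv ab by blast
    let ?p = "\<sigma> \<circ> transpose a b"
    note m = merge[OF ab(1,2) sep ab(5)]
    have "labels_cycles N ?p (f \<circ> \<phi>)"
      unfolding labels_cycles_def
    proof (intro ballI)
      fix x y assume xy: "x \<in> N" "y \<in> N"
      then have "f (\<phi> x) = f (\<phi> y) \<longleftrightarrow> \<phi> x = \<phi> y \<or> (\<phi> x = u \<or> \<phi> x = v) \<and> (\<phi> y = u \<or> \<phi> y = v)"
        using f[of "\<phi> x" "\<phi> y"] label_verts by auto
      then show "((f \<circ> \<phi>) x = (f \<circ> \<phi>) y) = ((x, y) \<in> gen_eq N (gr ?p))"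
        unfolding m(3) gen_eq_insert_iff[OF ab(1,2)] using label_eq xy ab by auto
    qed
    from repH[OF this] have "curve_count H (petrie N ?p \<tau> + card (f ` verts G - f ` \<phi> ` N))"
      unfolding curve_count_def using m(1) vH im by metis
    moreover have "card (f ` verts G - f ` \<phi> ` N) = card (verts G - \<phi> ` N)"
      by (rule unlabelled_quotient[OF f]) (use True in auto)
    ultimately show ?thesis using m(2) by force
  next
    case False
    \<comment> \<open>Here \<open>v'\<close> is an isolated one of the two vertices.\<close>
    then obtain u' v' where uv': "{u, v} = {u', v'}" "v' \<notin> \<phi> ` N" "u' \<noteq> v'" "u' \<in> verts G" "v' \<in> verts G"
      using \<open>u \<noteq> v\<close> uv by (metis insert_commute)
    note f' = f[unfolded uv'(1)]
    have "labels_cycles N \<sigma> (f \<circ> \<phi>)"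
      unfolding labels_cycles_def
    proof (intro ballI)
      fix x y assume xy: "x \<in> N" "y \<in> N"
      then have "\<phi> x \<noteq> v'" "\<phi> y \<noteq> v'" "\<phi> x \<in> verts G" "\<phi> y \<in> verts G"
        using label_verts uv'(2) by auto
      then have "f (\<phi> x) = f (\<phi> y) \<longleftrightarrow> \<phi> x = \<phi> y"
        using f'[of "\<phi> x" "\<phi> y"] by auto
      then show "((f \<circ> \<phi>) x = (f \<circ> \<phi>) y) = ((x, y) \<in> gen_eq N (gr \<sigma>))"
        using label_eq xy by simp
    qed
    from repH[OF this] have "curve_count H (petrie N \<sigma> \<tau> + card (f ` verts G - f ` \<phi> ` N))"
      unfolding curve_count_def using signed_map_axioms vH im by metis
    moreover have "f ` verts G - f ` \<phi> ` N = f ` (verts G - \<phi> ` N - {v'})"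
    proof
      show "f ` verts G - f ` \<phi> ` N \<subseteq> f ` (verts G - \<phi> ` N - {v'})"
      proof
        fix z assume "z \<in> f ` verts G - f ` \<phi> ` N"
        then obtain x where x: "x \<in> verts G" "z = f x" "f x \<notin> f ` \<phi> ` N" by auto
        have fuv: "f u' = f v'" using f' uv' by auto
        show "z \<in> f ` (verts G - \<phi> ` N - {v'})"
        proof (cases "x = v'")
          case True
          then have "z = f u'" "f u' \<notin> f ` \<phi> ` N" using x fuv by simp_all
          then have "u' \<notin> \<phi> ` N" by blast
          then show ?thesis using uv' \<open>z = f u'\<close> by blast
        qed (use x in blast)
      qed
      show "f ` (verts G - \<phi> ` N - {v'}) \<subseteq> f ` verts G - f ` \<phi> ` N"
        using f' uv' label_verts by blast
    qed
    moreover have "inj_on f (verts G - \<phi> ` N - {v'})"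
      using f' by (auto simp: inj_on_def)
    then have "card (f ` (verts G - \<phi> ` N - {v'})) + 1 = card (verts G - \<phi> ` N)"
      using uv' finite_verts card_Suc_Diff1[of "verts G - \<phi> ` N" v'] by (simp add: card_image)
    ultimately show ?thesis by force
  qed
qed

text \<open>Loops being absent, degree two means that \<open>v\<close> has two darts, one for each
  edge, and the rotation exchanges them because it changes signs. The ends of the edges differ, so
  the far vertices are distinct and the contraction of maps applies.\<close>

lemma curve_count_degree_two:
  assumes v: "degree G v = 2" and e: "e1 \<in> edges G" "e2 \<in> edges G" "e1 \<noteq> e2" "v \<in> ends G e1" "v \<in> ends G e2"
    and ne: "ends G e1 \<noteq> ends G e2" and H: "quotient_by f {e1, e2} G H"
    and f: "\<And>x y. x \<in> verts G \<Longrightarrow> y \<in> verts G \<Longrightarrow>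
      f x = f y \<longleftrightarrow> x = y \<or> x \<in> ends G e1 \<union> ends G e2 \<and> y \<in> ends G e1 \<union> ends G e2"
  shows "curve_count H (petrie N \<sigma> \<tau> + card (verts G - \<phi> ` N))"
proof -
  obtain c where c: "c \<in> N" "\<psi> c = e1" "\<phi> c = v" using dart_of_edge e by metis
  obtain d where d: "d \<in> N" "\<psi> d = e2" "\<phi> d = v" using dart_of_edge e by metis
  have fin_e: "finite (edges G)" using fin edges_eq by simp
  have "ends G e \<noteq> {v}" if e: "e \<in> edges G" for e
  proof -
    obtain x where "x \<in> N" "e = \<psi> x" using e edges_eq by auto
    then have "\<phi> x \<in> ends G e" "\<phi> (\<tau> x) \<in> ends G e" "\<phi> x \<noteq> \<phi> (\<tau> x)"
      using ends_eq label_loop by simp_all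
    then show ?thesis by (metis singletonD)
  qed
  then have no: "{e \<in> edges G. ends G e = {v}} = {}" by blast
  have "card {e \<in> edges G. v \<in> ends G e} = 2"
    using v unfolding degree_def no by (simp only: card.empty)
  moreover have "{e1, e2} \<subseteq> {e \<in> edges G. v \<in> ends G e}" "card {e1, e2} = 2" using e by auto
  ultimately have inc: "{e \<in> edges G. v \<in> ends G e} = {e1, e2}"
    using card_subset_eq[of "{e \<in> edges G. v \<in> ends G e}" "{e1, e2}"] fin_e by auto
  have at_v: "z = c \<or> z = d" if z: "z \<in> N" "\<phi> z = v" for z
  proof -
    have "\<psi> z \<in> {e1, e2}" unfolding inc[symmetric] using z edges_eq ends_eq by auto
    then have "z \<in> {c, \<tau> c, d, \<tau> d}" using c d z edge_eq by auto
    then show ?thesis using z c d label_loop by auto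
  qed
  have "\<sigma> c = d" using at_v[of "\<sigma> c"] label_rot c sign_rot[of c] by auto
  moreover have "\<sigma> d = c" using at_v[of "\<sigma> d"] label_rot d sign_rot[of d] by auto
  ultimately have two: "\<sigma> (\<sigma> c) = c" and sc: "\<sigma> c = d" by simp_all
  have "\<phi> (\<tau> c) \<noteq> \<phi> (\<tau> (\<sigma> c))" using ne c d sc ends_eq by auto
  then have sep: "(\<tau> c, \<tau> (\<sigma> c)) \<notin> gen_eq N (gr \<sigma>)" using label_eq c d sc by simp
  let ?D = "{c, \<tau> c, \<sigma> c, \<tau> (\<sigma> c)}"
  let ?\<tau> = "fix_set ?D \<tau>"
  obtain p where M: "signed_map (N - ?D) p ?\<tau> s" and P: "petrie (N - ?D) p ?\<tau> = petrie N \<sigma> \<tau>"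
    and \<sigma>cd: "\<sigma> (\<tau> c) \<in> N - ?D" "\<sigma> (\<tau> (\<sigma> c)) \<in> N - ?D"
    and ge: "\<forall>x\<in>N - ?D. \<forall>y\<in>N - ?D. (x, y) \<in> gen_eq (N - ?D) (gr p) \<longleftrightarrow>
      (x, y) \<in> gen_eq N (insert (\<tau> c, \<tau> (\<sigma> c)) (gr \<sigma>))"
    using contract_degree_two[OF c(1) two sep] by blast
  have W: "ends G e1 \<union> ends G e2 = {v, \<phi> (\<tau> c), \<phi> (\<tau> d)}" using c d ends_eq by auto
  have D: "z \<in> ?D \<longleftrightarrow> \<psi> z = e1 \<or> \<psi> z = e2" if "z \<in> N" for z
    using edge_eq[OF c(1) that] edge_eq[OF d(1) that] unfolding c(2) d(2) sc by blast
  have "labels_cycles (N - ?D) p (f \<circ> \<phi>)"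
    unfolding labels_cycles_def
  proof (intro ballI)
    fix x y assume xy: "x \<in> N - ?D" "y \<in> N - ?D"
    then have "\<phi> x \<noteq> v" "\<phi> y \<noteq> v" using at_v sc by auto
    then have "f (\<phi> x) = f (\<phi> y) \<longleftrightarrow> \<phi> x = \<phi> y \<or>
        (\<phi> x = \<phi> (\<tau> c) \<or> \<phi> x = \<phi> (\<tau> d)) \<and> (\<phi> y = \<phi> (\<tau> c) \<or> \<phi> y = \<phi> (\<tau> d))"
      using f[of "\<phi> x" "\<phi> y", unfolded W] label_verts xy by auto
    moreover have "(x, y) \<in> gen_eq (N - ?D) (gr p) \<longleftrightarrow> (x, y) \<in> gen_eq N (insert (\<tau> c, \<tau> d) (gr \<sigma>))"
      using ge xy sc by blast
    ultimately show "((f \<circ> \<phi>) x = (f \<circ> \<phi>) y) = ((x, y) \<in> gen_eq (N - ?D) (gr p))"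
      using gen_eq_insert_iff[of "\<tau> c" N "\<tau> d" x y "gr \<sigma>"] label_eq xy c d by auto
  qed
  moreover have im: "(f \<circ> \<phi>) ` (N - ?D) = f ` \<phi> ` N"
  proof
    show "f ` \<phi> ` N \<subseteq> (f \<circ> \<phi>) ` (N - ?D)"
    proof
      fix z assume "z \<in> f ` \<phi> ` N"
      then obtain x where x: "x \<in> N" "z = f (\<phi> x)" by auto
      show "z \<in> (f \<circ> \<phi>) ` (N - ?D)"
      proof (cases "x \<in> ?D")
        case True
        have "\<phi> x \<in> ends G e1 \<union> ends G e2" unfolding W using True c d sc by auto
        \<comment> \<open>The dart after \<open>\<tau> c\<close> survives at the merged vertex, so
          the labels of removed darts are still attained.\<close>
        moreover have "\<phi> (\<sigma> (\<tau> c)) \<in> ends G e1 \<union> ends G e2" unfolding W using label_rot c by simp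
        ultimately have "z = f (\<phi> (\<sigma> (\<tau> c)))"
          using x(2) f[OF subsetD[OF label_verts imageI] subsetD[OF label_verts imageI], of x "\<sigma> (\<tau> c)"] x(1) \<sigma>cd(1)
          by blast
        then show ?thesis using \<sigma>cd(1) by auto
      qed (use x in auto)
    qed
  qed auto
  moreover have fix_in: "?\<tau> z = \<tau> z" if "z \<in> N - ?D" for z using that unfolding fix_set_def by simp
  ultimately have "represents (N - ?D) p ?\<tau> (f \<circ> \<phi>) \<psi> H"
    unfolding represents_def
  proof (intro conjI ballI)
    show "edges H = \<psi> ` (N - ?D)"
      using D H by (auto simp: quotient_by_def edges_eq)
    fix z assume z: "z \<in> N - ?D"
    then have "\<psi> z \<in> edges H" using D[of z] H by (auto simp: quotient_by_def edges_eq)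
    then show "ends H (\<psi> z) = {(f \<circ> \<phi>) z, (f \<circ> \<phi>) (?\<tau> z)}"
      using z H ends_eq[of z] fix_in by (auto simp: quotient_by_def)
    fix w assume "w \<in> N - ?D"
    then show "(\<psi> z = \<psi> w) = (w = z \<or> w = ?\<tau> z)"
      using edge_eq z fix_in by simp
  qed (use H finite_verts label_verts in \<open>auto simp: quotient_by_def\<close>)
  moreover have "card (verts H - (f \<circ> \<phi>) ` (N - ?D)) = card (verts G - \<phi> ` N)"
  proof -
    have "card (f ` verts G - f ` \<phi> ` N) = card (verts G - \<phi> ` N)"
      by (rule unlabelled_quotient[OF f]) (use c d in \<open>auto simp: W\<close>)
    then show ?thesis unfolding im using H by (simp add: quotient_by_def)
  qed
  ultimately show ?thesis using M P unfolding curve_count_def by metis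
qed

end

text \<open>Alternating signs forbid cycles of odd length, in particular of length one or three, and
  the hypothesis on \<open>p\<close> forbids length two.\<close>

lemma four_cyc_le_card:
  assumes "finite S" "p permutes S" "\<And>x. x \<in> S \<Longrightarrow> p (p x) \<noteq> x" "\<And>x. x \<in> S \<Longrightarrow> s (p x) \<longleftrightarrow> \<not> s x"
  shows "4 * cyc S p \<le> card S"
proof -
  have pin: "p x \<in> S \<longleftrightarrow> x \<in> S" for x using assms(2) by (rule permutes_in_image)
  have four: "4 \<le> card {y \<in> S. orbit p y = orbit p x}" if x: "x \<in> S" for x
  proof -
    have pe: "s (p x) = (\<not> s x)" "s (p (p x)) = s x" "s (p (p (p x))) = (\<not> s x)"
      using assms(4)[of x] assms(4)[of "p x"] assms(4)[of "p (p x)"] x pin by auto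
    have "p x \<noteq> x" "p (p (p x)) \<noteq> x" "p (p x) \<noteq> p x" "p (p (p x)) \<noteq> p (p x)"
      using pe by (metis (full_types))+
    moreover have "p (p x) \<noteq> x" "p (p (p x)) \<noteq> p x" using assms(3) x pin by simp_all
    ultimately have "card {x, p x, p (p x), p (p (p x))} = 4" by auto
    moreover have "{x, p x, p (p x), p (p (p x))} \<subseteq> {y \<in> S. orbit p y = orbit p x}"
      using x pin orbit_step_eq[OF assms(2,1)] by auto
    moreover have "finite {y \<in> S. orbit p y = orbit p x}" using assms(1) by simp
    ultimately show ?thesis using card_mono by metis
  qed
  have "card S = (\<Sum>K\<in>orbit p ` S. card {y \<in> S. orbit p y = K})"
    using sum.image_gen[OF assms(1), of "\<lambda>_. 1 :: nat" "orbit p"] by simp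
  also have "\<dots> \<ge> (\<Sum>K\<in>orbit p ` S. 4)"
    by (rule sum_mono) (use four in auto)
  finally show ?thesis using gen_classes_gr[OF assms(2,1)] by simp
qed

section \<open>Counting on the graph of a map, and the existence of a reduction\<close>

lemma double_card_edges:
  assumes fin: "finite N" and q: "\<And>x. x \<in> N \<Longrightarrow> q x \<in> N \<and> q x \<noteq> x"
    and \<psi>: "\<And>x y. x \<in> N \<Longrightarrow> y \<in> N \<Longrightarrow> \<psi> x = \<psi> y \<longleftrightarrow> y = x \<or> y = q x"
  shows "card N = 2 * card (\<psi> ` N)"
proof -
  have "card {y \<in> N. \<psi> y = e} = 2" if e: "e \<in> \<psi> ` N" for e
  proof -
    obtain x where x: "x \<in> N" "e = \<psi> x" using e by auto
    have "\<psi> y = e \<longleftrightarrow> y = x \<or> y = q x" if "y \<in> N" for y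
      unfolding x(2) using \<psi>[OF x(1) that] by (metis (full_types))
    then have "{y \<in> N. \<psi> y = e} = {x, q x}" using x q by auto
    then show ?thesis using q[OF x(1)] by (auto simp: card_insert_if)
  qed
  then show ?thesis
    using sum.image_gen[OF fin, of "\<lambda>_. 1 :: nat" \<psi>] by simp
qed

lemma cyc_labels:
  assumes "labels_cycles N p \<phi>"
  shows "cyc N p = card (\<phi> ` N)"
proof -
  have "cyc N p = ncl (\<phi> ` N) {}"
  proof (rule ncl_equiv[where f = \<phi> and g = "inv_into N \<phi>"])
    show "(\<phi> a, \<phi> b) \<in> gen_eq (\<phi> ` N) {}" if "(a, b) \<in> gr p" "a \<in> N" "b \<in> N" for a b
    proof -
      have "(a, b) \<in> gen_eq N (gr p)" using that by (auto intro: gen_eq_base)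
      then have "\<phi> a = \<phi> b" using assms that(2,3) by (simp add: labels_cycles_def)
      then show ?thesis by simp
    qed
    show "(inv_into N \<phi> (\<phi> x), x) \<in> gen_eq N (gr p)" if "x \<in> N" for x
    proof -
      have "inv_into N \<phi> (\<phi> x) \<in> N" "\<phi> (inv_into N \<phi> (\<phi> x)) = \<phi> x"
        using that by (simp_all add: inv_into_into f_inv_into_f)
      then show ?thesis using assms that unfolding labels_cycles_def by blast
    qed
  qed (auto simp: inv_into_into f_inv_into_f)
  also have "\<dots> = card (\<phi> ` N)" by (rule ncl_discrete) simp
  finally show ?thesis .
qed

context represented_map
begin

lemma card_darts: "card N = 2 * card (edges G)"
  unfolding edges_eq using double_card_edges[OF fin, of \<tau> \<psi>] opp_fpf edge_eq by simp

lemma cyc_opp: "cyc N \<tau> = card (edges G)"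
  unfolding edges_eq
proof (rule cyc_labels)
  show "labels_cycles N \<tau> \<psi>"
    unfolding labels_cycles_def
  proof (intro ballI)
    fix x y assume xy: "x \<in> N" "y \<in> N"
    show "(\<psi> x = \<psi> y) = ((x, y) \<in> gen_eq N (gr \<tau>))"
    proof
      assume "\<psi> x = \<psi> y"
      then show "(x, y) \<in> gen_eq N (gr \<tau>)"
        using edge_eq[OF xy] gen_eq_gr[OF opp xy(1) order_refl] by auto
    next
      assume "(x, y) \<in> gen_eq N (gr \<tau>)"
      then show "\<psi> x = \<psi> y" by (rule gen_eq_invariant) (use edge_opp in auto)
    qed
  qed
qed

text \<open>The map sees the components that contain an edge; every vertex without darts adds one
  more.\<close>

lemma num_components_eq: "num_components G = comps N \<sigma> \<tau> + card (verts G - \<phi> ` N)"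
proof -
  let ?V = "verts G" and ?J = "joined_by G (edges G)"
  have J: "u \<in> \<phi> ` N \<and> v \<in> \<phi> ` N" if uv: "(u, v) \<in> ?J" for u v
  proof -
    obtain x where x: "x \<in> N" "u \<in> ends G (\<psi> x)" "v \<in> ends G (\<psi> x)"
      using uv edges_eq by (auto simp: joined_by_def)
    then show ?thesis using ends_eq[OF x(1)] opp_in by auto
  qed
  have "num_components G = ncl (?V \<inter> \<phi> ` N) ?J + ncl (?V - \<phi> ` N) ?J"
    unfolding num_components_def by (rule ncl_split[OF finite_verts]) (use J in blast)
  moreover have "ncl (?V - \<phi> ` N) ?J = card (?V - \<phi> ` N)"
    by (rule ncl_discrete) (use J in blast)
  moreover have "ncl (?V \<inter> \<phi> ` N) ?J = comps N \<sigma> \<tau>"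
  proof (rule ncl_equiv[where f = "inv_into N \<phi>" and g = \<phi>])
    have close: "(x, y) \<in> gen_eq N (gr \<sigma> \<union> gr \<tau>)" if "x \<in> N" "y \<in> N" "\<phi> x = \<phi> y" for x y
      using that label_eq[of x y] by (auto intro: gen_eq_base elim: gen_eq_mono)
    show "(inv_into N \<phi> u, inv_into N \<phi> v) \<in> gen_eq N (gr \<sigma> \<union> gr \<tau>)"
      if uv: "(u, v) \<in> ?J" "u \<in> ?V \<inter> \<phi> ` N" "v \<in> ?V \<inter> \<phi> ` N" for u v
    proof -
      obtain x where x: "x \<in> N" "u \<in> ends G (\<psi> x)" "v \<in> ends G (\<psi> x)"
        using uv(1) edges_eq by (auto simp: joined_by_def)
      have xx: "(\<tau> x, x) \<in> gen_eq N (gr \<sigma> \<union> gr \<tau>)" using x by (auto intro: gen_eq_base)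
      have "(inv_into N \<phi> w, x) \<in> gen_eq N (gr \<sigma> \<union> gr \<tau>)" if "w \<in> ends G (\<psi> x)" for w
      proof -
        consider "w = \<phi> x" | "w = \<phi> (\<tau> x)" using \<open>w \<in> ends G (\<psi> x)\<close> ends_eq[OF x(1)] by auto
        then show ?thesis
        proof cases
          case 1
          then show ?thesis using close[of "inv_into N \<phi> w" x] x(1) by (simp add: inv_into_into f_inv_into_f)
        next
          case 2
          then have "(inv_into N \<phi> w, \<tau> x) \<in> gen_eq N (gr \<sigma> \<union> gr \<tau>)"
            using close[of "inv_into N \<phi> w" "\<tau> x"] x(1) by (simp add: inv_into_into f_inv_into_f)
          then show ?thesis using xx by (rule gen_eq_trans)
        qed
      qed
      from gen_eq_trans[OF this[OF x(2)] gen_eq_sym[OF this[OF x(3)]]] show ?thesis .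
    qed
    show "(\<phi> a, \<phi> b) \<in> gen_eq (?V \<inter> \<phi> ` N) ?J" if ab: "(a, b) \<in> gr \<sigma> \<union> gr \<tau>" "a \<in> N" "b \<in> N" for a b
    proof (cases "b = \<sigma> a")
      case True
      then show ?thesis using label_rot ab by simp
    next
      case False
      then have "(\<phi> a, \<phi> b) \<in> ?J" using ab ends_eq[of a] edges_eq by (auto simp: joined_by_def)
      then show ?thesis using label_verts ab by (intro gen_eq_base) auto
    qed
    show "(\<phi> (inv_into N \<phi> v), v) \<in> gen_eq (?V \<inter> \<phi> ` N) ?J" if "v \<in> ?V \<inter> \<phi> ` N" for v
      using that by (simp add: f_inv_into_f)
    show "(inv_into N \<phi> (\<phi> x), x) \<in> gen_eq N (gr \<sigma> \<union> gr \<tau>)" if "x \<in> N" for x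
      using that by (intro close) (auto simp: inv_into_into f_inv_into_f)
  qed (use label_verts in \<open>auto simp: inv_into_into\<close>)
  ultimately show ?thesis by simp
qed

text \<open>Euler's formula eliminates the faces. The left-hand side is twice the Turaev genus of a
  diagram that contracts to the map; the right-hand side depends only on the graph and its curve
  count.\<close>

lemma faces_minus_petrie:
  "int (cyc N (\<sigma> \<circ> \<tau>)) - int (petrie N \<sigma> \<tau>) = 2 * int (num_components G) - int (card (verts G)) +
    int (card (edges G)) - int (petrie N \<sigma> \<tau> + card (verts G - \<phi> ` N))"
proof -
  have "card (verts G) = card (\<phi> ` N) + card (verts G - \<phi> ` N)"
    using card_Diff_subset[OF _ label_verts] card_mono[OF finite_verts label_verts] fin by simp
  then show ?thesis
    using planar card_darts cyc_opp cyc_labels[OF labels] num_components_eq by (simp add: defect_def)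
qed

text \<open>If no vertex and no face had length two, all would have length at least four. Vertices
  and faces together would then number at most half the darts, that is, at most the edges, against
  Euler's formula.\<close>

lemma small_cycle:
  assumes "N \<noteq> {}"
  shows "\<exists>x\<in>N. \<sigma> (\<sigma> x) = x \<or> \<sigma> (\<tau> (\<sigma> (\<tau> x))) = x"
proof (rule ccontr)
  assume n: "\<not> ?thesis"
  have f: "\<sigma> \<circ> \<tau> permutes N" by (rule permutes_compose[OF opp rot])
  have "4 * cyc N \<sigma> \<le> card N"
    by (rule four_cyc_le_card[OF fin rot, of s]) (use n sign_rot in auto)
  moreover have "4 * cyc N (\<sigma> \<circ> \<tau>) \<le> card N"
    by (rule four_cyc_le_card[OF fin f, of s]) (use n sign_rot sign_opp in auto)
  moreover have "comps N \<sigma> \<tau> > 0"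
    using assms finite_gen_classes[OF fin] by (simp add: card_gt_0_iff gen_classes_eq)
  ultimately show False
    using planar card_darts cyc_opp by (simp add: defect_def)
qed

text \<open>A face of length two is bounded by two parallel edges. The two edges at a vertex of
  degree two are either parallel or have different ends.\<close>

lemma reducible:
  assumes "edges G \<noteq> {}"
  shows "(\<exists>e1 e2. parallel_edges G e1 e2) \<or>
    (\<exists>v e1 e2. v \<in> verts G \<and> degree G v = 2 \<and> e1 \<in> edges G \<and> e2 \<in> edges G \<and> e1 \<noteq> e2 \<and>
      v \<in> ends G e1 \<and> v \<in> ends G e2 \<and> ends G e1 \<noteq> ends G e2)"
proof -
  have "N \<noteq> {}" using assms edges_eq by auto
  then obtain x where x: "x \<in> N" "\<sigma> (\<sigma> x) = x \<or> \<sigma> (\<tau> (\<sigma> (\<tau> x))) = x" using small_cycle by blast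
  have \<tau>x: "\<tau> x \<in> N" using x by simp
  show ?thesis
  proof (cases "\<sigma> (\<sigma> x) = x")
    case True
    let ?y = "\<sigma> x"
    have y: "?y \<in> N" "?y \<noteq> x" "?y \<noteq> \<tau> x" using x sign_rot[OF x(1)] sign_opp[OF x(1)] by auto
    have e: "\<psi> x \<noteq> \<psi> ?y" using edge_eq[OF x(1) y(1)] y by simp
    have orb: "z = x \<or> z = ?y" if z: "z \<in> N" "\<phi> z = \<phi> x" for z
    proof -
      have "z \<in> orbit \<sigma> x" using label_eq[OF x(1) z(1)] z(2) gen_eq_gr_orbit[OF rot fin x(1)] by metis
      then show ?thesis by induction (use True in auto)
    qed
    have inc: "{e \<in> edges G. \<phi> x \<in> ends G e} = {\<psi> x, \<psi> ?y}"
    proof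
      show "{\<psi> x, \<psi> ?y} \<subseteq> {e \<in> edges G. \<phi> x \<in> ends G e}"
        using x(1) y(1) ends_eq edges_eq label_rot by auto
      show "{e \<in> edges G. \<phi> x \<in> ends G e} \<subseteq> {\<psi> x, \<psi> ?y}"
      proof
        fix e assume "e \<in> {e \<in> edges G. \<phi> x \<in> ends G e}"
        then obtain z where "z \<in> N" "\<psi> z = e" "\<phi> z = \<phi> x" using dart_of_edge by auto
        then show "e \<in> {\<psi> x, \<psi> ?y}" using orb by auto
      qed
    qed
    have "ends G e \<noteq> {\<phi> x}" if e: "e \<in> edges G" for e
    proof -
      obtain z where z: "z \<in> N" "e = \<psi> z" using e edges_eq by auto
      then have "\<phi> z \<in> ends G e" "\<phi> (\<tau> z) \<in> ends G e" "\<phi> z \<noteq> \<phi> (\<tau> z)"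
        using ends_eq label_loop by simp_all
      then show ?thesis by (metis singletonD)
    qed
    then have no: "{e \<in> edges G. ends G e = {\<phi> x}} = {}" by blast
    have "degree G (\<phi> x) = 2" unfolding degree_def inc no using e by simp
    moreover have "\<phi> x \<in> ends G (\<psi> x)" "\<phi> x \<in> ends G (\<psi> ?y)" "\<psi> x \<in> edges G" "\<psi> ?y \<in> edges G" "\<phi> x \<in> verts G"
      using x(1) y(1) ends_eq edges_eq label_rot label_verts by auto
    ultimately show ?thesis
      using e unfolding parallel_edges_def by blast
  next
    case False
    let ?y = "\<sigma> (\<tau> x)"
    have y: "?y \<in> N" "?y \<noteq> x" "?y \<noteq> \<tau> x" using \<tau>x sign_rot[OF \<tau>x] sign_opp[OF x(1)] by auto
    have e: "\<psi> x \<noteq> \<psi> ?y" using edge_eq[OF x(1) y(1)] y by simp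
    have "\<phi> ?y = \<phi> (\<tau> x)" using label_rot[OF \<tau>x] .
    moreover have "\<phi> (\<tau> ?y) = \<phi> x" using label_rot[of "\<tau> ?y"] x False y(1) by simp
    ultimately have "ends G (\<psi> x) = ends G (\<psi> ?y)"
      using ends_eq[OF x(1)] ends_eq[OF y(1)] by (simp add: insert_commute)
    then have "parallel_edges G (\<psi> x) (\<psi> ?y)"
      using e x(1) y(1) edges_eq by (simp add: parallel_edges_def)
    then show ?thesis by blast
  qed
qed

end

section \<open>Independence of the count from the plane map\<close>

lemma curve_countE:
  assumes "curve_count G n"
  obtains N p q s \<phi> \<psi> where "represented_map N p q s \<phi> \<psi> G" "n = petrie N p q + card (verts G - \<phi> ` N)"
  using assms unfolding curve_count_def represented_map_def represented_map_axioms_def by blast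

text \<open>The reduction is found in the first map, but it is described by edges of
  \<open>G\<close> alone and so can be carried out in the second map as well. The resulting graphs
  coincide and have fewer edges.\<close>

lemma curve_count_unique:
  assumes "curve_count G m" "curve_count G n"
  shows "m = n"
  using assms
proof (induction "card (edges G)" arbitrary: G m n rule: less_induct)
  case less
  obtain N p q s \<phi> \<psi> where R: "represented_map N p q s \<phi> \<psi> G" and m: "m = petrie N p q + card (verts G - \<phi> ` N)"
    using less.prems(1) by (rule curve_countE)
  obtain N' p' q' s' \<phi>' \<psi>' where R': "represented_map N' p' q' s' \<phi>' \<psi>' G"
    and n: "n = petrie N' p' q' + card (verts G - \<phi>' ` N')"
    using less.prems(2) by (rule curve_countE)
  interpret A: represented_map N p q s \<phi> \<psi> G by fact
  interpret B: represented_map N' p' q' s' \<phi>' \<psi>' G by fact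
  have fe: "finite (edges G)" using A.edges_eq A.fin by simp
  show ?case
  proof (cases "edges G = {}")
    case True
    then have "N = {}" "N' = {}" using A.edges_eq B.edges_eq by auto
    then show ?thesis unfolding m n by (simp add: gen_classes_eq)
  next
    case False
    from A.reducible[OF False] consider (par) e1 e2 where "parallel_edges G e1 e2"
      | (two) v e1 e2 where "v \<in> verts G" "degree G v = 2" "e1 \<in> edges G" "e2 \<in> edges G" "e1 \<noteq> e2"
        "v \<in> ends G e1" "v \<in> ends G e2" "ends G e1 \<noteq> ends G e2"
      by blast
    then show ?thesis
    proof cases
      case par
      have "card (edges G - {e1, e2}) < card (edges G)"
        using par fe by (intro psubset_card_mono) (auto simp: parallel_edges_def)
      then show ?thesis
        using less.hyps[of "delete_edges G {e1, e2}"] A.curve_count_delete[OF par] B.curve_count_delete[OF par]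
        unfolding m n by (simp add: delete_edges_def)
    next
      case two
      \<comment> \<open>The identified vertices are sent to \<open>v\<close> itself, so the quotient
        has the vertex type of \<open>G\<close> and the induction hypothesis applies to it.\<close>
      define f where "f w = (if w \<in> ends G e1 \<union> ends G e2 then v else w)" for w
      define H where "H = \<lparr>verts = f ` verts G, edges = edges G - {e1, e2}, ends = (\<lambda>e. f ` ends G e)\<rparr>"
      have H: "quotient_by f {e1, e2} G H" by (simp add: quotient_by_def H_def)
      have f: "f x = f y \<longleftrightarrow> x = y \<or> x \<in> ends G e1 \<union> ends G e2 \<and> y \<in> ends G e1 \<union> ends G e2" for x y
        using two by (auto simp: f_def)
      have "card (edges H) < card (edges G)"
        unfolding H_def mgraph.simps using two(3) fe by (intro psubset_card_mono) auto
      then show ?thesis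
        using less.hyps[of H] A.curve_count_degree_two[OF two(2-8) H f] B.curve_count_degree_two[OF two(2-8) H f]
        unfolding m n by blast
    qed
  qed
qed

lemma cornersE:
  assumes "(z, w) \<in> corners p"
  obtains x where "z = (x, True)" "w = (p x, False)"
  using assms by (auto simp: corners_def)

lemma linksE:
  assumes "(z, w) \<in> links A q"
  obtains x b where "z = (x, b)" "w = (q x, b)" "x \<in> A"
  using assms by (auto simp: links_def)

text \<open>A map and its dual have the same Petrie walks: moving each \<open>True\<close> side from
  \<open>x\<close> to \<open>q x\<close> turns corners of \<open>p\<close> into corners of
  \<open>p \<circ> q\<close> and respects links.\<close>

lemma petrie_dual:
  assumes p: "p permutes N" and q: "q permutes N" "q \<circ> q = id"
  shows "ncl (sides N) (corners p \<union> links UNIV q) = petrie N (p \<circ> q) q"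
proof -
  have qq: "q (q x) = x" for x using q(2) by (metis comp_apply id_apply)
  have qin: "q x \<in> N \<longleftrightarrow> x \<in> N" for x using q(1) by (rule permutes_in_image)
  let ?f = "\<lambda>z. if snd z then (q (fst z), True) else z"
  have fN: "?f z \<in> sides N" if "z \<in> sides N" for z using that qin by (cases z) simp
  then show ?thesis
  proof (rule ncl_equiv[where f = ?f and g = ?f])
    show "(?f z, ?f w) \<in> gen_eq (sides N) (corners (p \<circ> q) \<union> links UNIV q)"
      if zw: "(z, w) \<in> corners p \<union> links UNIV q" "z \<in> sides N" "w \<in> sides N" for z w
    proof (rule gen_eq_base)
      from zw(1) show "(?f z, ?f w) \<in> corners (p \<circ> q) \<union> links UNIV q"
        by (auto elim!: cornersE linksE simp: qq)
    qed (use zw(2,3) fN in blast)+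
    show "(?f z, ?f w) \<in> gen_eq (sides N) (corners p \<union> links UNIV q)"
      if zw: "(z, w) \<in> corners (p \<circ> q) \<union> links UNIV q" "z \<in> sides N" "w \<in> sides N" for z w
    proof (rule gen_eq_base)
      from zw(1) show "(?f z, ?f w) \<in> corners p \<union> links UNIV q"
        by (auto elim!: cornersE linksE simp: qq)
    qed (use zw(2,3) fN in blast)+
    show "?f z \<in> sides N" if "z \<in> sides N" for z using fN[OF that] .
    have ff: "?f (?f z) = z" for z using qq by (cases z) simp
    show "(?f (?f z), z) \<in> gen_eq (sides N) R" for z R unfolding ff by simp
    then show "(?f (?f z), z) \<in> gen_eq (sides N) R" for z R .
  qed
qed

text \<open>This and its converse translate between inductive first returns and the explicit number
  of steps in the definition of \<open>arcs\<close>.\<close>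

lemma first_return_funpow:
  assumes "first_return p A x y"
  shows "\<exists>n>0. y = (p ^^ n) x \<and> (\<forall>m. 0 < m \<and> m < n \<longrightarrow> (p ^^ m) x \<notin> A)"
  using assms
proof (induction rule: first_return.induct)
  case (hit x)
  show ?case by (rule exI[of _ 1]) auto
next
  case (skip x y)
  then obtain n where n: "n > 0" "y = (p ^^ n) (p x)" "\<forall>m. 0 < m \<and> m < n \<longrightarrow> (p ^^ m) (p x) \<notin> A" by blast
  have "(p ^^ m) x \<notin> A" if "0 < m" "m < Suc n" for m
    using that n(3) skip.hyps(1) by (cases m; cases "m = 1") (auto simp: funpow_swap1)
  then show ?case using n(2) by (intro exI[of _ "Suc n"]) (auto simp: funpow_swap1)
qed

lemma funpow_first_return:
  assumes "n > 0" "(p ^^ n) x \<in> A" "\<And>m. 0 < m \<Longrightarrow> m < n \<Longrightarrow> (p ^^ m) x \<notin> A"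
  shows "first_return p A x ((p ^^ n) x)"
  using assms
proof (induction n arbitrary: x)
  case (Suc n)
  show ?case
  proof (cases "n = 0")
    case True
    then show ?thesis using Suc.prems first_return.hit[of p x A] by simp
  next
    case False
    have "p x \<notin> A" using Suc.prems(3)[of 1] False by simp
    moreover have "first_return p A (p x) ((p ^^ n) (p x))"
    proof (rule Suc.IH)
      show "(p ^^ m) (p x) \<notin> A" if "0 < m" "m < n" for m
        using Suc.prems(3)[of "Suc m"] that by (simp add: funpow_swap1)
    qed (use False Suc.prems in \<open>auto simp: funpow_swap1\<close>)
    ultimately show ?thesis using first_return.skip[of p x A] by (simp add: funpow_swap1)
  qed
qed simp

section \<open>From link diagrams to signed maps\<close>

text \<open>Separated from the notion of a diagram so that cells can be counted by cycles of
  permutations before a newly built record is known to be a link diagram; its Euler equation is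
  proved from these counts.\<close>

locale dart_structure =
  fixes D :: "'d diagram"
  assumes fin: "finite (darts D)" and rot: "rot D permutes darts D" and opp: "opp D permutes darts D"
    and opp_fpf: "x \<in> darts D \<Longrightarrow> opp D x \<noteq> x" and opp_opp': "x \<in> darts D \<Longrightarrow> opp D (opp D x) = x"
begin

abbreviation "S \<equiv> darts D"
abbreviation "\<sigma> \<equiv> rot D"
abbreviation "\<tau> \<equiv> opp D"

lemma rot_in [simp]: "\<sigma> x \<in> S \<longleftrightarrow> x \<in> S"
  using rot by (rule permutes_in_image)

lemma opp_in [simp]: "\<tau> x \<in> S \<longleftrightarrow> x \<in> S"
  using opp by (rule permutes_in_image)

lemma opp_opp [simp]: "\<tau> (\<tau> x) = x"
  using opp_opp' opp by (cases "x \<in> S") (auto simp: permutes_not_in)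

lemma opp_comp: "\<tau> \<circ> \<tau> = id"
  by auto

lemma face_eq: "face_next D = \<sigma> \<circ> \<tau>"
  by (auto simp: face_next_def)

lemma face_permutes: "\<sigma> \<circ> \<tau> permutes S"
  by (rule permutes_compose[OF opp rot])

lemma card_crossings: "card (crossings D) = cyc S \<sigma>"
  using gen_classes_gr[OF rot fin] by (simp add: crossings_def)

lemma card_faces: "card (faces D) = cyc S (\<sigma> \<circ> \<tau>)"
  using gen_classes_gr[OF face_permutes fin] by (simp add: faces_def face_eq)

lemma edge_set_eq: "{x, \<tau> x} = {y, \<tau> y} \<longleftrightarrow> y = x \<or> y = \<tau> x"
  by (auto simp: doubleton_eq_iff)

lemma card_dart_edges: "card (dart_edges D) = cyc S \<tau>" "card S = 2 * card (dart_edges D)"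
proof -
  have "labels_cycles S \<tau> (\<lambda>d. {d, \<tau> d})"
    unfolding labels_cycles_def
  proof (intro ballI iffI)
    fix x y assume xy: "x \<in> S" "y \<in> S"
    show "(x, y) \<in> gen_eq S (gr \<tau>)" if "{x, \<tau> x} = {y, \<tau> y}"
      using that gen_eq_gr[OF opp xy(1) order_refl] unfolding edge_set_eq by auto
    show "{x, \<tau> x} = {y, \<tau> y}" if "(x, y) \<in> gen_eq S (gr \<tau>)"
      using that by (rule gen_eq_invariant) auto
  qed
  then show "card (dart_edges D) = cyc S \<tau>"
    unfolding dart_edges_def using cyc_labels by metis
  show "card S = 2 * card (dart_edges D)"
    unfolding dart_edges_def
    by (rule double_card_edges[OF fin, of \<tau>]) (use opp_fpf edge_set_eq in auto)
qed

lemma dart_components_eq: "dart_components D = gen_classes S (gr \<sigma> \<union> gr \<tau>)"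
proof -
  have "gen_eq S (edge_rel D \<union> {(d, \<sigma> d) | d. d \<in> S}) = gen_eq S (gr \<sigma> \<union> gr \<tau>)"
    by (rule gen_eq_cong; rule gen_eq_base) (auto simp: edge_rel_def)
  then show ?thesis by (simp add: dart_components_def gen_classes_eq)
qed

end

locale diagram =
  fixes D :: "'d diagram"
  assumes diagram: "link_diagram D"
begin

sublocale dart_structure D
  using diagram by unfold_locales (auto simp: link_diagram_def)

abbreviation "NA \<equiv> nonalt D"

definition sgn_over :: "'d \<Rightarrow> bool" where
  "sgn_over x \<longleftrightarrow> x \<in> over D"

lemma sign_rot: "x \<in> S \<Longrightarrow> sgn_over (\<sigma> x) \<longleftrightarrow> \<not> sgn_over x"
  and four_valent: "x \<in> S \<Longrightarrow> card (orbit \<sigma> x) = 4"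
  and euler: "int (card (crossings D)) - int (card (dart_edges D)) + int (card (faces D)) = 2 * int (card (dart_components D))"
  using diagram unfolding link_diagram_def sgn_over_def by auto

lemma NA_iff: "x \<in> NA \<longleftrightarrow> x \<in> S \<and> (sgn_over (\<tau> x) \<longleftrightarrow> sgn_over x)"
  by (auto simp: nonalt_def sgn_over_def)

lemma NA_opp [simp]: "\<tau> x \<in> NA \<longleftrightarrow> x \<in> NA"
  by (auto simp: NA_iff)

lemma card_four_crossings: "card S = 4 * card (crossings D)"
proof -
  have "card {y \<in> S. orbit \<sigma> y = K} = 4" if K: "K \<in> orbit \<sigma> ` S" for K
  proof -
    obtain x where x: "x \<in> S" "K = orbit \<sigma> x" using K by auto
    have "orbit \<sigma> y = K \<longleftrightarrow> y \<in> K" if "y \<in> S" for y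
    proof
      show "orbit \<sigma> y = K \<Longrightarrow> y \<in> K" using self_in_orbit[OF rot fin, of y] by simp
      assume "y \<in> K"
      then have "(x, y) \<in> gen_eq S (gr \<sigma>)" using gen_eq_gr_orbit[OF rot fin x(1)] x(2) by simp
      then have "orbit \<sigma> x = orbit \<sigma> y"
        by (rule gen_eq_invariant) (use orbit_step_eq[OF rot fin] in auto)
      then show "orbit \<sigma> y = K" using x(2) by simp
    qed
    moreover have "K \<subseteq> S" unfolding x(2) by (rule permutes_orbit_subset[OF rot x(1)])
    ultimately have "{y \<in> S. orbit \<sigma> y = K} = K" by auto
    then show ?thesis using four_valent x by simp
  qed
  then show ?thesis
    using sum.image_gen[OF fin, of "\<lambda>_. 1 :: nat" "orbit \<sigma>"] by (simp add: crossings_def)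
qed

lemma planar: "defect S \<sigma> \<tau> = 0"
  using euler card_dart_edges card_crossings card_faces by (simp add: defect_def dart_components_eq)

text \<open>With four darts at each crossing there are twice as many edges as crossings, so Euler's
  formula gives the number of faces as twice the components plus the crossings. Crossingless circles
  cancel, each adding two to twice the components and one to either state.\<close>

lemma genus_eq: "2 * diagram_turaev_genus D =
    of_int (int (cyc S (\<sigma> \<circ> \<tau>)) - int (card (states_A D)) - int (card (states_B D)))"
proof -
  have "int (cyc S (\<sigma> \<circ> \<tau>)) = 2 * int (card (dart_components D)) + int (card (crossings D))"
    using euler card_dart_edges(2) card_four_crossings card_faces by simp
  then have "of_int (int (cyc S (\<sigma> \<circ> \<tau>))) = 2 * rat_of_nat (card (dart_components D)) + rat_of_nat (card (crossings D))"
    by simp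
  then show ?thesis by (simp add: diagram_turaev_genus_def Let_def field_simps)
qed

text \<open>
  The curves of both states, in terms of faces: here \<open>(x, False)\<close> and \<open>(x, True)\<close> are the two ends of
  the side of the edge \<open>x\<close> along the face of \<open>x\<close>.
\<close>

definition state_rel :: "(('d \<times> bool) \<times> ('d \<times> bool)) set" where
  "state_rel = corners (\<sigma> \<circ> \<tau>) \<union> (through (S - NA) \<union> links NA \<tau>)"

text \<open>A curve of a given state runs along one side of every dart. If the darts without sign
  \<open>s\<close> are joined to their successors, it is the side \<open>(\<tau> d, True)\<close>
  for these and \<open>(d, False)\<close> for the others. Reversing \<open>s\<close> gives the
  complementary sides, those of the other state.\<close>

definition type_sides :: "('d \<Rightarrow> bool) \<Rightarrow> ('d \<times> bool) set" where
  "type_sides s = {(x, b). if b then \<not> s (\<tau> x) else s x}"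

text \<open>Stated for an arbitrary sign, which makes both states instances. Along an alternating
  edge a state curve stays on the side it is on, which gives \<open>through\<close>; along a
  non-alternating one it changes sides, which gives \<open>links\<close>.\<close>

lemma card_state:
  assumes rot_s: "\<And>x. x \<in> S \<Longrightarrow> s (\<sigma> x) \<longleftrightarrow> \<not> s x" and NA: "\<And>x. x \<in> S \<Longrightarrow> x \<in> NA \<longleftrightarrow> (s (\<tau> x) \<longleftrightarrow> s x)"
  shows "ncl S (edge_rel D \<union> {(d, \<sigma> d) | d. d \<in> S \<and> \<not> s d}) = ncl (sides S \<inter> type_sides s) state_rel"
proof (rule ncl_equiv[where f = "\<lambda>x. if s x then (x, False) else (\<tau> x, True)" and g = "\<lambda>(x, b). if b then \<tau> x else x"])
  let ?f = "\<lambda>x. if s x then (x, False) else (\<tau> x, True)" and ?T = "sides S \<inter> type_sides s"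
  let ?g = "\<lambda>(x, b). if b then \<tau> x else x"
  let ?R = "edge_rel D \<union> {(d, \<sigma> d) | d. d \<in> S \<and> \<not> s d}"
  show fin: "?f x \<in> ?T" if "x \<in> S" for x using that by (auto simp: type_sides_def)
  show "?g z \<in> S" if "z \<in> ?T" for z using that by auto
  have base: "(z, w) \<in> gen_eq ?T state_rel" if "(z, w) \<in> state_rel" "z \<in> ?T" "w \<in> ?T" for z w
    using that by (rule gen_eq_base)
  show "(?f a, ?f b) \<in> gen_eq ?T state_rel" if ab: "(a, b) \<in> ?R" "a \<in> S" "b \<in> S" for a b
  proof (cases "(a, b) \<in> edge_rel D")
    case True
    then have b: "b = \<tau> a" by (auto simp: edge_rel_def)
    show ?thesis
    proof (cases "s a = s (\<tau> a)")
      case True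
      then have aNA: "a \<in> NA" using NA[OF ab(2)] by blast
      have sb: "s b = s a" using True unfolding b by (rule sym)
      have "(?f a, ?f b) \<in> state_rel"
      proof (cases "s a")
        case True
        then have "?f a = (a, False)" "?f b = (b, False)" using sb by simp_all
        then have "?f a = (a, False)" "?f b = (\<tau> a, False)" using b by simp_all
        then show ?thesis using aNA by (simp only:) (simp add: state_rel_def)
      next
        case False
        then have "?f a = (\<tau> a, True)" "?f b = (\<tau> b, True)" using sb by simp_all
        then have "?f a = (\<tau> a, True)" "?f b = (\<tau> (\<tau> a), True)" using b by simp_all
        then show ?thesis using aNA by (simp only:) (simp add: state_rel_def)
      qed
      from base[OF this fin[OF ab(2)] fin[OF ab(3)]] show ?thesis .
    next
      case False
      then have "a \<notin> NA" using NA[OF ab(2)] by blast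
      then have aS: "a \<in> S - NA" "\<tau> a \<in> S - NA" using ab(2) by simp_all
      have "(?f a, ?f b) \<in> state_rel \<or> (?f b, ?f a) \<in> state_rel"
      proof (cases "s a")
        case True
        then have "?f a = (a, False)" "?f b = (a, True)" using False b by simp_all
        then show ?thesis using aS by (simp only:) (simp add: state_rel_def)
      next
        case sa: False
        then have "?f a = (\<tau> a, True)" "?f b = (\<tau> a, False)" using False b by simp_all
        then show ?thesis using aS by (simp only:) (simp add: state_rel_def)
      qed
      then show ?thesis
      proof
        assume "(?f a, ?f b) \<in> state_rel"
        from base[OF this fin[OF ab(2)] fin[OF ab(3)]] show ?thesis .
      next
        assume "(?f b, ?f a) \<in> state_rel"
        from gen_eq_sym[OF base[OF this fin[OF ab(3)] fin[OF ab(2)]]] show ?thesis .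
      qed
    qed
  next
    case False
    then have b: "b = \<sigma> a" "\<not> s a" using ab by auto
    then have "(?f a, ?f b) \<in> state_rel" using rot_s[OF ab(2)] by (simp add: state_rel_def)
    from base[OF this fin[OF ab(2)] fin[OF ab(3)]] show ?thesis .
  qed
  have base': "(x, y) \<in> gen_eq S ?R" if "(x, y) \<in> ?R" "x \<in> S" for x y
    using that by (intro gen_eq_base) (auto simp: edge_rel_def)
  show "(?g z, ?g w) \<in> gen_eq S ?R" if zw: "(z, w) \<in> state_rel" "z \<in> ?T" "w \<in> ?T" for z w
  proof -
    have e: "(x, \<tau> x) \<in> gen_eq S ?R" if "x \<in> S" for x
      using that by (intro base') (auto simp: edge_rel_def)
    from zw(1) consider x where "z = (x, True)" "w = (\<sigma> (\<tau> x), False)"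
      | x where "z = (x, True)" "w = (x, False)" | x b where "z = (x, b)" "w = (\<tau> x, b)"
      by (auto simp: state_rel_def corners_def through_def links_def)
    then show ?thesis
    proof cases
      case 1
      then have "x \<in> S" "\<not> s (\<tau> x)" using zw(2) by (auto simp: type_sides_def)
      then have "(\<tau> x, \<sigma> (\<tau> x)) \<in> gen_eq S ?R" by (intro base') auto
      then show ?thesis using 1 by simp
    next
      case 2
      then show ?thesis using e[of x] zw(2) gen_eq_sym by auto
    next
      case 3
      then show ?thesis using e[of x] e[of "\<tau> x"] zw(2) gen_eq_sym by auto
    qed
  qed
  show "(?g (?f x), x) \<in> gen_eq S ?R" for x by auto
  show "(?f (?g z), z) \<in> gen_eq ?T state_rel" if "z \<in> ?T" for z
    using that by (auto simp: type_sides_def split: if_splits)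
qed

lemma card_states: "card (states_A D) + card (states_B D) = ncl (sides S) state_rel"
proof -
  let ?A = "type_sides sgn_over"
  have "card (states_A D) = ncl (sides S \<inter> ?A) state_rel"
    using card_state[of sgn_over] sign_rot NA_iff by (simp add: states_A_def sgn_over_def Diff_iff)
  moreover have "{(d, \<sigma> d) | d. d \<in> over D} = {(d, \<sigma> d) | d. d \<in> S \<and> \<not> \<not> sgn_over d}"
    using diagram by (auto simp: link_diagram_def sgn_over_def)
  then have "card (states_B D) = ncl (sides S \<inter> type_sides (\<lambda>x. \<not> sgn_over x)) state_rel"
    using card_state[of "\<lambda>x. \<not> sgn_over x"] sign_rot NA_iff by (simp add: states_B_def)
  moreover have "sides S \<inter> type_sides (\<lambda>x. \<not> sgn_over x) = sides S - ?A"
    by (auto simp: type_sides_def)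
  moreover have "ncl (sides S) state_rel = ncl (sides S \<inter> ?A) state_rel + ncl (sides S - ?A) state_rel"
  proof (rule ncl_split)
    show "z \<in> ?A \<longleftrightarrow> w \<in> ?A" if "(z, w) \<in> state_rel" "z \<in> sides S" "w \<in> sides S" for z w
      using that(1) unfolding state_rel_def
    proof (elim UnE cornersE linksE)
      fix x assume "z = (x, True)" "w = ((\<sigma> \<circ> \<tau>) x, False)"
      then show ?thesis using that(2) sign_rot[of "\<tau> x"] by (simp add: type_sides_def)
    next
      assume "(z, w) \<in> through (S - NA)"
      then obtain x where "z = (x, True)" "w = (x, False)" "x \<in> S - NA" by (auto simp: through_def)
      then show ?thesis by (auto simp: type_sides_def NA_iff)
    next
      fix x b assume "z = (x, b)" "w = (\<tau> x, b)" "x \<in> NA"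
      then show ?thesis by (auto simp: type_sides_def NA_iff)
    qed
  qed (use fin in simp)
  ultimately show ?thesis by simp
qed

text \<open>Alternating edges are contracted by removing their darts from the face permutation. A
  face without non-alternating edges is itself a state curve and vanishes from both counts at once,
  so their difference is unaffected.\<close>

lemma signed_map_exists:
  "\<exists>\<sigma>'. signed_map NA \<sigma>' (fix_set (S - NA) \<tau>) sgn_over \<and>
    (\<forall>x\<in>NA. first_return (\<sigma> \<circ> \<tau>) NA (\<tau> x) (\<sigma>' x)) \<and>
    2 * diagram_turaev_genus D =
      of_int (int (cyc NA (\<sigma>' \<circ> fix_set (S - NA) \<tau>)) - int (petrie NA \<sigma>' (fix_set (S - NA) \<tau>)))"
proof -
  let ?A = "S - NA" and ?\<phi> = "\<sigma> \<circ> \<tau>"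
  let ?\<tau> = "fix_set ?A \<tau>"
  have NAS: "NA \<subseteq> S" and SA: "S - ?A = NA" by (auto simp: NA_iff)
  obtain ds where ds: "set ds = ?A" "distinct ds" using finite_distinct_list[of ?A] fin by auto
  have dsS: "set ds \<subseteq> S" using ds by auto
  have Acl: "\<tau> z \<in> ?A \<longleftrightarrow> z \<in> ?A" for z by auto
  have \<tau>': "?\<tau> permutes S" "?\<tau> permutes NA"
    using permutes_fix_set[OF opp opp_comp Acl] unfolding SA by auto
  have \<tau>'_eq: "?\<tau> x = \<tau> x" if "x \<in> NA" for x using that by (simp add: fix_set_def)
  have \<tau>\<tau>': "?\<tau> \<circ> ?\<tau> = id" using Acl by (auto simp: fix_set_def fun_eq_iff)
  have "defect S ?\<phi> \<tau> = 0" using defect_dual[OF rot opp opp_comp] planar by simp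
  then have pl: "defect S ?\<phi> ?\<tau> = 0"
    using planar_fix_set[OF face_permutes opp opp_comp fin _ Acl] by auto
  let ?\<psi> = "fold del ds ?\<phi>"
  have \<psi>: "?\<psi> permutes NA" "defect NA ?\<psi> ?\<tau> = 0"
    using planar_del_set[OF ds(2) dsS face_permutes \<tau>'(1) fin pl] unfolding ds(1) SA by (auto simp: fix_set_def)
  define p where "p = ?\<psi> \<circ> ?\<tau>"
  have p: "p permutes NA" unfolding p_def by (rule permutes_compose[OF \<tau>'(2) \<psi>(1)])
  have p\<tau>: "p \<circ> ?\<tau> = ?\<psi>" unfolding p_def using \<tau>\<tau>' by (simp add: comp_assoc)
  have ret: "first_return ?\<phi> NA (\<tau> x) (p x)" if "x \<in> NA" for x
    using first_return_del_set[OF ds(2) dsS face_permutes, of "\<tau> x"] that NAS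
    unfolding ds(1) SA by (auto simp: p_def \<tau>'_eq)
  have M: "signed_map NA p ?\<tau> sgn_over"
  proof
    show "finite NA" using fin NAS finite_subset by blast
    show "defect NA p ?\<tau> = 0"
      using defect_dual[OF \<psi>(1) \<tau>'(2) \<tau>\<tau>'] \<psi>(2) unfolding p_def by simp
    fix x assume x: "x \<in> NA"
    show "?\<tau> x \<noteq> x" "?\<tau> (?\<tau> x) = x" "sgn_over (?\<tau> x) \<longleftrightarrow> sgn_over x"
      using x opp_fpf by (auto simp: \<tau>'_eq NA_iff)
    \<comment> \<open>Along a face the sign of a dart is opposite to that of the end by which the
      preceding edge was left. The two ends of an alternating edge have opposite signs, so removing
      its darts preserves this rule.\<close>
    have "sgn_over (?\<psi> (\<tau> x)) \<longleftrightarrow> \<not> sgn_over (\<tau> (\<tau> x))"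
    proof (rule alternating_del_set[where A = S and v = "\<lambda>x. sgn_over (\<tau> x)"])
      show "sgn_over (?\<phi> z) \<longleftrightarrow> \<not> sgn_over (\<tau> z)" if "z \<in> S" for z
        using that sign_rot by simp
      show "d \<in> S" "sgn_over d \<longleftrightarrow> \<not> sgn_over (\<tau> d)" if "d \<in> set ds" for d
        using that unfolding ds(1) by (auto simp: NA_iff)
      show "\<tau> x \<in> S - set ds" unfolding ds(1) SA using x by simp
    qed
    then show "sgn_over (p x) \<longleftrightarrow> \<not> sgn_over x" using x by (simp add: p_def \<tau>'_eq)
  qed (fact p \<tau>'(2))+
  have L: "labels_cycles S ?\<phi> (orbit ?\<phi>)"
    unfolding labels_cycles_def
  proof (intro ballI iffI)
    fix x y assume xy: "x \<in> S" "y \<in> S"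
    show "(x, y) \<in> gen_eq S (gr ?\<phi>)" if "orbit ?\<phi> x = orbit ?\<phi> y"
      using that self_in_orbit[OF face_permutes fin, of y] gen_eq_gr_orbit[OF face_permutes fin xy(1)] by simp
    show "orbit ?\<phi> x = orbit ?\<phi> y" if "(x, y) \<in> gen_eq S (gr ?\<phi>)"
      using that by (rule gen_eq_invariant) (use orbit_step_eq[OF face_permutes fin] in \<open>simp only: gr_iff\<close>)
  qed
  let ?V = "orbit ?\<phi> ` S" and ?E = "links NA \<tau>"
  have unt: "untouched d ?E" if "d \<in> set ds" for d
    using that unfolding ds(1) by (auto simp: untouched_def)
  have W: "weight ?V (orbit ?\<phi>) S ?\<phi> (through ?A \<union> ?E) = weight ?V (orbit ?\<phi>) NA ?\<psi> ?E"
    and L': "labels_cycles NA ?\<psi> (orbit ?\<phi>)"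
    using weight_del_set[OF ds(2) dsS face_permutes fin L _ _ unt, of ?V] fin unfolding ds(1) SA by simp_all
  have V: "card ?V = card (orbit ?\<phi> ` NA) + card (?V - orbit ?\<phi> ` NA)"
    using card_Diff_subset[of "orbit ?\<phi> ` NA" ?V] card_mono[of ?V "orbit ?\<phi> ` NA"] image_mono[OF NAS, of "orbit ?\<phi>"] fin finite_subset[OF NAS fin] by auto
  \<comment> \<open>The number of faces bounded by alternating edges only.\<close>
  define r where "r = card (?V - orbit ?\<phi> ` NA)"
  have F: "cyc S ?\<phi> = cyc NA ?\<psi> + r"
    unfolding r_def using V cyc_labels[OF L] cyc_labels[OF L'] by simp
  have "ncl (sides S) state_rel = ncl (sides NA) (corners ?\<psi> \<union> ?E) + r"
    using W unfolding weight_def state_rel_def r_def Diff_cancel card.empty add_0_right .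
  also have "ncl (sides NA) (corners ?\<psi> \<union> ?E) = ncl (sides NA) (corners ?\<psi> \<union> links UNIV ?\<tau>)"
    by (rule ncl_cong; rule gen_eq_base) (auto simp: links_def \<tau>'_eq)
  also have "\<dots> = petrie NA p ?\<tau>"
    unfolding p_def by (rule petrie_dual[OF \<psi>(1) \<tau>'(2) \<tau>\<tau>'])
  finally have "2 * diagram_turaev_genus D = of_int (int (cyc NA (p \<circ> ?\<tau>)) - int (petrie NA p ?\<tau>))"
    using genus_eq card_states F unfolding p\<tau> by simp
  then show ?thesis using M ret by blast
qed

lemma arcs_eq:
  assumes M: "signed_map NA p q sgn_over" and ret: "\<And>x. x \<in> NA \<Longrightarrow> first_return (\<sigma> \<circ> \<tau>) NA (\<tau> x) (p x)"
  shows "arcs D = {(x, p x) | x. x \<in> NA}"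
proof
  interpret M: signed_map NA p q sgn_over by fact
  show "arcs D \<subseteq> {(x, p x) | x. x \<in> NA}"
  proof
    fix z assume "z \<in> arcs D"
    then obtain d e n where z: "z = (\<tau> d, e)" "d \<in> NA" "e \<in> NA" "n > 0" "e = ((\<sigma> \<circ> \<tau>) ^^ n) d"
      "\<forall>m. 0 < m \<and> m < n \<longrightarrow> ((\<sigma> \<circ> \<tau>) ^^ m) d \<notin> NA"
      unfolding arcs_def face_eq by blast
    then have "first_return (\<sigma> \<circ> \<tau>) NA d e" using funpow_first_return[of n "\<sigma> \<circ> \<tau>" d NA] by blast
    moreover have "first_return (\<sigma> \<circ> \<tau>) NA d (p (\<tau> d))" using ret[of "\<tau> d"] z(2) by simp
    ultimately have "e = p (\<tau> d)" by (rule first_return_unique)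
    then show "z \<in> {(x, p x) | x. x \<in> NA}" using z(1,2) NA_opp by blast
  qed
  show "{(x, p x) | x. x \<in> NA} \<subseteq> arcs D"
  proof
    fix z assume "z \<in> {(x, p x) | x. x \<in> NA}"
    then obtain x where x: "z = (x, p x)" "x \<in> NA" by auto
    obtain n where n: "n > 0" "p x = ((\<sigma> \<circ> \<tau>) ^^ n) (\<tau> x)"
      "\<forall>m. 0 < m \<and> m < n \<longrightarrow> ((\<sigma> \<circ> \<tau>) ^^ m) (\<tau> x) \<notin> NA"
      using first_return_funpow[OF ret[OF x(2)]] by blast
    have "sgn_over (\<tau> x) \<longleftrightarrow> sgn_over x" using x(2) by (simp add: NA_iff)
    \<comment> \<open>Both ends of a non-alternating edge have the same sign and \<open>p\<close>
      reverses it, so the exclusion of pairs on one edge in the definition of \<open>arcs\<close>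
      discards nothing.\<close>
    then have "p x \<notin> {\<tau> x, \<tau> (\<tau> x)}" using M.sign_rot[OF x(2)] by auto
    moreover have "p x \<in> NA" "\<tau> x \<in> NA" "z = (\<tau> (\<tau> x), p x)" using x by simp_all
    ultimately show "z \<in> arcs D"
      unfolding arcs_def face_eq using n by blast
  qed
qed

lemma represents_ad_graph:
  assumes M: "signed_map NA p q sgn_over" and ret: "\<And>x. x \<in> NA \<Longrightarrow> first_return (\<sigma> \<circ> \<tau>) NA (\<tau> x) (p x)"
    and q: "\<And>x. x \<in> NA \<Longrightarrow> q x = \<tau> x"
  shows "represents NA p q (\<lambda>x. Curve (gen_eq NA (gr p) `` {x})) (\<lambda>x. {x, \<tau> x}) (ad_graph D)"
    and "Curve ` curves D = (\<lambda>x. Curve (gen_eq NA (gr p) `` {x})) ` NA"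
proof -
  let ?\<phi> = "\<lambda>x. Curve (gen_eq NA (gr p) `` {x})"
  have "gen_eq NA (arcs D) = gen_eq NA (gr p)"
    using arcs_eq[OF M ret] by (intro gen_eq_cong; intro gen_eq_base) simp_all
  then have C: "curves D = (\<lambda>x. gen_eq NA (gr p) `` {x}) ` NA"
    by (simp add: curves_def gen_classes_eq)
  then show curves: "Curve ` curves D = ?\<phi> ` NA" by (simp add: image_image)
  have fNA: "finite NA" using fin by (simp add: NA_iff finite_subset[of NA S] subset_iff)
  show "represents NA p q ?\<phi> (\<lambda>x. {x, \<tau> x}) (ad_graph D)"
    unfolding represents_def
  proof (intro conjI ballI)
    show "finite (verts (ad_graph D))"
      using fNA fin finite_gen_classes[OF fin] by (simp add: ad_graph_def C dart_components_eq)
    show "?\<phi> ` NA \<subseteq> verts (ad_graph D)" using curves by (auto simp: ad_graph_def)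
    show "labels_cycles NA p ?\<phi>" by (simp add: labels_cycles_def gen_eq_class_eq_iff)
    show "edges (ad_graph D) = (\<lambda>x. {x, \<tau> x}) ` NA" by (simp add: ad_graph_def)
    fix x assume x: "x \<in> NA"
    show "({x, \<tau> x} = {y, \<tau> y}) = (y = x \<or> y = q x)" if "y \<in> NA" for y
      using edge_set_eq q[OF x] by simp
    have "{\<gamma> \<in> curves D. \<gamma> \<inter> {x, \<tau> x} \<noteq> {}} = {gen_eq NA (gr p) `` {x}, gen_eq NA (gr p) `` {\<tau> x}}"
    proof
      show "{gen_eq NA (gr p) `` {x}, gen_eq NA (gr p) `` {\<tau> x}} \<subseteq> {\<gamma> \<in> curves D. \<gamma> \<inter> {x, \<tau> x} \<noteq> {}}"
        unfolding C using x by auto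
      show "{\<gamma> \<in> curves D. \<gamma> \<inter> {x, \<tau> x} \<noteq> {}} \<subseteq> {gen_eq NA (gr p) `` {x}, gen_eq NA (gr p) `` {\<tau> x}}"
      proof
        fix \<gamma> assume "\<gamma> \<in> {\<gamma> \<in> curves D. \<gamma> \<inter> {x, \<tau> x} \<noteq> {}}"
        then obtain y where y: "\<gamma> = gen_eq NA (gr p) `` {y}" "(y, x) \<in> gen_eq NA (gr p) \<or> (y, \<tau> x) \<in> gen_eq NA (gr p)"
          unfolding C by auto
        then show "\<gamma> \<in> {gen_eq NA (gr p) `` {x}, gen_eq NA (gr p) `` {\<tau> x}}"
          using gen_eq_class_eq_iff[of NA "gr p" y] by blast
      qed
    qed
    then show "ends (ad_graph D) {x, \<tau> x} = {?\<phi> x, ?\<phi> (q x)}"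
      using q[OF x] by (simp add: ad_graph_def)
  qed
qed

end

section \<open>Graphs of a map up to isomorphism\<close>

lemma represents_iso:
  assumes R: "represents N p q \<phi> \<psi> G" and q: "\<And>x. x \<in> N \<Longrightarrow> q x \<in> N" and iso: "mgraph_iso G H"
  shows "\<exists>\<phi>' \<psi>'. represents N p q \<phi>' \<psi>' H \<and> card (verts H - \<phi>' ` N) = card (verts G - \<phi> ` N)"
proof -
  obtain f h where f: "bij_betw f (verts G) (verts H)" and h: "bij_betw h (edges G) (edges H)"
    and e: "\<forall>e\<in>edges G. ends G e \<subseteq> verts G \<and> ends H (h e) = f ` ends G e"
    using iso unfolding mgraph_iso_def by blast
  have r: "finite (verts G)" "\<phi> ` N \<subseteq> verts G" "labels_cycles N p \<phi>" "edges G = \<psi> ` N"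
    "\<forall>x\<in>N. \<forall>y\<in>N. \<psi> x = \<psi> y \<longleftrightarrow> y = x \<or> y = q x" "\<forall>x\<in>N. ends G (\<psi> x) = {\<phi> x, \<phi> (q x)}"
    using R unfolding represents_def by blast+
  have fi: "f (\<phi> x) = f (\<phi> y) \<longleftrightarrow> \<phi> x = \<phi> y" if "x \<in> N" "y \<in> N" for x y
    using inj_on_eq_iff[OF bij_betw_imp_inj_on[OF f] subsetD[OF r(2) imageI] subsetD[OF r(2) imageI]] that by blast
  have hi: "h (\<psi> x) = h (\<psi> y) \<longleftrightarrow> \<psi> x = \<psi> y" if "x \<in> N" "y \<in> N" for x y
    using h r(4) that by (auto simp: bij_betw_def inj_on_def)
  have "represents N p q (f \<circ> \<phi>) (h \<circ> \<psi>) H"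
    unfolding represents_def
  proof (intro conjI ballI)
    show "finite (verts H)" using f r(1) bij_betw_finite by blast
    show "(f \<circ> \<phi>) ` N \<subseteq> verts H" using f r(2) by (auto simp: bij_betw_def)
    show "labels_cycles N p (f \<circ> \<phi>)" using r(3) fi by (simp add: labels_cycles_def)
    show "edges H = (h \<circ> \<psi>) ` N" using h r(4) by (simp add: bij_betw_def image_comp)
    fix x assume x: "x \<in> N"
    show "((h \<circ> \<psi>) x = (h \<circ> \<psi>) y) = (y = x \<or> y = q x)" if "y \<in> N" for y
      using hi[OF x that] r(5) x that by simp
    show "ends H ((h \<circ> \<psi>) x) = {(f \<circ> \<phi>) x, (f \<circ> \<phi>) (q x)}"
      using e r(4,6) x by simp
  qed
  moreover have "verts H - (f \<circ> \<phi>) ` N = f ` (verts G - \<phi> ` N)"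
    using inj_on_image_set_diff[OF bij_betw_imp_inj_on[OF f] Diff_subset r(2)] bij_betw_imp_surj_on[OF f]
    by (simp add: image_comp)
  then have "card (verts H - (f \<circ> \<phi>) ` N) = card (verts G - \<phi> ` N)"
    using f by (metis Diff_subset bij_betw_def card_image inj_on_subset)
  ultimately show ?thesis by blast
qed

lemma represents_unique_iso:
  assumes G: "represents N p q \<phi> \<psi> G" and H: "represents N p q \<phi>' \<psi>' H" and q: "\<And>x. x \<in> N \<Longrightarrow> q x \<in> N"
    and c: "card (verts G - \<phi> ` N) = card (verts H - \<phi>' ` N)"
  shows "mgraph_iso G H"
proof -
  have r: "finite (verts G)" "\<phi> ` N \<subseteq> verts G" "labels_cycles N p \<phi>" "edges G = \<psi> ` N"
    "\<forall>x\<in>N. \<forall>y\<in>N. \<psi> x = \<psi> y \<longleftrightarrow> y = x \<or> y = q x" "\<forall>x\<in>N. ends G (\<psi> x) = {\<phi> x, \<phi> (q x)}"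
    using G unfolding represents_def by blast+
  have r': "finite (verts H)" "\<phi>' ` N \<subseteq> verts H" "labels_cycles N p \<phi>'" "edges H = \<psi>' ` N"
    "\<forall>x\<in>N. \<forall>y\<in>N. \<psi>' x = \<psi>' y \<longleftrightarrow> y = x \<or> y = q x" "\<forall>x\<in>N. ends H (\<psi>' x) = {\<phi>' x, \<phi>' (q x)}"
    using H unfolding represents_def by blast+
  \<comment> \<open>Vertices with darts are matched through their labels; isolated ones can be
    matched arbitrarily, as there are equally many.\<close>
  obtain k where k: "bij_betw k (verts G - \<phi> ` N) (verts H - \<phi>' ` N)"
    using finite_same_card_bij[of "verts G - \<phi> ` N" "verts H - \<phi>' ` N"] c r(1) r'(1) by auto
  define f where "f v = (if v \<in> \<phi> ` N then \<phi>' (inv_into N \<phi> v) else k v)" for v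
  define h where "h e = \<psi>' (inv_into N \<psi> e)" for e
  have inv: "inv_into N a (a x) \<in> N" "a (inv_into N a (a x)) = a x" if "x \<in> N" for x and a :: "'a \<Rightarrow> 'z"
    using that by (simp_all add: inv_into_into f_inv_into_f)
  have f_lab: "f (\<phi> x) = \<phi>' x" if "x \<in> N" for x
  proof -
    have "(inv_into N \<phi> (\<phi> x), x) \<in> gen_eq N (gr p)"
      using inv[OF that, of \<phi>] that r(3) unfolding labels_cycles_def by blast
    then have "\<phi>' (inv_into N \<phi> (\<phi> x)) = \<phi>' x"
      using inv[OF that, of \<phi>] that r'(3) unfolding labels_cycles_def by blast
    then show ?thesis using that by (simp add: f_def)
  qed
  have h_lab: "h (\<psi> x) = \<psi>' x" if "x \<in> N" for x
  proof -
    have "x = inv_into N \<psi> (\<psi> x) \<or> x = q (inv_into N \<psi> (\<psi> x))"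
      using inv[OF that, of \<psi>] that r(5) by blast
    then show ?thesis
      using inv[OF that, of \<psi>] that r'(5) unfolding h_def by blast
  qed
  have "bij_betw f (\<phi> ` N \<union> (verts G - \<phi> ` N)) (\<phi>' ` N \<union> (verts H - \<phi>' ` N))"
  proof (rule bij_betw_combine)
    have "f x = f y \<longrightarrow> x = y" if "x \<in> \<phi> ` N" "y \<in> \<phi> ` N" for x y
      using that f_lab r(3) r'(3) unfolding labels_cycles_def by auto
    then show "bij_betw f (\<phi> ` N) (\<phi>' ` N)"
      by (intro bij_betw_imageI inj_onI) (use f_lab in \<open>auto simp: image_image\<close>)
    show "bij_betw f (verts G - \<phi> ` N) (verts H - \<phi>' ` N)"
      using k by (rule bij_betw_cong[THEN iffD1, rotated]) (simp add: f_def)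
  qed auto
  then have "bij_betw f (verts G) (verts H)"
    using r(2) r'(2) by (simp add: Un_absorb1)
  moreover have "bij_betw h (edges G) (edges H)"
  proof (rule bij_betw_imageI)
    show "inj_on h (edges G)"
      unfolding r(4) by (rule inj_onI) (use h_lab r(5) r'(5) in auto)
    show "h ` edges G = edges H"
      unfolding r(4) r'(4) using h_lab by (auto simp: image_image)
  qed
  moreover have "\<forall>e\<in>edges G. ends G e \<subseteq> verts G \<and> ends H (h e) = f ` ends G e"
    using r(2,4,6) r'(6) h_lab f_lab q by auto
  ultimately show ?thesis unfolding mgraph_iso_def by blast
qed

lemma has_ad_graph_genus:
  assumes "has_ad_graph D G"
  shows "\<exists>n. curve_count G n \<and> 2 * diagram_turaev_genus D =
    of_int (2 * int (num_components G) - int (card (verts G)) + int (card (edges G)) - int n)"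
proof -
  interpret diagram D using assms by unfold_locales (simp add: has_ad_graph_def)
  let ?q = "fix_set (S - NA) \<tau>"
  obtain p where M: "signed_map NA p ?q sgn_over"
    and ret: "\<And>x. x \<in> NA \<Longrightarrow> first_return (\<sigma> \<circ> \<tau>) NA (\<tau> x) (p x)"
    and g: "2 * diagram_turaev_genus D = of_int (int (cyc NA (p \<circ> ?q)) - int (petrie NA p ?q))"
    using signed_map_exists by blast
  interpret M: signed_map NA p ?q sgn_over by fact
  have q: "?q x = \<tau> x" if "x \<in> NA" for x using that by (simp add: fix_set_def)
  obtain \<phi> \<psi> where "represents NA p ?q \<phi> \<psi> G"
    using represents_iso[OF represents_ad_graph(1)[OF M ret q]] M.opp_in assms
    unfolding has_ad_graph_def by blast
  then interpret represented_map NA p ?q sgn_over \<phi> \<psi> G by unfold_locales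
  show ?thesis using petrie_count g unfolding faces_minus_petrie by blast
qed

section \<open>From signed maps to link diagrams\<close>

text \<open>The edges of the second map that are not in the first are alternating, and contracting them gives the first map.\<close>

definition expands ::
  "'a set \<Rightarrow> ('a \<Rightarrow> 'a) \<Rightarrow> ('a \<Rightarrow> 'a) \<Rightarrow> ('a \<Rightarrow> bool) \<Rightarrow> 'a set \<Rightarrow> ('a \<Rightarrow> 'a) \<Rightarrow> ('a \<Rightarrow> 'a) \<Rightarrow> ('a \<Rightarrow> bool) \<Rightarrow> bool" where
  "expands N p q s N' p' q' s' \<longleftrightarrow>
    N \<subseteq> N' \<and> (\<forall>x\<in>N. q' x = q x \<and> s' x = s x) \<and> (\<forall>x\<in>N' - N. s' (q' x) \<noteq> s' x) \<and>
    (\<forall>x\<in>N. first_return (p' \<circ> q') N (q x) (p x)) \<and>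
    (\<forall>x\<in>N'. \<exists>y\<in>N. (x, y) \<in> gen_eq N' (gr p' \<union> gr q'))"

lemma first_return_connected:
  assumes "f permutes S" "first_return f A x y" "x \<in> S"
  shows "(x, y) \<in> gen_eq S (gr f)"
  using assms(2,3)
proof (induction rule: first_return.induct)
  case (hit x)
  then show ?case using gen_eq_gr[OF assms(1)] by blast
next
  case (skip x y)
  then show ?case using gen_eq_gr[OF assms(1), of x "gr f"] permutes_in_image[OF assms(1)] by (meson gen_eq_trans order_refl)
qed

lemma expands_refl:
  assumes "plane_map N p q s"
  shows "expands N p q s N p q s"
proof -
  interpret plane_map N p q s by fact
  have "first_return (p \<circ> q) N (q x) (p x)" if "x \<in> N" for x
    using that first_return.hit[of "p \<circ> q" "q x" N] opp_opp permutes_in_image[OF rot] by simp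
  then show ?thesis unfolding expands_def by blast
qed

lemma expands_trans:
  assumes M1: "plane_map N1 p1 q1 s1" and M2: "plane_map N2 p2 q2 s2"
    and E1: "expands N0 p0 q0 s0 N1 p1 q1 s1" and E2: "expands N1 p1 q1 s1 N2 p2 q2 s2"
  shows "expands N0 p0 q0 s0 N2 p2 q2 s2"
proof -
  interpret A: plane_map N1 p1 q1 s1 by fact
  interpret B: plane_map N2 p2 q2 s2 by fact
  have sub: "N0 \<subseteq> N1" "N1 \<subseteq> N2" using E1 E2 by (auto simp: expands_def)
  have qin: "q1 x \<in> N1 \<longleftrightarrow> x \<in> N1" for x using A.opp by (rule permutes_in_image)
  have pin: "p1 x \<in> N1 \<longleftrightarrow> x \<in> N1" for x using A.rot by (rule permutes_in_image)
  have \<phi>2: "p2 \<circ> q2 permutes N2" by (rule permutes_compose[OF B.opp B.rot])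
  have ret: "first_return (p2 \<circ> q2) N1 (q1 x) (p1 x)" if "x \<in> N1" for x
    using E2 that by (simp add: expands_def)
  show ?thesis
    unfolding expands_def
  proof (intro conjI ballI)
    show "N0 \<subseteq> N2" using sub by blast
    show "q2 x = q0 x" "s2 x = s0 x" if "x \<in> N0" for x
      using that sub E1 E2 unfolding expands_def by auto
    show "s2 (q2 x) \<noteq> s2 x" if x: "x \<in> N2 - N0" for x
    proof (cases "x \<in> N1")
      case True
      then have "s1 (q1 x) \<noteq> s1 x" "q2 x = q1 x" "s2 x = s1 x" "s2 (q1 x) = s1 (q1 x)"
        using x E1 E2 qin unfolding expands_def by auto
      then show ?thesis by metis
    next
      case False
      then show ?thesis using x E2 unfolding expands_def by auto
    qed
    show "first_return (p2 \<circ> q2) N0 (q0 x) (p0 x)" if x: "x \<in> N0" for x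
    proof (rule first_return_trans)
      show "first_return (p1 \<circ> q1) N0 (q0 x) (p0 x)" using E1 x by (simp add: expands_def)
      have "q0 x = q1 x" using E1 x by (simp add: expands_def)
      then show "q0 x \<in> N1" using x sub qin by auto
      show "(p1 \<circ> q1) z \<in> N1 \<and> first_return (p2 \<circ> q2) N1 z ((p1 \<circ> q1) z)" if "z \<in> N1" for z
        using ret[of "q1 z"] that qin pin A.opp_opp by simp
    qed (fact sub(1))
    show "\<exists>y\<in>N0. (x, y) \<in> gen_eq N2 (gr p2 \<union> gr q2)" if x: "x \<in> N2" for x
    proof -
      obtain y where y: "y \<in> N1" "(x, y) \<in> gen_eq N2 (gr p2 \<union> gr q2)"
        using E2 x unfolding expands_def by blast
      obtain z where z: "z \<in> N0" "(y, z) \<in> gen_eq N1 (gr p1 \<union> gr q1)"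
        using E1 y(1) unfolding expands_def by blast
      have opp_step: "(a, q1 a) \<in> gen_eq N2 (gr p2 \<union> gr q2)" if "a \<in> N1" for a
      proof -
        have "q2 a = q1 a" using E2 that by (simp add: expands_def)
        then show ?thesis using gen_eq_gr[OF B.opp, of a] that sub by force
      qed
      have "(y, z) \<in> gen_eq N2 (gr p2 \<union> gr q2)"
        using z(2)
      proof (rule gen_eq_mono)
        fix a b assume ab: "(a, b) \<in> gr p1 \<union> gr q1" "a \<in> N1" "b \<in> N1"
        have "q1 a \<in> N2" using ab(2) qin sub by auto
        then have "(q1 a, p1 a) \<in> gen_eq N2 (gr (p2 \<circ> q2))"
          using first_return_connected[OF \<phi>2 ret[OF ab(2)]] by simp
        then have "(q1 a, p1 a) \<in> gen_eq N2 (gr p2 \<union> gr q2)"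
          using gen_eq_face[OF B.rot B.opp] by simp
        then have "(a, p1 a) \<in> gen_eq N2 (gr p2 \<union> gr q2)"
          using opp_step[OF ab(2)] gen_eq_trans by metis
        then show "(a, b) \<in> gen_eq N2 (gr p2 \<union> gr q2)"
          using ab opp_step[OF ab(2)] by auto
      qed
      then show ?thesis using y(2) z(1) gen_eq_trans by metis
    qed
  qed
qed

text \<open>The new dart is a component by itself, and merging cycles from different components
  leaves the defect unchanged.\<close>

lemma attach_dart:
  assumes p: "p permutes S" and q: "q permutes S" and "finite S" "a \<in> S" "d \<in> S" "a \<noteq> d" "p d = d" "q d = d"
    and "defect S p q = 0"
  shows "p \<circ> transpose a d permutes S" "defect S (p \<circ> transpose a d) q = 0"
    and "gen_eq S (gr (p \<circ> transpose a d)) = gen_eq S (insert (a, d) (gr p))"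
proof -
  have i: "p x = d \<longleftrightarrow> x = d" "q x = d \<longleftrightarrow> x = d" for x
    using assms by (metis permutes_inj injD)+
  have sep: "(a, d) \<notin> gen_eq S (gr q \<union> gr p)"
  proof
    assume "(a, d) \<in> gen_eq S (gr q \<union> gr p)"
    then have "(a = d) = (d = d)" by (rule gen_eq_invariant) (use i in auto)
    then show False using assms(6) by simp
  qed
  then have sep': "(a, d) \<notin> gen_eq S (gr p)"
    by (auto dest: gen_eq_mono[where R' = "gr q \<union> gr p"] intro: gen_eq_base)
  show pt: "p \<circ> transpose a d permutes S" using assms by (simp add: permutes_transpose)
  show "defect S (p \<circ> transpose a d) q = 0"
    using defect_merge[OF q p assms(3-5) sep'] sep assms(9) defect_commute[OF p q] defect_commute[OF pt q] by simp
  show "gen_eq S (gr (p \<circ> transpose a d)) = gen_eq S (insert (a, d) (gr p))"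
    using gen_eq_transpose[OF p assms(3-5) sep', of "{}"] by simp
qed

section \<open>Expansion of a map to a four-valent one\<close>

lemma card_four_orbit:
  assumes "distinct [a, b, c, d]" "p a = b" "p b = c" "p c = d" "p d = a" "x \<in> {a, b, c, d}"
  shows "card (orbit p x) = 4"
proof -
  have "orbit p x \<subseteq> {a, b, c, d}"
  proof
    fix y assume "y \<in> orbit p x"
    then show "y \<in> {a, b, c, d}" by induction (use assms(2-6) in auto)
  qed
  moreover have "{a, b, c, d} \<subseteq> orbit p x"
  proof -
    have "p x \<in> orbit p x" "p (p x) \<in> orbit p x" "p (p (p x)) \<in> orbit p x" "p (p (p (p x))) \<in> orbit p x"
      by (intro orbit.intros)+
    then show ?thesis using assms(2-6) by auto
  qed
  ultimately have "orbit p x = {a, b, c, d}" by blast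
  then show ?thesis using assms(1) by simp
qed

abbreviation bad_darts :: "'a set \<Rightarrow> ('a \<Rightarrow> 'a) \<Rightarrow> 'a set" where
  "bad_darts N p \<equiv> {x \<in> N. card (orbit p x) \<noteq> 4}"

context plane_map
begin

lemma insert_two:
  assumes "d \<notin> N" "e \<notin> N" "d \<noteq> e"
  shows "\<sigma> permutes insert d (insert e N)" "\<tau> permutes insert d (insert e N)"
    "finite (insert d (insert e N))" "defect (insert d (insert e N)) \<sigma> \<tau> = 0"
    "\<sigma> d = d" "\<sigma> e = e" "\<tau> d = d" "\<tau> e = e"
proof -
  have sub: "\<sigma> permutes X" "\<tau> permutes X" if "N \<subseteq> X" for X
    using permutes_subset[OF rot that] permutes_subset[OF opp that] by simp_all
  show fixed: "\<sigma> d = d" "\<sigma> e = e" "\<tau> d = d" "\<tau> e = e"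
    using assms rot opp by (simp_all add: permutes_not_in)
  show "\<sigma> permutes insert d (insert e N)" "\<tau> permutes insert d (insert e N)"
    by (rule sub; blast)+
  show "finite (insert d (insert e N))" using fin by simp
  have "defect (insert e N) \<sigma> \<tau> = 0"
    using defect_drop[of \<sigma> "insert e N" \<tau> e] sub[of "insert e N"] fin fixed planar assms by (simp add: subset_insertI)
  then show "defect (insert d (insert e N)) \<sigma> \<tau> = 0"
    using defect_drop[of \<sigma> "insert d (insert e N)" \<tau> d] sub[of "insert d (insert e N)"] fin fixed assms
    by (simp add: subset_insertI2)
qed

lemma orbit_unchanged:
  assumes "z \<in> N" "\<And>w. (z, w) \<in> gen_eq N (gr \<sigma>) \<Longrightarrow> p w = \<sigma> w"
  shows "orbit p z = orbit \<sigma> z"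
  by (rule orbit_cong) (use assms gen_eq_gr_orbit[OF rot fin assms(1)] self_in_orbit[OF rot fin] in auto)

text \<open>A vertex of degree two receives an alternating loop between its second dart and its
  first. The new darts are neighbours, so the loop bounds a face and the map stays plane.\<close>

lemma add_loop:
  assumes x: "x \<in> N" and two: "\<sigma> (\<sigma> x) = x" and de: "d \<notin> N" "e \<notin> N" "d \<noteq> e"
  shows "\<exists>N' p q s'. plane_map N' p q s' \<and> expands N \<sigma> \<tau> s N' p q s' \<and>
    card (bad_darts N' p) < card (bad_darts N \<sigma>)"
proof -
  let ?N = "insert d (insert e N)" and ?y = "\<sigma> x"
  note ins = insert_two[OF de]
  have yN: "?y \<in> N" "?y \<noteq> x" using x sign_rot[OF x] by auto
  have ne: "x \<noteq> d" "x \<noteq> e" "?y \<noteq> d" "?y \<noteq> e" using x yN de by metis+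
  \<comment> \<open>Together with the next transposition this makes the vertex the four-cycle
    \<open>x\<close>, \<open>\<sigma> x\<close>, \<open>d\<close>, \<open>e\<close>.\<close>
  define p1 where "p1 = \<sigma> \<circ> transpose ?y d"
  have a1: "p1 permutes ?N" "defect ?N p1 \<tau> = 0" "gen_eq ?N (gr p1) = gen_eq ?N (insert (?y, d) (gr \<sigma>))"
    unfolding p1_def using attach_dart[OF ins(1,2,3) _ _ ne(3) ins(5,7,4)] yN by simp_all
  have p1e: "p1 e = e" using ne ins de by (simp add: p1_def)
  define p where "p = p1 \<circ> transpose d e"
  have a2: "p permutes ?N" "defect ?N p \<tau> = 0"
    unfolding p_def using attach_dart[OF a1(1) ins(2,3) _ _ de(3) p1e ins(8) a1(2)] by simp_all
  have pv: "p ?y = d" "p d = e" "p e = x" "\<And>z. z \<notin> {?y, d, e} \<Longrightarrow> p z = \<sigma> z"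
    using ne de ins two by (auto simp: p_def p1_def transpose_def)
  have px: "p x = ?y" using pv(4)[of x] ne yN by auto
  define q where "q = \<tau> \<circ> transpose d e"
  have qv: "q d = e" "q e = d" "\<And>z. z \<in> N \<Longrightarrow> q z = \<tau> z"
    using de ins by (auto simp: q_def transpose_def)
  have q: "q permutes ?N" unfolding q_def using ins(2) by (simp add: permutes_transpose)
  define s' where "s' = s(d := s x, e := \<not> s x)"
  have sv: "s' d = s x" "s' e = (\<not> s x)" "\<And>z. z \<in> N \<Longrightarrow> s' z = s z" using de by (auto simp: s'_def)
  have sy: "s ?y = (\<not> s x)" using sign_rot[OF x] by simp
  have pl: "defect ?N p q = 0"
  proof -
    have i: "\<tau> z = d \<longleftrightarrow> z = d" for z using ins(7) by (metis opp_inj)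
    have "(d, e) \<notin> gen_eq ?N (gr \<tau>)"
    proof
      assume "(d, e) \<in> gen_eq ?N (gr \<tau>)"
      then have "(d = d) = (e = d)" by (rule gen_eq_invariant) (use i in auto)
      then show False using de by simp
    qed
    \<comment> \<open>Before \<open>d\<close> and \<open>e\<close> are paired they lie on a common
      face, and merging them into an edge there adds no handle.\<close>
    moreover have "(d, e) \<in> gen_eq ?N (gr (p \<circ> \<tau>))"
      using ins(7) pv(2) by (intro gen_eq_base) auto
    ultimately show ?thesis
      unfolding q_def using defect_merge[OF a2(1) ins(2,3), of d e] a2(2) by simp
  qed
  have M: "plane_map ?N p q s'"
  proof
    fix z assume z: "z \<in> ?N"
    show "q z \<noteq> z" "q (q z) = z"
      using z qv de opp_fpf by auto
    show "s' (p z) \<longleftrightarrow> \<not> s' z"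
    proof (cases "z \<in> {?y, d, e}")
      case True
      then consider "z = ?y" | "z = d" | "z = e" by blast
      then show ?thesis
        by cases (simp_all add: pv(1-3) sv(1,2) sv(3)[OF yN(1)] sv(3)[OF x] sy)
    next
      case False
      then have "z \<in> N" using z by auto
      then show ?thesis using False pv(4) sv sign_rot by simp
    qed
  qed (fact ins(3) a2(1) q pl)+
  have E: "expands N \<sigma> \<tau> s ?N p q s'"
    unfolding expands_def
  proof (intro conjI ballI)
    show "q z = \<tau> z" "s' z = s z" if "z \<in> N" for z using that qv sv by auto
    show "s' (q z) \<noteq> s' z" if "z \<in> ?N - N" for z using that qv sv by auto
    show "first_return (p \<circ> q) N (\<tau> z) (\<sigma> z)" if z: "z \<in> N" for z
    proof (cases "z = ?y")
      case True
      have "first_return (p \<circ> q) N d x" using first_return.hit[of "p \<circ> q" d N] qv pv x by simp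
      then have "first_return (p \<circ> q) N (\<tau> ?y) x"
        using first_return.skip[of "p \<circ> q" "\<tau> ?y" N x] qv pv yN de by simp
      then show ?thesis using True two by simp
    next
      case False
      then have "p z = \<sigma> z" using z de by (intro pv(4)) auto
      then show ?thesis using first_return.hit[of "p \<circ> q" "\<tau> z" N] qv z by simp
    qed
    show "\<exists>y\<in>N. (z, y) \<in> gen_eq ?N (gr p \<union> gr q)" if z: "z \<in> ?N" for z
    proof -
      have c: "(?y, d) \<in> gen_eq ?N (gr p \<union> gr q)" "(d, e) \<in> gen_eq ?N (gr p \<union> gr q)"
        by (rule gen_eq_base; use pv(1,2) yN(1) in simp)+
      from z consider "z = d" | "z = e" | "z \<in> N" by blast
      then show ?thesis
      proof cases
        case 1
        then show ?thesis using gen_eq_sym[OF c(1)] yN(1) by blast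
      next
        case 2
        then show ?thesis using gen_eq_sym[OF gen_eq_trans[OF c]] yN(1) by blast
      next
        case 3
        then show ?thesis by blast
      qed
    qed
  qed auto
  have four: "card (orbit p z) = 4" if "z \<in> {x, ?y, d, e}" for z
    by (rule card_four_orbit[OF _ px pv(1-3) that]) (use ne yN de in auto)
  have "orbit \<sigma> x \<subseteq> {x, ?y}"
  proof
    fix z assume "z \<in> orbit \<sigma> x"
    then show "z \<in> {x, ?y}" by induction (use two in auto)
  qed
  moreover have "orbit \<sigma> ?y = orbit \<sigma> x" using orbit_step_eq[OF rot fin] .
  moreover have "card (orbit \<sigma> x) \<le> 2"
    using card_mono[OF _ \<open>orbit \<sigma> x \<subseteq> {x, ?y}\<close>] yN by (simp add: card_insert_if split: if_splits)
  ultimately have xbad: "x \<in> bad_darts N \<sigma>" using x by auto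
  have "bad_darts ?N p \<subseteq> bad_darts N \<sigma> - {x}"
  proof
    fix z assume z: "z \<in> bad_darts ?N p"
    then have n: "z \<notin> {x, ?y, d, e}" using four by blast
    then have zN: "z \<in> N" using z by auto
    have "orbit p z = orbit \<sigma> z"
    proof (rule orbit_unchanged[OF zN])
      fix w assume w: "(z, w) \<in> gen_eq N (gr \<sigma>)"
      then have "w \<in> N" using zN gen_eq_closed by metis
      moreover have "w \<noteq> ?y"
      proof
        assume "w = ?y"
        then have "z \<in> orbit \<sigma> ?y" using gen_eq_sym[OF w] gen_eq_gr_orbit[OF rot fin yN(1)] by simp
        then show False using n \<open>orbit \<sigma> ?y = orbit \<sigma> x\<close> \<open>orbit \<sigma> x \<subseteq> {x, ?y}\<close> by auto
      qed
      ultimately show "p w = \<sigma> w" using de by (intro pv(4)) auto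
    qed
    then show "z \<in> bad_darts N \<sigma> - {x}" using z zN n by auto
  qed
  then have "card (bad_darts ?N p) \<le> card (bad_darts N \<sigma> - {x})" using fin by (intro card_mono) auto
  also have "\<dots> < card (bad_darts N \<sigma>)" using xbad fin by (intro psubset_card_mono) auto
  finally show ?thesis using M E by blast
qed

text \<open>Three consecutive darts are cut off into a new vertex, joined to the rest of the old one
  by an alternating edge. The new vertex has degree four and the old one loses two darts.\<close>

lemma split_vertex:
  assumes x: "x \<in> N" and bad: "card (orbit \<sigma> x) \<noteq> 4" and nx: "\<sigma> (\<sigma> x) \<noteq> x" and de: "d \<notin> N" "e \<notin> N" "d \<noteq> e"
  shows "\<exists>N' p q s'. plane_map N' p q s' \<and> expands N \<sigma> \<tau> s N' p q s' \<and>
    card (bad_darts N' p) < card (bad_darts N \<sigma>)"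
proof -
  let ?N = "insert d (insert e N)" and ?y = "\<sigma> x" and ?z = "\<sigma> (\<sigma> x)"
  define l where "l = inv \<sigma> x"
  note ins = insert_two[OF de]
  have l: "l \<in> N" "\<sigma> l = x" using x rot by (auto simp: l_def permutes_inverses permutes_in_image permutes_inv)
  have N: "?y \<in> N" "?z \<in> N" using x by auto
  have sv0: "s ?y = (\<not> s x)" "s ?z = s x" "s l = (\<not> s x)" "s (\<sigma> ?z) = (\<not> s x)"
    using x sign_rot[of x] sign_rot[of ?y] sign_rot[of ?z] sign_rot[of l] l by auto
  have ne0: "?y \<noteq> x" "?z \<noteq> ?y" "?z \<noteq> l" "?y \<noteq> l" "x \<noteq> l"
  proof -
    show "?y \<noteq> x" "?z \<noteq> ?y" "?z \<noteq> l" "x \<noteq> l" using sv0 by (metis (full_types))+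
    show "?y \<noteq> l" using l nx by metis
  qed
  have ne: "x \<noteq> d" "x \<noteq> e" "?y \<noteq> d" "?y \<noteq> e" "?z \<noteq> d" "?z \<noteq> e" "l \<noteq> d" "l \<noteq> e" using x N l de by metis+
  define p1 where "p1 = \<sigma> \<circ> transpose ?z d"
  have a1: "p1 permutes ?N" "defect ?N p1 \<tau> = 0" "gen_eq ?N (gr p1) = gen_eq ?N (insert (?z, d) (gr \<sigma>))"
    unfolding p1_def using attach_dart[OF ins(1,2,3) _ _ ne(5) ins(5,7,4)] N by simp_all
  have p1e: "p1 e = e" using ne ins de by (simp add: p1_def)
  define p2 where "p2 = p1 \<circ> transpose l e"
  have a2: "p2 permutes ?N" "defect ?N p2 \<tau> = 0" "gen_eq ?N (gr p2) = gen_eq ?N (insert (l, e) (gr p1))"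
    unfolding p2_def using attach_dart[OF a1(1) ins(2,3) _ _ ne(8) p1e ins(8) a1(2)] l by simp_all
  \<comment> \<open>This separates the four-cycle \<open>x\<close>, \<open>\<sigma> x\<close>,
    \<open>\<sigma> (\<sigma> x)\<close>, \<open>d\<close> from the remainder, where
    \<open>e\<close> takes the place of the three darts after \<open>l\<close>.\<close>
  define p where "p = p2 \<circ> transpose d e"
  have pv: "p ?z = d" "p d = x" "p l = e" "p e = \<sigma> ?z" "\<And>w. w \<notin> {?z, d, l, e} \<Longrightarrow> p w = \<sigma> w"
    using ne ne0 de ins l by (auto simp: p_def p2_def p1_def transpose_def)
  have px: "p x = ?y" "p ?y = ?z" using pv(5)[of x] pv(5)[of ?y] ne ne0 nx by auto
  have p: "p permutes ?N" unfolding p_def using a2(1) by (simp add: permutes_transpose)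
  define q where "q = \<tau> \<circ> transpose d e"
  have qv: "q d = e" "q e = d" "\<And>z. z \<in> N \<Longrightarrow> q z = \<tau> z"
    using de ins by (auto simp: q_def transpose_def)
  have q: "q permutes ?N" unfolding q_def using ins(2) by (simp add: permutes_transpose)
  \<comment> \<open>Each new dart takes the sign opposite to its predecessor: \<open>d\<close>
    follows a dart of the sign of \<open>x\<close>, and \<open>e\<close> follows \<open>l\<close>,
    which has the other sign. The new edge is therefore alternating.\<close>
  define s' where "s' = s(d := \<not> s x, e := s x)"
  have sv: "s' d = (\<not> s x)" "s' e = s x" "\<And>z. z \<in> N \<Longrightarrow> s' z = s z" using de by (auto simp: s'_def)
  have de_q: "(d, e) \<in> gen_eq ?N (gr p \<union> gr q)" using qv by (auto intro!: gen_eq_base)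
  have pl: "defect ?N p q = 0"
  proof -
    have i: "\<tau> z = d \<longleftrightarrow> z = d" for z using ins(7) by (metis opp_inj)
    have sep: "(d, e) \<notin> gen_eq ?N (gr \<tau>)"
    proof
      assume "(d, e) \<in> gen_eq ?N (gr \<tau>)"
      then have "(d = d) = (e = d)" by (rule gen_eq_invariant) (use i in auto)
      then show False using de by simp
    qed
    then have c\<tau>: "cyc ?N q + 1 = cyc ?N \<tau>"
      unfolding q_def using cyc_transpose_merge[OF ins(2,3)] by simp
    have zl: "(?z, l) \<in> gen_eq N (gr \<sigma>)"
    proof -
      have "(l, x) \<in> gen_eq N (gr \<sigma>)" "(x, ?y) \<in> gen_eq N (gr \<sigma>)" "(?y, ?z) \<in> gen_eq N (gr \<sigma>)"
        using l x N by (auto intro!: gen_eq_base)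
      then show ?thesis by (meson gen_eq_sym gen_eq_trans)
    qed
    have up: "(a, b) \<in> gen_eq ?N (gr p2)" if "(a, b) \<in> gen_eq N (insert (?z, d) (gr \<sigma>)) \<or> (a, b) = (?z, d) \<or> (a, b) = (l, e)" for a b
    proof -
      have 1: "(a, b) \<in> gen_eq ?N (gr p2)" if "(a, b) \<in> gen_eq ?N (gr p1)" for a b
        using that unfolding a2(3) by (rule gen_eq_mono) (auto intro: gen_eq_base)
      have 2: "(a, b) \<in> gen_eq ?N (gr p1)" if "(a, b) \<in> gen_eq N (insert (?z, d) (gr \<sigma>))" for a b
        using that unfolding a1(3) by (rule gen_eq_mono) (auto intro: gen_eq_base)
      have 3: "(?z, d) \<in> gen_eq ?N (gr p1)" unfolding a1(3) using N by (auto intro: gen_eq_base)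
      have 4: "(l, e) \<in> gen_eq ?N (gr p2)" unfolding a2(3) using l by (auto intro: gen_eq_base)
      show ?thesis using that 1 2 3 4 by auto
    qed
    have "(?z, l) \<in> gen_eq N (insert (?z, d) (gr \<sigma>))"
      using zl by (rule gen_eq_mono) (auto intro: gen_eq_base)
    then have "(?z, l) \<in> gen_eq ?N (gr p2)" "(?z, d) \<in> gen_eq ?N (gr p2)" "(l, e) \<in> gen_eq ?N (gr p2)"
      using up by blast+
    then have "(d, e) \<in> gen_eq ?N (gr p2)" by (meson gen_eq_sym gen_eq_trans)
    then have c\<sigma>: "cyc ?N p = cyc ?N p2 + 1"
      unfolding p_def using cyc_transpose_split[OF a2(1) ins(3) _ _ de(3)] by simp
    have face: "p \<circ> q = p2 \<circ> \<tau>"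
    proof
      fix w
      have "transpose d e (\<tau> (transpose d e w)) = \<tau> w"
        using ins(7,8) opp_inj by (auto simp: transpose_def)
      then show "(p \<circ> q) w = (p2 \<circ> \<tau>) w" by (simp add: p_def q_def)
    qed
    \<comment> \<open>One vertex is gained, one edge cycle is lost and the faces stay. The new edge
      keeps the two parts connected, so the defect cannot have grown.\<close>
    have "comps ?N p q \<le> comps ?N p2 \<tau>"
    proof (rule ncl_mono[OF ins(3)])
      fix a b assume ab: "(a, b) \<in> gr p2 \<union> gr \<tau>" "a \<in> ?N" "b \<in> ?N"
      have "(a, p2 a) \<in> gen_eq ?N (gr p \<union> gr q)"
        by (rule gen_eq_untranspose[OF p[unfolded p_def] _ de_q ab(2)]) (auto simp: p_def)
      moreover have "(a, \<tau> a) \<in> gen_eq ?N (gr p \<union> gr q)"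
        by (rule gen_eq_untranspose[OF q[unfolded q_def] _ de_q ab(2)]) (auto simp: q_def)
      ultimately show "(a, b) \<in> gen_eq ?N (gr p \<union> gr q)" using ab(1) by auto
    qed
    then show ?thesis
      using a2(2) c\<tau> c\<sigma> defect_nonneg[OF p q ins(3)] by (simp add: defect_def face)
  qed
  have M: "plane_map ?N p q s'"
  proof
    fix w assume w: "w \<in> ?N"
    show "q w \<noteq> w" "q (q w) = w"
      using w qv de opp_fpf by auto
    show "s' (p w) \<longleftrightarrow> \<not> s' w"
    proof (cases "w \<in> {?z, d, l, e}")
      case True
      then consider "w = ?z" | "w = d" | "w = l" | "w = e" by blast
      then show ?thesis
        by cases (simp_all add: pv(1-4) sv(1,2) sv(3)[OF N(2)] sv(3)[OF x] sv(3)[OF l(1)] sv(3)[of "\<sigma> ?z"] x sv0)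
    next
      case False
      then have "w \<in> N" using w by auto
      then show ?thesis using False pv(5) sv sign_rot by simp
    qed
  qed (fact ins(3) p q pl)+
  have E: "expands N \<sigma> \<tau> s ?N p q s'"
    unfolding expands_def
  proof (intro conjI ballI)
    show "q w = \<tau> w" "s' w = s w" if "w \<in> N" for w using that qv sv by auto
    show "s' (q w) \<noteq> s' w" if "w \<in> ?N - N" for w using that qv sv by auto
    show "first_return (p \<circ> q) N (\<tau> w) (\<sigma> w)" if w: "w \<in> N" for w
    proof -
      consider "w = ?z" | "w = l" | "w \<notin> {?z, d, l, e}" using w de by blast
      then show ?thesis
      proof cases
        case 1
        have "first_return (p \<circ> q) N d (\<sigma> ?z)" using first_return.hit[of "p \<circ> q" d N] qv pv N by simp
        then show ?thesis
          using first_return.skip[of "p \<circ> q" "\<tau> w" N "\<sigma> w"] qv pv w 1 de by simp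
      next
        case 2
        have "first_return (p \<circ> q) N e x" using first_return.hit[of "p \<circ> q" e N] qv pv x by simp
        then show ?thesis
          using first_return.skip[of "p \<circ> q" "\<tau> w" N "\<sigma> w"] qv pv w 2 de l by simp
      next
        case 3
        then show ?thesis using first_return.hit[of "p \<circ> q" "\<tau> w" N] qv w pv(5)[OF 3] by simp
      qed
    qed
    show "\<exists>y\<in>N. (w, y) \<in> gen_eq ?N (gr p \<union> gr q)" if w: "w \<in> ?N" for w
    proof -
      have c: "(?z, d) \<in> gen_eq ?N (gr p \<union> gr q)"
        by (rule gen_eq_base; use pv(1) N(2) in simp)
      from w consider "w = d" | "w = e" | "w \<in> N" by blast
      then show ?thesis
      proof cases
        case 1
        then show ?thesis using gen_eq_sym[OF c] N(2) by blast
      next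
        case 2
        then show ?thesis using gen_eq_sym[OF gen_eq_trans[OF c de_q]] N(2) by blast
      next
        case 3
        then show ?thesis by blast
      qed
    qed
  qed auto
  have four: "card (orbit p w) = 4" if "w \<in> {x, ?y, ?z, d}" for w
    by (rule card_four_orbit[OF _ px pv(1,2) that]) (use ne ne0 nx in auto)
  have orb: "orbit \<sigma> ?y = orbit \<sigma> x" "orbit \<sigma> ?z = orbit \<sigma> x" using orbit_step_eq[OF rot fin] by metis+
  have "bad_darts ?N p \<subseteq> insert e (bad_darts N \<sigma> - {x, ?y})"
  proof
    fix w assume w: "w \<in> bad_darts ?N p"
    then have n: "w \<notin> {x, ?y, ?z, d}" using four by blast
    show "w \<in> insert e (bad_darts N \<sigma> - {x, ?y})"
    proof (cases "w = e \<or> w \<in> orbit \<sigma> x")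
      case True
      moreover have "w \<in> bad_darts N \<sigma>" if wx: "w \<in> orbit \<sigma> x"
      proof -
        have xw: "(x, w) \<in> gen_eq N (gr \<sigma>)" using wx gen_eq_gr_orbit[OF rot fin x] by simp
        have "w \<in> N" using x gen_eq_closed[OF xw] by simp
        moreover have "orbit \<sigma> x = orbit \<sigma> w"
          using xw by (rule gen_eq_invariant) (use orbit_step_eq[OF rot fin] in simp)
        ultimately show ?thesis using bad by auto
      qed
      ultimately show ?thesis using n by auto
    next
      case False
      then have wN: "w \<in> N" using w n by auto
      have "orbit p w = orbit \<sigma> w"
      proof (rule orbit_unchanged[OF wN])
        fix v assume v: "(w, v) \<in> gen_eq N (gr \<sigma>)"
        then have vN: "v \<in> N" using wN gen_eq_closed by metis
        have "v \<notin> orbit \<sigma> x"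
          using False gen_eq_gr_orbit[OF rot fin x] gen_eq_sym[OF v] gen_eq_trans by metis
        moreover have "?z \<in> orbit \<sigma> x" by (intro orbit.intros)
        moreover have "l \<in> orbit \<sigma> x"
          using self_in_orbit[OF rot fin, of l] orbit_step_eq[OF rot fin, of l] l by simp
        ultimately show "p v = \<sigma> v" using vN de by (intro pv(5)) auto
      qed
      then show ?thesis using w wN n by auto
    qed
  qed
  then have "card (bad_darts ?N p) \<le> card (insert e (bad_darts N \<sigma> - {x, ?y}))" using fin by (intro card_mono) auto
  also have "\<dots> \<le> card (bad_darts N \<sigma> - {x, ?y}) + 1" by (simp add: card_insert_if fin)
  \<comment> \<open>At least the two bad darts \<open>x\<close> and \<open>\<sigma> x\<close> become
    good, and at most the one dart \<open>e\<close> is added.\<close>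
  also have "\<dots> < card (bad_darts N \<sigma>)"
  proof -
    have sub: "{x, ?y} \<subseteq> bad_darts N \<sigma>" "card {x, ?y} = 2" using x N bad orb ne0 by auto
    then show ?thesis using card_Diff_subset[OF _ sub(1)] card_mono[OF _ sub(1)] fin by simp
  qed
  finally show ?thesis using M E by blast
qed

end

text \<open>Induction on the number of darts at vertices of degree other than four. A vertex of
  degree two gets a loop, any other is split; the infinite supply of natural numbers provides the
  new darts.\<close>

lemma four_valent_expansion:
  assumes "plane_map (N :: nat set) p q s"
  shows "\<exists>N' p' q' s'. plane_map N' p' q' s' \<and> expands N p q s N' p' q' s' \<and> (\<forall>x\<in>N'. card (orbit p' x) = 4)"
  using assms
proof (induction "card (bad_darts N p)" arbitrary: N p q s rule: less_induct)
  case less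
  interpret plane_map N p q s by fact
  show ?case
  proof (cases "bad_darts N p = {}")
    case True
    then show ?thesis using expands_refl[OF less.prems] less.prems by blast
  next
    case False
    then obtain x where x: "x \<in> N" "card (orbit p x) \<noteq> 4" by auto
    obtain d where d: "d \<notin> N" using ex_new_if_finite[OF infinite_UNIV_nat fin] by auto
    obtain e where e: "e \<notin> insert d N" using ex_new_if_finite[OF infinite_UNIV_nat, of "insert d N"] fin by auto
    have "\<exists>N' p' q' s'. plane_map N' p' q' s' \<and> expands N p q s N' p' q' s' \<and>
        card (bad_darts N' p') < card (bad_darts N p)"
    proof (cases "p (p x) = x")
      case True
      show ?thesis by (rule add_loop[OF x(1) True d]) (use e in auto)
    next
      case False
      show ?thesis by (rule split_vertex[OF x False d]) (use e in auto)
    qed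
    then obtain N1 p1 q1 s1 where 1: "plane_map N1 p1 q1 s1" "expands N p q s N1 p1 q1 s1"
      "card (bad_darts N1 p1) < card (bad_darts N p)" by blast
    obtain N2 p2 q2 s2 where 2: "plane_map N2 p2 q2 s2" "expands N1 p1 q1 s1 N2 p2 q2 s2"
      "\<forall>x\<in>N2. card (orbit p2 x) = 4"
      using less.hyps[OF 1(3,1)] by blast
    show ?thesis using expands_trans[OF 1(1) 2(1) 1(2) 2(2)] 2 by blast
  qed
qed

lemma curve_count_has_ad_graph:
  assumes "curve_count G n"
  shows "\<exists>D. has_ad_graph D G"
proof -
  obtain N p q s \<phi> \<psi> where "represented_map N p q s \<phi> \<psi> G"
    using assms by (rule curve_countE)
  then interpret R: represented_map N p q s \<phi> \<psi> G .
  obtain N' p' q' s' where M: "plane_map N' p' q' s'" and E: "expands N p q s N' p' q' s'"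
    and four: "\<forall>x\<in>N'. card (orbit p' x) = 4"
    using four_valent_expansion[OF R.plane_map_axioms] by blast
  interpret M: plane_map N' p' q' s' by fact
  have E': "N \<subseteq> N'" "\<And>x. x \<in> N \<Longrightarrow> q' x = q x \<and> s' x = s x" "\<And>x. x \<in> N' - N \<Longrightarrow> s' (q' x) \<noteq> s' x"
    "\<And>x. x \<in> N \<Longrightarrow> first_return (p' \<circ> q') N (q x) (p x)"
    "\<And>x. x \<in> N' \<Longrightarrow> \<exists>y\<in>N. (x, y) \<in> gen_eq N' (gr p' \<union> gr q')"
    using E unfolding expands_def by blast+
  let ?I = "card (verts G - \<phi> ` N)"
  \<comment> \<open>Each isolated vertex is realised by a crossingless circle.\<close>
  define D where "D = \<lparr>darts = N', rot = p', opp = q', over = {x \<in> N'. s' x}, circles = ?I\<rparr>"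
  have sel: "darts D = N'" "rot D = p'" "opp D = q'" "over D = {x \<in> N'. s' x}" "circles D = ?I"
    by (simp_all add: D_def)
  interpret D0: dart_structure D
    by unfold_locales (simp_all add: sel M.fin M.rot M.opp M.opp_fpf)
  have link: "link_diagram D"
    unfolding link_diagram_def
  proof (intro conjI ballI)
    show "int (card (crossings D)) - int (card (dart_edges D)) + int (card (faces D)) = 2 * int (card (dart_components D))"
      using M.planar D0.card_crossings D0.card_faces D0.card_dart_edges
      by (simp add: defect_def D0.dart_components_eq sel)
  qed (auto simp: sel M.fin M.rot M.opp M.opp_fpf M.sign_rot four)
  interpret D: diagram D by unfold_locales (fact link)
  have sgn: "D.sgn_over x \<longleftrightarrow> s' x" if "x \<in> N'" for x using that by (simp add: D.sgn_over_def sel)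
  have NA: "nonalt D = N"
  proof
    show "nonalt D \<subseteq> N"
      using E'(3) by (auto simp: nonalt_def sel)
    show "N \<subseteq> nonalt D"
    proof
      fix x assume x: "x \<in> N"
      then have "q' x = q x" "q x \<in> N" "s' x = s x" "s' (q x) = s (q x)" using E'(2) R.opp_in by simp_all
      then show "x \<in> nonalt D" using x E'(1) R.sign_opp by (auto simp: nonalt_def sel)
    qed
  qed
  have M': "signed_map (nonalt D) p q D.sgn_over"
    unfolding NA
  proof
    have sg: "D.sgn_over x \<longleftrightarrow> s x" if "x \<in> N" for x using that sgn E'(1,2) by auto
    fix x assume x: "x \<in> N"
    show "D.sgn_over (q x) \<longleftrightarrow> D.sgn_over x" "D.sgn_over (p x) \<longleftrightarrow> \<not> D.sgn_over x"
      using x sg R.sign_opp R.sign_rot R.opp_in R.rot_in by simp_all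
  qed (use R.fin R.rot R.opp R.opp_fpf R.opp_opp R.planar in auto)
  have ret: "first_return (rot D \<circ> opp D) (nonalt D) (opp D x) (p x)" if "x \<in> nonalt D" for x
    using that E'(2,4) unfolding NA sel by simp
  have q: "q x = opp D x" if "x \<in> nonalt D" for x using that E'(2) unfolding NA sel by simp
  let ?\<phi> = "\<lambda>x. Curve (gen_eq N (gr p) `` {x})"
  have rep: "represents N p q ?\<phi> (\<lambda>x. {x, opp D x}) (ad_graph D)"
    and curves: "Curve ` curves D = ?\<phi> ` N"
    using D.represents_ad_graph[OF M' ret q] unfolding NA by simp_all
  \<comment> \<open>Every component of an expansion contains an original dart, so no alternating
    component with crossings arises that would add a vertex.\<close>
  have no_alt: "{K \<in> dart_components D. K \<inter> nonalt D = {}} = {}"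
  proof -
    have "K \<inter> N \<noteq> {}" if K: "K \<in> dart_components D" for K
    proof -
      obtain x where "x \<in> N'" "K = gen_eq N' (gr p' \<union> gr q') `` {x}"
        using K unfolding D0.dart_components_eq sel gen_classes_eq by auto
      then show ?thesis using E'(5)[of x] by blast
    qed
    then show ?thesis unfolding NA by blast
  qed
  have "verts (ad_graph D) = ?\<phi> ` N \<union> Circle ` {..<?I}"
    unfolding ad_graph_def no_alt by (simp add: curves sel)
  then have "verts (ad_graph D) - ?\<phi> ` N = Circle ` {..<?I}" by auto
  then have "card (verts (ad_graph D) - ?\<phi> ` N) = ?I"
    by (simp add: card_image inj_on_def)
  then have "mgraph_iso (ad_graph D) G"
    using represents_unique_iso[OF rep R.rep] R.opp_in by simp
  then show ?thesis using link unfolding has_ad_graph_def by blast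
qed

section \<open>The Turaev genus of an alternating decomposition graph\<close>

text \<open>The definite description denotes: a diagram exists because the map can be expanded, and
  all diagrams have the same genus because the count is unique.\<close>

lemma turaev_genus_eq:
  assumes "curve_count G n"
  shows "2 * turaev_genus G =
    of_int (2 * int (num_components G) - int (card (verts G)) + int (card (edges G)) - int n)"
proof -
  have D: "2 * diagram_turaev_genus D =
    of_int (2 * int (num_components G) - int (card (verts G)) + int (card (edges G)) - int n)"
    if "has_ad_graph D G" for D
    using has_ad_graph_genus[OF that] curve_count_unique[OF assms] by blast
  obtain D0 where D0: "has_ad_graph D0 G" using curve_count_has_ad_graph[OF assms] by blast
  have "turaev_genus G = diagram_turaev_genus D0"
    unfolding turaev_genus_def
  proof (rule the_equality)
    show "\<exists>D. has_ad_graph D G \<and> diagram_turaev_genus D0 = diagram_turaev_genus D" using D0 by blast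
    fix g assume "\<exists>D. has_ad_graph D G \<and> g = diagram_turaev_genus D"
    then obtain D where "has_ad_graph D G" "g = diagram_turaev_genus D" by blast
    then show "g = diagram_turaev_genus D0" using D[of D] D[OF D0] by simp
  qed
  then show ?thesis using D[OF D0] by simp
qed

lemma gen_eq_contract:
  assumes V: "ends G e1 \<union> ends G e2 \<subseteq> verts G" and v: "v \<in> ends G e1" "v \<in> ends G e2"
  shows "(x, y) \<in> gen_eq (verts G) (joined_by G {e1, e2}) \<longleftrightarrow>
    x = y \<or> x \<in> ends G e1 \<union> ends G e2 \<and> y \<in> ends G e1 \<union> ends G e2"
proof
  let ?W = "ends G e1 \<union> ends G e2" and ?J = "joined_by G {e1, e2}"
  assume "(x, y) \<in> gen_eq (verts G) ?J"
  \<comment> \<open>The function is constant on the ends of the contracted edges and injective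
    elsewhere, hence an invariant of the relation.\<close>
  then have "(if x \<in> ?W then None else Some x) = (if y \<in> ?W then None else Some y)"
    by (rule gen_eq_invariant) (auto simp: joined_by_def)
  then show "x = y \<or> x \<in> ?W \<and> y \<in> ?W" by (auto split: if_splits)
next
  let ?W = "ends G e1 \<union> ends G e2" and ?J = "joined_by G {e1, e2}"
  have "(w, v) \<in> gen_eq (verts G) ?J" if "w \<in> ?W" for w
    using that V v by (intro gen_eq_base) (auto simp: joined_by_def)
  then show "x = y \<or> x \<in> ?W \<and> y \<in> ?W \<Longrightarrow> (x, y) \<in> gen_eq (verts G) ?J"
    by (metis gen_eq_refl gen_eq_sym gen_eq_trans)
qed

lemma contract_edges_quotient:
  assumes "\<And>e. e \<in> edges G \<Longrightarrow> ends G e \<subseteq> verts G"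
  shows "quotient_by (\<lambda>x. gen_eq (verts G) (joined_by G F) `` {x}) F G (contract_edges G F)"
  unfolding quotient_by_def
proof (intro conjI ballI)
  let ?f = "\<lambda>x. gen_eq (verts G) (joined_by G F) `` {x}"
  show "verts (contract_edges G F) = ?f ` verts G" by (simp add: contract_edges_def gen_classes_eq)
  show "edges (contract_edges G F) = edges G - F" by (simp add: contract_edges_def)
  fix e assume "e \<in> edges (contract_edges G F)"
  then have e: "ends G e \<subseteq> verts G" using assms by (simp add: contract_edges_def)
  have "{X \<in> gen_classes (verts G) (joined_by G F). X \<inter> ends G e \<noteq> {}} = ?f ` ends G e"
  proof
    show "{X \<in> gen_classes (verts G) (joined_by G F). X \<inter> ends G e \<noteq> {}} \<subseteq> ?f ` ends G e"
    proof
      fix X assume "X \<in> {X \<in> gen_classes (verts G) (joined_by G F). X \<inter> ends G e \<noteq> {}}"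
      then obtain x y where x: "X = ?f x" "y \<in> X" "y \<in> ends G e" by (auto simp: gen_classes_eq)
      then have "X = ?f y" using gen_eq_class_eq_iff[of "verts G" "joined_by G F" x y] by simp
      then show "X \<in> ?f ` ends G e" using x by blast
    qed
    show "?f ` ends G e \<subseteq> {X \<in> gen_classes (verts G) (joined_by G F). X \<inter> ends G e \<noteq> {}}"
      unfolding gen_classes_eq using e by blast
  qed
  then show "ends (contract_edges G F) e = ?f ` ends G e" by (simp add: contract_edges_def)
qed

lemma num_components_contract:
  assumes G: "\<And>e. e \<in> edges G \<Longrightarrow> ends G e \<subseteq> verts G" and F: "F \<subseteq> edges G"
  shows "num_components (contract_edges G F) = num_components G"
proof -
  let ?f = "\<lambda>x. gen_eq (verts G) (joined_by G F) `` {x}" and ?H = "contract_edges G F"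
  let ?R = "joined_by G (edges G)" and ?R' = "joined_by ?H (edges ?H)"
  note H = contract_edges_quotient[OF G, of F, unfolded quotient_by_def]
  have up: "(x, y) \<in> gen_eq (verts G) ?R" if "(x, y) \<in> gen_eq (verts G) (joined_by G F)" for x y
    using that by (rule gen_eq_mono) (use F in \<open>auto simp: joined_by_def intro!: gen_eq_base\<close>)
  have pick: "(SOME y. y \<in> ?f x) \<in> ?f x" for x
    by (rule someI[of "\<lambda>y. y \<in> ?f x" x]) simp
  have pick_eq: "(x, SOME y. y \<in> ?f x) \<in> gen_eq (verts G) ?R" for x
    using pick[of x] up by blast
  have "ncl (verts G) ?R = ncl (verts ?H) ?R'"
  proof (rule ncl_equiv[where f = ?f and g = "\<lambda>X. SOME y. y \<in> X"])
    show "?f x \<in> verts ?H" if "x \<in> verts G" for x using H that by simp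
    show "(SOME y. y \<in> X) \<in> verts G" if X: "X \<in> verts ?H" for X
    proof -
      obtain x where "x \<in> verts G" "X = ?f x" using H X by auto
      then show ?thesis using gen_eq_closed[OF pick_eq[of x]] by simp
    qed
    show "(?f a, ?f b) \<in> gen_eq (verts ?H) ?R'" if ab: "(a, b) \<in> ?R" "a \<in> verts G" "b \<in> verts G" for a b
    proof -
      obtain e where e: "e \<in> edges G" "a \<in> ends G e" "b \<in> ends G e" using ab(1) by (auto simp: joined_by_def)
      show ?thesis
      proof (cases "e \<in> F")
        case True
        then have "(a, b) \<in> gen_eq (verts G) (joined_by G F)"
          using e ab by (intro gen_eq_base) (auto simp: joined_by_def)
        then have "?f a = ?f b" by (simp add: gen_eq_class_eq_iff)
        then show ?thesis by simp
      next
        case False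
        then have "e \<in> edges ?H" "?f a \<in> ends ?H e" "?f b \<in> ends ?H e" using H e by auto
        then have "(?f a, ?f b) \<in> ?R'" by (auto simp: joined_by_def)
        then show ?thesis using H ab by (intro gen_eq_base) auto
      qed
    qed
    show "((SOME y. y \<in> X), (SOME y. y \<in> Y)) \<in> gen_eq (verts G) ?R" if XY: "(X, Y) \<in> ?R'" for X Y
    proof -
      obtain e where e: "e \<in> edges ?H" "X \<in> ends ?H e" "Y \<in> ends ?H e" using XY by (auto simp: joined_by_def)
      then obtain a b where ab: "a \<in> ends G e" "b \<in> ends G e" "X = ?f a" "Y = ?f b" using H by auto
      have "e \<in> edges G" using e H by simp
      then have "(a, b) \<in> gen_eq (verts G) ?R"
        using ab(1,2) G by (intro gen_eq_base) (auto simp: joined_by_def)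
      then show ?thesis unfolding ab(3,4)
        using gen_eq_trans[OF gen_eq_sym[OF pick_eq] gen_eq_trans[OF _ pick_eq]] by blast
    qed
    show "((SOME y. y \<in> ?f x), x) \<in> gen_eq (verts G) ?R" for x using gen_eq_sym[OF pick_eq] .
    show "(?f (SOME y. y \<in> X), X) \<in> gen_eq (verts ?H) ?R'" if X: "X \<in> verts ?H" for X
    proof -
      obtain x where x: "X = ?f x" using H X by auto
      have "?f x = ?f (SOME y. y \<in> ?f x)"
        unfolding gen_eq_class_eq_iff using pick[of x] by (rule ImageE) simp
      then show ?thesis unfolding x by (metis gen_eq_refl)
    qed
  qed
  then show ?thesis by (simp add: num_components_def)
qed

section \<open>The effect of each operation on the genus\<close>

context represented_map
begin

lemma ends_subset:
  assumes "e \<in> edges G"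
  shows "ends G e \<subseteq> verts G"
proof -
  obtain x where x: "x \<in> N" "e = \<psi> x" using assms edges_eq by auto
  then show ?thesis using ends_eq[OF x(1)] subsetD[OF label_verts imageI] opp_in by simp
qed

lemma finite_edges: "finite (edges G)"
  using edges_eq fin by simp

lemma card_edges_minus: "e1 \<in> edges G \<Longrightarrow> e2 \<in> edges G \<Longrightarrow> e1 \<noteq> e2 \<Longrightarrow> card (edges G) = card (edges G - {e1, e2}) + 2"
  using card_Diff_subset[of "{e1, e2}" "edges G"] card_mono[OF finite_edges, of "{e1, e2}"] by simp

text \<open>Both edges contain \<open>v\<close>, so their ends collapse to a single vertex and the
  other vertices stay as they are.\<close>

lemma card_verts_contract:
  assumes e: "e1 \<in> edges G" "e2 \<in> edges G" and v: "v \<in> ends G e1" "v \<in> ends G e2"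
  shows "card (verts (contract_edges G {e1, e2})) + card (ends G e1 \<union> ends G e2) = card (verts G) + 1"
proof -
  let ?W = "ends G e1 \<union> ends G e2" and ?f = "\<lambda>x. gen_eq (verts G) (joined_by G {e1, e2}) `` {x}"
  have W: "?W \<subseteq> verts G" using e ends_subset by blast
  have f: "?f x = ?f y \<longleftrightarrow> x = y \<or> x \<in> ?W \<and> y \<in> ?W" for x y
    unfolding gen_eq_class_eq_iff by (rule gen_eq_contract[OF W v])
  have "verts (contract_edges G {e1, e2}) = ?f ` verts G"
    using contract_edges_quotient[OF ends_subset] unfolding quotient_by_def by blast
  also have "\<dots> = insert (?f v) (?f ` (verts G - ?W))"
  proof
    show "?f ` verts G \<subseteq> insert (?f v) (?f ` (verts G - ?W))"
    proof
      fix X assume "X \<in> ?f ` verts G"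
      then obtain x where x: "x \<in> verts G" "X = ?f x" by auto
      show "X \<in> insert (?f v) (?f ` (verts G - ?W))"
      proof (cases "x \<in> ?W")
        case True
        then have "X = ?f v" using f[of x v] x(2) v by simp
        then show ?thesis by simp
      qed (use x in blast)
    qed
  qed (use W v in blast)
  also have "card \<dots> = card (verts G - ?W) + 1"
  proof -
    have "inj_on ?f (verts G - ?W)" using f by (auto simp: inj_on_def)
    moreover have "?f v \<notin> ?f ` (verts G - ?W)"
    proof
      assume "?f v \<in> ?f ` (verts G - ?W)"
      then obtain x where "x \<in> verts G - ?W" "?f v = ?f x" by blast
      then show False using f[of v x] v by auto
    qed
    ultimately show ?thesis using finite_verts by (simp add: card_image)
  qed
  finally show ?thesis
    using card_Diff_subset[OF finite_subset[OF W finite_verts] W] card_mono[OF finite_verts W] by simp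
qed

text \<open>The contraction arises from the deletion by identifying \<open>u\<close> and
  \<open>v\<close>, which lie in different components there. Compared with \<open>G\<close>, the
  vertices and the count drop by one each, the edges by two, and the components stay, so all changes
  cancel.\<close>

lemma turaev_genus_contract_parallel:
  assumes par: "parallel_edges G e1 e2" and uv: "ends G e1 = {u, v}"
    and sep: "(u, v) \<notin> gen_eq (verts G) (joined_by G (edges G - {e1, e2}))"
  shows "turaev_genus (contract_edges G {e1, e2}) = turaev_genus G"
proof -
  let ?D = "delete_edges G {e1, e2}" and ?H = "contract_edges G {e1, e2}"
  let ?f = "\<lambda>x. gen_eq (verts G) (joined_by G {e1, e2}) `` {x}"
  have e: "e1 \<in> edges G" "e2 \<in> edges G" "e1 \<noteq> e2" "ends G e1 = ends G e2"
    using par by (auto simp: parallel_edges_def)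
  have W: "ends G e1 \<union> ends G e2 = {u, v}" using e uv by simp
  have ue: "u \<in> ends G e1" "u \<in> ends G e2" unfolding e(4)[symmetric] uv by simp_all
  have uvV: "u \<in> verts G" "v \<in> verts G" using ends_subset[OF e(1)] uv by auto
  have "u \<noteq> v" using sep by auto
  note n = curve_count_delete[OF par]
  have D: "verts ?D = verts G" "edges ?D = edges G - {e1, e2}" "ends ?D = ends G" by (simp_all add: delete_edges_def)
  obtain N' p' q' s' \<phi>' \<psi>' where R: "represented_map N' p' q' s' \<phi>' \<psi>' ?D"
    and n': "petrie N \<sigma> \<tau> + card (verts G - \<phi> ` N) = petrie N' p' q' + card (verts ?D - \<phi>' ` N')"
    using n by (rule curve_countE)
  interpret R: represented_map N' p' q' s' \<phi>' \<psi>' ?D by fact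
  have "quotient_by ?f {} ?D ?H"
    using contract_edges_quotient[OF ends_subset, of "{e1, e2}"] unfolding quotient_by_def D by auto
  moreover have "?f x = ?f y \<longleftrightarrow> x = y \<or> x \<in> {u, v} \<and> y \<in> {u, v}" for x y
    unfolding gen_eq_class_eq_iff using gen_eq_contract[of G e1 e2 u, OF _ ue, unfolded W] uvV by simp
  moreover have "(u, v) \<notin> gen_eq (verts ?D) (joined_by ?D (edges ?D))"
    using sep by (simp add: D joined_by_def)
  ultimately obtain m where m: "curve_count ?H m" "m + 1 = petrie N \<sigma> \<tau> + card (verts G - \<phi> ` N)"
    using R.curve_count_merge[of u v ?f ?H] uvV n' unfolding D by metis
  have "card (verts ?H) + 1 = card (verts G)"
    using card_verts_contract[OF e(1,2) ue] \<open>u \<noteq> v\<close> unfolding W by simp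
  moreover have "num_components ?H = num_components G"
    by (rule num_components_contract[OF ends_subset]) (use e in auto)
  moreover have "card (edges G) = card (edges ?H) + 2"
    using card_edges_minus[OF e(1-3)] by (simp add: contract_edges_def)
  ultimately have "2 * turaev_genus ?H = 2 * turaev_genus G"
    using turaev_genus_eq[OF m(1)] turaev_genus_eq[OF petrie_count] m(2)[symmetric] by simp
  then show ?thesis by simp
qed

lemma turaev_genus_no_edges:
  assumes "edges G = {}"
  shows "turaev_genus G = 0"
proof -
  have "N = {}" using assms edges_eq by simp
  then show ?thesis
    using turaev_genus_eq[OF petrie_count] num_components_eq assms by (simp add: gen_classes_eq)
qed

text \<open>Deletion keeps vertices and count and removes two edges. Twice the genus therefore drops
  by two and grows by two for every new component.\<close>

lemma turaev_genus_parallel: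
  assumes par: "parallel_edges G e1 e2"
  shows "num_components G = num_components (delete_edges G {e1, e2}) \<Longrightarrow>
      turaev_genus (delete_edges G {e1, e2}) = turaev_genus G - 1"
    and "num_components (delete_edges G {e1, e2}) = num_components G + 1 \<Longrightarrow>
      turaev_genus (delete_edges G {e1, e2}) = turaev_genus (contract_edges G {e1, e2}) \<and>
      turaev_genus (contract_edges G {e1, e2}) = turaev_genus G"
proof -
  let ?D = "delete_edges G {e1, e2}"
  have e: "e1 \<in> edges G" "e2 \<in> edges G" "e1 \<noteq> e2" "ends G e1 = ends G e2"
    using par by (auto simp: parallel_edges_def)
  have D: "verts ?D = verts G" "edges ?D = edges G - {e1, e2}" by (simp_all add: delete_edges_def)
  have eq: "2 * turaev_genus ?D = 2 * turaev_genus G +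
      2 * of_int (int (num_components ?D) - int (num_components G)) - 2"
    using turaev_genus_eq[OF curve_count_delete[OF par]] turaev_genus_eq[OF petrie_count] card_edges_minus[OF e(1-3)]
    unfolding D by simp
  show "num_components G = num_components ?D \<Longrightarrow> turaev_genus ?D = turaev_genus G - 1"
    using eq by simp
  assume k: "num_components ?D = num_components G + 1"
  obtain x where x: "x \<in> N" "\<psi> x = e1" using e edges_eq by auto
  let ?u = "\<phi> x" and ?v = "\<phi> (\<tau> x)"
  let ?J = "joined_by G (edges G - {e1, e2})"
  have uv: "ends G e1 = {?u, ?v}" using ends_eq x by auto
  have "(?u, ?v) \<notin> gen_eq (verts G) ?J"
  proof
    assume uvJ: "(?u, ?v) \<in> gen_eq (verts G) ?J"
    \<comment> \<open>If the ends were still connected, the deleted edges would be redundant for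
      connectivity and no component could be gained.\<close>
    have "ncl (verts G) ?J \<le> ncl (verts G) (joined_by G (edges G))"
    proof (rule ncl_mono[OF finite_verts])
      fix a b assume ab: "(a, b) \<in> joined_by G (edges G)" "a \<in> verts G" "b \<in> verts G"
      then obtain e where h: "e \<in> edges G" "a \<in> ends G e" "b \<in> ends G e" by (auto simp: joined_by_def)
      show "(a, b) \<in> gen_eq (verts G) ?J"
      proof (cases "e \<in> {e1, e2}")
        case True
        then have "a \<in> {?u, ?v}" "b \<in> {?u, ?v}" using h e uv by auto
        then show ?thesis
          by (elim insertE emptyE) (use uvJ gen_eq_sym[OF uvJ] in simp_all)
      next
        case False
        then show ?thesis using h ab by (intro gen_eq_base) (auto simp: joined_by_def)
      qed
    qed
    then show False using k by (simp add: num_components_def D delete_edges_def joined_by_def)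
  qed
  then show "turaev_genus ?D = turaev_genus (contract_edges G {e1, e2}) \<and>
      turaev_genus (contract_edges G {e1, e2}) = turaev_genus G"
    using turaev_genus_contract_parallel[OF par uv] eq k by simp
qed

text \<open>If the two edges are parallel, \<open>v\<close> has no other edge and is separated by
  their deletion, which is the separating case of parallel edges. Otherwise three vertices become
  one, so vertices and edges both drop by two while count and components stay.\<close>

lemma turaev_genus_degree_two:
  assumes v: "degree G v = 2" and e: "e1 \<in> edges G" "e2 \<in> edges G" "e1 \<noteq> e2" and ve: "v \<in> ends G e1" "v \<in> ends G e2"
  shows "turaev_genus (contract_edges G {e1, e2}) = turaev_genus G"
proof -
  let ?H = "contract_edges G {e1, e2}"
  obtain c where c: "c \<in> N" "\<psi> c = e1" "\<phi> c = v" using dart_of_edge e ve by metis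
  obtain d where d: "d \<in> N" "\<psi> d = e2" "\<phi> d = v" using dart_of_edge e ve by metis
  have e1: "ends G e1 = {v, \<phi> (\<tau> c)}" "v \<noteq> \<phi> (\<tau> c)"
    using ends_eq[OF c(1)] label_loop[OF c(1)] unfolding c(2,3) by simp_all
  have e2: "ends G e2 = {v, \<phi> (\<tau> d)}" "v \<noteq> \<phi> (\<tau> d)"
    using ends_eq[OF d(1)] label_loop[OF d(1)] unfolding d(2,3) by simp_all
  show ?thesis
  proof (cases "ends G e1 = ends G e2")
    case True
    then have par: "parallel_edges G e1 e2" using e by (simp add: parallel_edges_def)
    have sub: "{e1, e2} \<subseteq> {e \<in> edges G. v \<in> ends G e}" using e ve by auto
    have fe: "finite {e \<in> edges G. v \<in> ends G e}" using finite_edges by simp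
    have "card {e \<in> edges G. v \<in> ends G e} \<le> card {e1, e2}" using v e(3) unfolding degree_def by simp
    then have "{e1, e2} = {e \<in> edges G. v \<in> ends G e}" by (rule card_seteq[OF fe sub])
    then have iso: "v \<notin> ends G e" if "e \<in> edges G - {e1, e2}" for e using that by blast
    have "(v, \<phi> (\<tau> c)) \<notin> gen_eq (verts G) (joined_by G (edges G - {e1, e2}))"
    proof
      assume "(v, \<phi> (\<tau> c)) \<in> gen_eq (verts G) (joined_by G (edges G - {e1, e2}))"
      then have "(v = v) = (\<phi> (\<tau> c) = v)"
        by (rule gen_eq_invariant) (use iso in \<open>auto simp: joined_by_def\<close>)
      then show False using e1(2) by simp
    qed
    then show ?thesis using turaev_genus_contract_parallel[OF par e1(1)] by simp
  next
    case False
    let ?f = "\<lambda>x. gen_eq (verts G) (joined_by G {e1, e2}) `` {x}"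
    have "?f x = ?f y \<longleftrightarrow> x = y \<or> x \<in> ends G e1 \<union> ends G e2 \<and> y \<in> ends G e1 \<union> ends G e2" for x y
      unfolding gen_eq_class_eq_iff using ends_subset e ve by (intro gen_eq_contract[of G e1 e2 v]) auto
    then have n: "curve_count ?H (petrie N \<sigma> \<tau> + card (verts G - \<phi> ` N))"
      using curve_count_degree_two[OF v e ve False contract_edges_quotient[OF ends_subset]] by blast
    have "\<phi> (\<tau> c) \<noteq> \<phi> (\<tau> d)" using False e1 e2 by auto
    then have "card (ends G e1 \<union> ends G e2) = 3" unfolding e1 e2 using e1(2) e2(2) by (simp add: insert_commute)
    then have "card (verts ?H) + 2 = card (verts G)"
      using card_verts_contract[OF e(1,2) ve] by simp
    moreover have "num_components ?H = num_components G"
      by (rule num_components_contract[OF ends_subset]) (use e in auto)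
    moreover have "card (edges G) = card (edges ?H) + 2"
      using card_edges_minus[OF e] by (simp add: contract_edges_def)
    ultimately have "2 * turaev_genus ?H = 2 * turaev_genus G"
      using turaev_genus_eq[OF n] turaev_genus_eq[OF petrie_count] by simp
    then show ?thesis by simp
  qed
qed

end

theorem corollary3p9:
  fixes G :: "('v, 'e) mgraph"
  assumes "alternating_decomposition_graph G"
  shows "(edges G = {} \<longrightarrow> turaev_genus G = 0) \<and>
    (\<forall>e1 e2. parallel_edges G e1 e2 \<longrightarrow>
      (let G' = delete_edges G {e1, e2};
           G'' = contract_edges G {e1, e2}
       in (num_components G = num_components G' \<longrightarrow> turaev_genus G' = turaev_genus G - 1) \<and>
          (num_components G' = num_components G + 1 \<longrightarrow>
             turaev_genus G' = turaev_genus G'' \<and> turaev_genus G'' = turaev_genus G))) \<and>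
    (\<forall>v e1 e2. v \<in> verts G \<and> degree G v = 2 \<and>
        e1 \<in> edges G \<and> e2 \<in> edges G \<and> e1 \<noteq> e2 \<and> v \<in> ends G e1 \<and> v \<in> ends G e2 \<longrightarrow>
      (let G' = contract_edges G {e1, e2}
       in turaev_genus G' = turaev_genus G))"
proof -
  obtain n where "curve_count G n"
    using assms has_ad_graph_genus unfolding alternating_decomposition_graph_def by blast
  then obtain N p q s \<phi> \<psi> where "represented_map N p q s \<phi> \<psi> G"
    by (rule curve_countE)
  then interpret represented_map N p q s \<phi> \<psi> G .
  show ?thesis
    unfolding Let_def
    using turaev_genus_no_edges turaev_genus_parallel turaev_genus_degree_two by blast
qed

end
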